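(* Let $B,\gamma,\gamma_0>0$ and let $$\epsilon_0:=\frac{e^{-3/2}}{\sqrt2\,(1+B)}>0 .$$ Let $\beta\in\mathcal C^0([0,1],\mathbb R)$ with $\|\beta\|_\infty\le B$. For every $\epsilon\in(0,\epsilon_0)$ and every neural operator $\hat{\mathcal K}$ of accuracy $\epsilon$ on $H$, consider the plant $$u_t(x,t)=u_x(x,t)+\beta(x)u(0,t),\quad (x,t)\in[0,1)\times\mathbb R^+,\qquad u(1,t)=U(t),$$ in feedback with the adaptive control law $$U(t)=\int_0^1\hat k(1-y,t)\,\hat u(y,t)\,dy,\qquad \hat k(\cdot,t)=\hat{\mathcal K}(\hat\beta(\cdot,t)),$$ along with the update law $$\hat\beta_t(x,t)=\mathrm{Proj}\big(\tau(x,t),\hat\beta(x,t)\big),\qquad \tau(x,t)=\gamma\,(u(x,t)-\hat u(x,t))\,u(0,t),$$ with any Lipschitz initial condition $\hat\beta_0=\hat\beta(\cdot,0)$ such that $\|\hat\beta_0\|_\infty\le B$, and the passive observer $$\hat u_t(x,t)=\hat u_x(x,t)+\hat\beta(x,t)u(0,t)+\gamma_0\,(u(x,t)-\hat u(x,t))\,u^2(0,t),\qquad \hat u(1,t)=U(t),$$ with any initial condition $\hat u_0=\hat u(\cdot,0)$ such that $\|\hat u_0\|<\infty$. Then all solutions for which $\hat\beta(\cdot,t)$ remains $K$-Lipschitz for all time satisfy $$\|u\|,\ \|\hat u\|,\ \|u\|_\infty,\ \|\hat u\|_\infty\in\mathcal L_2\cap\mathcal L_\infty,$$ $$\|u(\cdot,t)\|_\infty\to0,\qquad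 \|\hat u(\cdot,t)\|_\infty\to0\qquad\text{as }t\to\infty .$$ Additionally, there are constants $\rho,R>0$, not depending on the particular solution, such that the following global stability estimate for the equilibrium $(u,\hat u,\hat\beta)=(0,0,\beta)$ holds: $$S(t)\le R\,S(0)\,e^{\rho S(0)},\quad t\ge0,\qquad\text{where } S:=\|u\|^2+\|\hat u\|^2+\|\tilde\beta\|^2,\quad \tilde\beta:=\beta-\hat\beta .$$
   Context: Notation: $\mathbb R^+=[0,\infty)$; subscripts $t,x$ denote partial derivatives; $(a*b)(x)=\int_0^x a(x-y)b(y)\,dy$. For a function $a(x,t)$, $\|a(t)\|=\big(\int_0^1a^2(x,t)\,dx\big)^{1/2}$ is the spatial $L^2$ norm and $\|a\|_\infty$ at time $t$ is the spatial supremum norm; both are regarded as functions of $t$, and $\mathcal L_2,\mathcal L_\infty$ are the usual spaces of functions of $t\in[0,\infty)$. The set $H$: fix constants $M\ge B$ and $K>0$ (which may be as large as required). $H$ is the set of $\alpha\in\mathcal C^0([0,1],\mathbb R)$ with $\|\alpha\|_\infty\le M$ that are $K$-Lipschitz, with the supremum norm. Exact kernel operator: for $\varphi\in\mathcal C^0([0,1],\mathbb R)$, $\mathcal K(\varphi)$ is the unique continuous solution $k$ on $[0,1]$ of the Volterra equation $k=-\varphi+\varphi*k$. Neural operator of accuracy $\epsilon$ on $H$: a DeepONet $\hat{\mathcal K}$ mapping $H$ into continuous functions on $[0,1]$ such that $|\mathcal K(\varphi)(x)-\hat{\mathcal K}(\varphi)(x)|<\epsilon$ for all $\varphi\in H$,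 $x\in[0,1]$. A DeepONet is an operator of the form $u\mapsto\big(y\mapsto\sum_{k=1}^p g^{\mathcal N}(\mathbf u_m;v^{(k)})f^{\mathcal N}(y;\theta^{(k)})\big)$, where $\mathbf u_m=(u(x_1),\dots,u(x_m))$ are samples of the input function at finitely many points and $g^{\mathcal N}(\cdot;v^{(k)}),f^{\mathcal N}(\cdot;\theta^{(k)})$ are neural networks. Projection: $\mathrm{Proj}(a,b)=0$ if $|b|=B$ and $ab>0$, and $\mathrm{Proj}(a,b)=a$ otherwise. Since Proj is discontinuous, solutions are understood in the Filippov sense.
   Formalization: For merely L2 initial data sup norms can be infinite for t<1, so their membership in L2∩L∞ is claimed on [1,∞), and on [0,∞) if the initial sup norms of u and û are finite; solutions are required to keep |β̂|≤B, the domain of the projection. *)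

theory Defs
  imports "HOL-Analysis.Analysis"
begin

text \<open>Functions of the space variable are only looked at on the interval from 0 to 1; a function
  \<open>a(x,t)\<close> is written \<open>a x t\<close>.\<close>

definition square_integrable_on :: "(real \<Rightarrow> real) \<Rightarrow> real set \<Rightarrow> bool"
    (infixr "square'_integrable'_on" 46) where
  "f square_integrable_on S \<longleftrightarrow>
     f \<in> borel_measurable (lebesgue_on S) \<and> (\<lambda>x. (f x)\<^sup>2) integrable_on S"

definition l2_norm :: "(real \<Rightarrow> real) \<Rightarrow> real" where
  "l2_norm a = sqrt (integral {0..1} (\<lambda>x. (a x)\<^sup>2))"

text \<open>Extended-valued, so that the norm of an unbounded function is infinite.\<close>

definition sup_norm :: "(real \<Rightarrow> real) \<Rightarrow> ennreal" where
  "sup_norm a = (SUP x\<in>{0..1}. ennreal \<bar>a x\<bar>)"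

text \<open>The spaces \<open>L\<^sub>2\<close> and \<open>L\<^sub>\<infinity>\<close> of nonnegative functions of time on \<open>S\<close>.\<close>

definition L2_time :: "real set \<Rightarrow> (real \<Rightarrow> ennreal) set" where
  "L2_time S = {f \<in> borel_measurable (lebesgue_on S). (\<integral>\<^sup>+ t. (f t)\<^sup>2 \<partial>lebesgue_on S) < \<infinity>}"

definition Linf_time :: "real set \<Rightarrow> (real \<Rightarrow> ennreal) set" where
  "Linf_time S =
     {f \<in> borel_measurable (lebesgue_on S). \<exists>C::real. AE t in lebesgue_on S. f t \<le> ennreal C}"

definition admissible_set :: "real \<Rightarrow> real \<Rightarrow> (real \<Rightarrow> real) set" where
  "admissible_set M K =
     {\<phi>. continuous_on {0..1} \<phi> \<and> sup_norm \<phi> \<le> ennreal M \<and> K-lipschitz_on {0..1} \<phi>}"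

text \<open>The value 0 off the unit interval only serves to make the solution unique as a
  function on the whole real line.\<close>

definition kernel_op :: "(real \<Rightarrow> real) \<Rightarrow> real \<Rightarrow> real" where
  "kernel_op \<phi> =
     (THE k. continuous_on {0..1} k \<and>
             (\<forall>x\<in>{0..1}. k x = - \<phi> x + integral {0..x} (\<lambda>y. \<phi> (x - y) * k y)) \<and>
             (\<forall>x. x \<notin> {0..1} \<longrightarrow> k x = 0))"

text \<open>Feedforward networks with activation function \<open>\<sigma>\<close>, \<open>m\<close> inputs and \<open>n\<close> outputs.
  Vectors are functions on the naturals of which only the first \<open>m\<close> (resp. \<open>n\<close>) entries matter.
  Affine maps and activations are separate steps, so that the output layer may or may
  not be activated.\<close>

inductive neural_network ::
    "(real \<Rightarrow> real) \<Rightarrow> nat \<Rightarrow> nat \<Rightarrow> ((nat \<Rightarrow> real) \<Rightarrow> nat \<Rightarrow> real) \<Rightarrow> bool"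
  for \<sigma> :: "real \<Rightarrow> real" and m :: nat where
  input: "neural_network \<sigma> m m (\<lambda>h. h)"
| affine: "neural_network \<sigma> m n N \<Longrightarrow>
    neural_network \<sigma> m q (\<lambda>h i. (\<Sum>j<n. W i j * N h j) + b i)"
| activation: "neural_network \<sigma> m n N \<Longrightarrow> neural_network \<sigma> m n (\<lambda>h i. \<sigma> (N h i))"

definition deeponet_on ::
    "(real \<Rightarrow> real) set \<Rightarrow> (real \<Rightarrow> real) \<Rightarrow> ((real \<Rightarrow> real) \<Rightarrow> real \<Rightarrow> real) \<Rightarrow> bool" where
  "deeponet_on H \<sigma> F \<longleftrightarrow>
     (\<exists>(m::nat) (p::nat) (z :: nat \<Rightarrow> real) g f.
        (\<forall>i<m. z i \<in> {0..1}) \<and>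
        (\<forall>k<p. neural_network \<sigma> m 1 (g k) \<and> neural_network \<sigma> 1 1 (f k)) \<and>
        (\<forall>\<phi>\<in>H. \<forall>y\<in>{0..1}. F \<phi> y = (\<Sum>k<p. g k (\<lambda>i. \<phi> (z i)) 0 * f k (\<lambda>i. y) 0)))"

definition neural_operator ::
    "(real \<Rightarrow> real) set \<Rightarrow> (real \<Rightarrow> real) \<Rightarrow> real \<Rightarrow> ((real \<Rightarrow> real) \<Rightarrow> real \<Rightarrow> real) \<Rightarrow> bool" where
  "neural_operator H \<sigma> \<epsilon> F \<longleftrightarrow>
     deeponet_on H \<sigma> F \<and>
     (\<forall>\<phi>\<in>H. continuous_on {0..1} (F \<phi>) \<and> (\<forall>x\<in>{0..1}. \<bar>kernel_op \<phi> x - F \<phi> x\<bar> < \<epsilon>))"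

definition Proj :: "real \<Rightarrow> real \<Rightarrow> real \<Rightarrow> real" where
  "Proj B a b = (if \<bar>b\<bar> = B \<and> a * b > 0 then 0 else a)"

text \<open>Convexification of a discontinuous right-hand side \<open>f\<close> living on the domain \<open>D\<close>. No
  null sets are removed from the balls: \<^const>\<open>Proj\<close> differs from its first argument only where
  \<open>\<bar>b\<bar> = B\<close>, which is a null set, so that removing null sets would remove the projection.\<close>

definition filippov :: "real set \<Rightarrow> (real \<Rightarrow> real) \<Rightarrow> real \<Rightarrow> real set" where
  "filippov D f b = (\<Inter>\<delta>\<in>{0<..}. closure (convex hull (f ` (D \<inter> ball b \<delta>))))"

text \<open>\<open>g\<close> is locally absolutely continuous on the interval \<open>I\<close> and its derivative
  is \<open>v\<close> almost everywhere.\<close>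

definition ac_deriv_on :: "(real \<Rightarrow> real) \<Rightarrow> (real \<Rightarrow> real) \<Rightarrow> real set \<Rightarrow> bool" where
  "ac_deriv_on g v I \<longleftrightarrow>
     (\<forall>a\<in>I. \<forall>b\<in>I. a \<le> b \<longrightarrow> v absolutely_integrable_on {a..b} \<and> g b - g a = integral {a..b} v)"

text \<open>\<open>w\<^sub>t = w\<^sub>x + f\<close> on the strip \<open>0 \<le> x \<le> 1\<close>, \<open>t \<ge> 0\<close>, along the characteristics
  \<open>x + t = \<xi>\<close>, on which \<open>w\<^sub>t - w\<^sub>x\<close> is the derivative of \<open>t \<mapsto> w(\<xi> - t, t)\<close>.\<close>

definition transport_solution :: "(real \<Rightarrow> real \<Rightarrow> real) \<Rightarrow> (real \<Rightarrow> real \<Rightarrow> real) \<Rightarrow> bool" where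
  "transport_solution w f \<longleftrightarrow>
     (\<forall>\<xi>\<ge>0. ac_deriv_on (\<lambda>t. w (\<xi> - t) t) (\<lambda>t. f (\<xi> - t) t) {max 0 (\<xi> - 1)..\<xi>})"

definition control_law ::
    "((real \<Rightarrow> real) \<Rightarrow> real \<Rightarrow> real) \<Rightarrow> (real \<Rightarrow> real \<Rightarrow> real) \<Rightarrow> (real \<Rightarrow> real \<Rightarrow> real) \<Rightarrow> real \<Rightarrow> real"
  where
  "control_law Khat uh bh t = integral {0..1} (\<lambda>y. Khat (\<lambda>x. bh x t) (1 - y) * uh y t)"

text \<open>Here \<open>uh\<close> and \<open>bh\<close> are the observer state and the parameter estimate. The bound on
  \<open>bh\<close> expresses that \<open>[-B,B]\<close> is the domain of the projected update law: the formula for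
  \<^const>\<open>Proj\<close> does not act when \<open>\<bar>b\<bar> > B\<close>, and without the bound a solution could leave the
  interval through its end points.\<close>

definition closed_loop_solution ::
    "real \<Rightarrow> real \<Rightarrow> real \<Rightarrow> (real \<Rightarrow> real) \<Rightarrow> ((real \<Rightarrow> real) \<Rightarrow> real \<Rightarrow> real) \<Rightarrow>
     (real \<Rightarrow> real \<Rightarrow> real) \<Rightarrow> (real \<Rightarrow> real \<Rightarrow> real) \<Rightarrow> (real \<Rightarrow> real \<Rightarrow> real) \<Rightarrow> bool" where
  "closed_loop_solution B \<gamma> \<gamma>\<^sub>0 \<beta> Khat u uh bh \<longleftrightarrow>
     \<comment> \<open>state space, trace at \<open>x = 0\<close>, initial condition of the estimate\<close>
     (\<forall>t\<ge>0. (\<lambda>x. u x t) square_integrable_on {0..1}) \<and>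
     (\<forall>t\<ge>0. (\<lambda>x. uh x t) square_integrable_on {0..1}) \<and>
     (\<forall>T\<ge>0. (\<lambda>t. u 0 t) square_integrable_on {0..T}) \<and>
     (\<forall>t\<ge>0. sup_norm (\<lambda>x. bh x t) \<le> ennreal B) \<and>
     (\<exists>L. L-lipschitz_on {0..1} (\<lambda>x. bh x 0)) \<and>
     \<comment> \<open>plant\<close>
     transport_solution u (\<lambda>x t. \<beta> x * u 0 t) \<and>
     (\<forall>t\<ge>0. u 1 t = control_law Khat uh bh t) \<and>
     \<comment> \<open>observer\<close>
     transport_solution uh
       (\<lambda>x t. bh x t * u 0 t + \<gamma>\<^sub>0 * (u x t - uh x t) * (u 0 t)\<^sup>2) \<and>
     (\<forall>t\<ge>0. uh 1 t = control_law Khat uh bh t) \<and>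
     \<comment> \<open>update law\<close>
     (\<forall>x\<in>{0..1}. \<exists>v. ac_deriv_on (\<lambda>t. bh x t) v {0..} \<and>
        (AE t in lebesgue_on {0..}.
           v t \<in> filippov {-B..B} (Proj B (\<gamma> * (u x t - uh x t) * u 0 t)) (bh x t)))"

definition S_fun ::
    "(real \<Rightarrow> real) \<Rightarrow> (real \<Rightarrow> real \<Rightarrow> real) \<Rightarrow> (real \<Rightarrow> real \<Rightarrow> real) \<Rightarrow> (real \<Rightarrow> real \<Rightarrow> real) \<Rightarrow>
     real \<Rightarrow> real" where
  "S_fun \<beta> u uh bh t =
     (l2_norm (\<lambda>x. u x t))\<^sup>2 + (l2_norm (\<lambda>x. uh x t))\<^sup>2 + (l2_norm (\<lambda>x. \<beta> x - bh x t))\<^sup>2"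

end

theory Submission
  imports Defs
begin

text \<open>Write \<open>e = u - uh\<close>, \<open>v(t) = u(0,t)\<close> and \<open>bt = \<beta> - bh\<close>. The whole argument runs along the
  characteristics \<open>x + t = \<xi>\<close>; no derivative of a kernel and no energy of a target system is needed.

  The error \<open>e\<close> vanishes at \<open>x = 1\<close> and solves a damped equation driven by \<open>bt v\<close>, hence it is jointly
  continuous for \<open>t \<ge> 1\<close>. There the Lyapunov function \<open>\<parallel>e\<parallel>\<^sup>2 + \<parallel>bt\<parallel>\<^sup>2 / \<gamma>\<close> decreases and dissipates
  \<open>e(0,\<cdot>)\<^sup>2\<close> and \<open>\<parallel>e\<parallel>\<^sup>2 v\<^sup>2\<close>.

  The observer equation, integrated along the characteristics that start at time \<open>t\<close>, expresses
  \<open>v(t+\<cdot>) - bh(\<cdot>,t) * v(t+\<cdot>)\<close> on \<open>[0,1]\<close> as \<open>uh(\<cdot>,t) + e(0,t+\<cdot>) + P\<close>, where \<open>P\<close> is controlled by a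
  dissipated quantity times \<open>v\<close>. Convolving with the resolvent \<open>\<delta> - k\<close> recovers \<open>v(t+1)\<close>, and the control
  law cancels everything except \<open>(khat - k) * uh\<close>. So \<open>v(t+1)\<close> is at most \<open>\<epsilon> (1 + B)\<close> times the mean of
  \<open>\<bar>v\<bar>\<close> over \<open>[t,t+1]\<close>, up to dissipated terms; a Gronwall argument for \<open>\<integral> v\<^sup>2\<close> gives
  \<open>\<integral> v\<^sup>2 \<le> C S(0) exp (\<rho> S(0))\<close>, and \<open>u\<close> and \<open>uh\<close> are bounded by \<open>v\<close> on a window of length three.
  On \<open>[0,1]\<close> crude bounds suffice, because \<open>bt\<close> is bounded by \<open>2 B\<close>.\<close>

section \<open>Absolutely continuous functions and integral inequalities\<close>

text \<open>The initial data are only square integrable, so the error need not be continuous at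
  early times. After one time unit every characteristic in the strip has started at x = 1, where the
  error vanishes; hence the split at time 1, and the need to bound the Lyapunov function at time 1
  by S(0). The delay equation comes from freezing the estimate at the start of a unit window. The
  update law moves \<open>bh\<close> at a rate of at most \<gamma> times the modulus of e v, so
  freezing costs a product of \<open>v\<close> with a dissipated quantity. That quantity need not be
  small, but the damping term with \<open>\<gamma>\<^sub>0\<close> in the observer makes it
  integrable in time, which is all that a Gronwall weight has to satisfy. Its total mass is at most
  a multiple of V(1), and this is the source of the exponential in S(0). The delayed term itself has
  no such integrable factor: its coefficient must be small enough to be absorbed, and the threshold
  on \<epsilon> serves this purpose. The adaptation enters twice more: the update law cancels the
  cross term between e and \<open>bt\<close> in the Lyapunov function, and the projection keeps the
  estimate in the set where the neural operator is accurate.\<close>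

lemmas absolutely_integrable_integrable = set_lebesgue_integral_eq_integral(1)

lemma absolutely_integrable_on_subinterval:
  fixes f :: "real \<Rightarrow> real"
  assumes "f absolutely_integrable_on {a..b}" "{c..d} \<subseteq> {a..b}"
  shows "f absolutely_integrable_on {c..d}"
  using assms(1) _ assms(2) by (rule set_integrable_subset) simp

lemma absolutely_integrable_continuous_mult:
  fixes f g :: "real \<Rightarrow> real"
  assumes g: "continuous_on {a..b} g" and f: "f absolutely_integrable_on {a..b}"
  shows "(\<lambda>x. g x * f x) absolutely_integrable_on {a..b}"
proof (rule absolutely_integrable_bounded_measurable_product_real[OF _ _ _ f])
  show "g \<in> borel_measurable (lebesgue_on {a..b})"
    by (simp add: continuous_imp_measurable_on_sets_lebesgue g)
  show "bounded (g ` {a..b})"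
    by (simp add: compact_continuous_image compact_imp_bounded g)
qed auto

lemma integral_abs_bound_integral:
  fixes f g :: "real \<Rightarrow> real"
  assumes "f integrable_on S" "g integrable_on S" "\<And>x. x \<in> S \<Longrightarrow> \<bar>f x\<bar> \<le> g x"
  shows "\<bar>integral S f\<bar> \<le> integral S g"
  using integral_norm_bound_integral[of f S g] assms by auto

lemma continuous_on_indefinite_integral:
  fixes f :: "real \<Rightarrow> real"
  assumes "f absolutely_integrable_on {a..b}"
  shows "continuous_on {a..b} (\<lambda>t. integral {a..t} f)"
  using assms absolutely_integrable_on_def indefinite_integral_continuous_1 by blast

lemma continuous_on_halfline:
  fixes f :: "real \<Rightarrow> real"
  assumes "\<And>T. T \<ge> 0 \<Longrightarrow> continuous_on {0..T} f"
  shows "continuous_on {0..} f"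
  unfolding continuous_on_eq_continuous_within
proof
  fix t :: real assume t: "t \<in> {0..}"
  have "continuous (at t within {0..t+1}) f"
    using assms[of "t+1"] t by (auto simp: continuous_on_eq_continuous_within)
  moreover have "at t within {0..t+1} = at t within {0..}"
    by (rule at_within_nhd[of _ "{..<t+1}"]) (use t in auto)
  ultimately show "continuous (at t within {0..}) f" by (simp add: continuous_within)
qed

text \<open>Telescoping over short pieces turns the local inequality into a global one, and
  \<open>e\<close> is arbitrary. This replaces the argument that a function with derivative zero is
  constant; it never differentiates \<open>D\<close>, which is what makes it suitable for absolutely
  continuous functions.\<close>

lemma constant_if_locally_small_increments:
  fixes D n :: "real \<Rightarrow> real"
  assumes ab: "a \<le> b" and n: "\<And>s t. a \<le> s \<Longrightarrow> s \<le> t \<Longrightarrow> t \<le> b \<Longrightarrow> n s \<le> n t"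
    and loc: "\<And>e. e > 0 \<Longrightarrow> \<exists>d>0. \<forall>s t. a \<le> s \<and> s \<le> t \<and> t \<le> b \<and> t - s < d \<longrightarrow>
                  \<bar>D t - D s\<bar> \<le> e * (n t - n s)"
  shows "D b = D a"
proof -
  have "\<bar>D b - D a\<bar> \<le> e * (n b - n a)" if e: "e > 0" for e
  proof -
    obtain d where d: "d > 0" "\<And>s t. a \<le> s \<Longrightarrow> s \<le> t \<Longrightarrow> t \<le> b \<Longrightarrow> t - s < d \<Longrightarrow>
                  \<bar>D t - D s\<bar> \<le> e * (n t - n s)"
      using loc[OF e] by auto
    have "a \<le> a \<and> a \<le> b \<and> b \<le> b \<longrightarrow> \<bar>D b - D a\<bar> \<le> e * (n b - n a)"
      using ab
    \<comment> \<open>The Bolzano principle does the telescoping: the property is additive over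
      adjacent intervals and holds on all short ones.\<close>
    proof (induction rule: Bolzano[where P = "\<lambda>s t. a \<le> s \<and> s \<le> t \<and> t \<le> b \<longrightarrow> \<bar>D t - D s\<bar> \<le> e * (n t - n s)"])
      case (trans p q r)
      then show ?case by (auto simp: algebra_simps)
    next
      case (local x)
      then show ?case using d by (intro exI[of _ d]) auto
    qed
    then show ?thesis using ab by simp
  qed
  note * = this
  have "\<bar>D b - D a\<bar> \<le> 0"
  proof (rule field_le_epsilon)
    fix e :: real assume e: "e > 0"
    have nn: "n b - n a \<ge> 0" using n[of a b] ab by auto
    \<comment> \<open>The summand 1 keeps the denominator positive when \<open>n\<close> is
      constant.\<close>
    have "\<bar>D b - D a\<bar> \<le> (e / (n b - n a + 1)) * (n b - n a)"
      using *[of "e / (n b - n a + 1)"] e nn by (auto simp: divide_pos_pos)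
    also have "\<dots> \<le> e"
      using e nn by (simp add: field_simps mult_left_mono)
    finally show "\<bar>D b - D a\<bar> \<le> 0 + e" by simp
  qed
  then show ?thesis by simp
qed

lemma ac_continuous_on:
  assumes "\<And>t. t \<in> {a..b} \<Longrightarrow> y t - y a = integral {a..t} y'" "y' absolutely_integrable_on {a..b}"
  shows "continuous_on {a..b} (y :: real \<Rightarrow> real)"
proof -
  have "continuous_on {a..b} (\<lambda>t. y a + integral {a..t} y')"
    by (intro continuous_intros continuous_on_indefinite_integral assms)
  then show ?thesis
    by (rule continuous_on_eq) (use assms(1) in fastforce)
qed

text \<open>The defect of the chain rule on a short interval is the integral of (y t + y s - 2 y r)
  y' r. The first factor is uniformly small by uniform continuity of \<open>y\<close>, so the defect
  is small relative to the increment of the total variation, and the preceding criterion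
  applies.\<close>

lemma ac_square:
  fixes y y' :: "real \<Rightarrow> real"
  assumes ab: "a \<le> b" and y: "\<And>t. t \<in> {a..b} \<Longrightarrow> y t - y a = integral {a..t} y'"
    and y': "y' absolutely_integrable_on {a..b}"
  shows "(\<lambda>t. 2 * y t * y' t) absolutely_integrable_on {a..b}"
    and "(y b)\<^sup>2 - (y a)\<^sup>2 = integral {a..b} (\<lambda>t. 2 * y t * y' t)"
proof -
  have cont: "continuous_on {a..b} y"
    using y y' by (rule ac_continuous_on)
  then show ai: "(\<lambda>t. 2 * y t * y' t) absolutely_integrable_on {a..b}"
    by (intro absolutely_integrable_continuous_mult y' continuous_intros)
  have sub: "f integrable_on {s..t}" if "f absolutely_integrable_on {a..b}" "a \<le> s" "t \<le> b"
    for f :: "real \<Rightarrow> real" and s t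
    using that by (meson absolutely_integrable_on_def atLeastatMost_subset_iff integrable_on_subinterval)
  have split: "integral {a..t} f - integral {a..s} f = integral {s..t} f"
    if "f absolutely_integrable_on {a..b}" "a \<le> s" "s \<le> t" "t \<le> b" for f :: "real \<Rightarrow> real" and s t
    using Henstock_Kurzweil_Integration.integral_combine[of a s t f] sub that by auto
  have ay': "(\<lambda>t. \<bar>y' t\<bar>) absolutely_integrable_on {a..b}"
    using y' by (rule set_integrable_abs)
  define D where "D t = (y t)\<^sup>2 - integral {a..t} (\<lambda>t. 2 * y t * y' t)" for t
  define n where "n t = integral {a..t} (\<lambda>t. \<bar>y' t\<bar>)" for t
  have "D b = D a"
  proof (rule constant_if_locally_small_increments[OF ab, where n = n])
    show "n s \<le> n t" if "a \<le> s" "s \<le> t" "t \<le> b" for s t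
      unfolding n_def using split[OF ay' that] that sub[OF ay'] integral_nonneg[of "\<lambda>t. \<bar>y' t\<bar>" "{s..t}"]
      by auto
    fix e :: real assume e: "e > 0"
    have "uniformly_continuous_on {a..b} y"
      using cont by (simp add: compact_uniformly_continuous)
    then obtain d where d: "d > 0" "\<And>s t. s \<in> {a..b} \<Longrightarrow> t \<in> {a..b} \<Longrightarrow> dist t s < d \<Longrightarrow> dist (y t) (y s) < e/2"
      unfolding uniformly_continuous_on_def using e by (metis half_gt_zero)
    show "\<exists>d>0. \<forall>s t. a \<le> s \<and> s \<le> t \<and> t \<le> b \<and> t - s < d \<longrightarrow> \<bar>D t - D s\<bar> \<le> e * (n t - n s)"
    proof (intro exI[of _ d] conjI allI impI d)
      fix s t assume st: "a \<le> s \<and> s \<le> t \<and> t \<le> b \<and> t - s < d"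
      have yst: "y t - y s = integral {s..t} y'"
        using y[of t] y[of s] split[OF y', of s t] st by auto
      have spl: "integral {a..t} (\<lambda>t. 2 * y t * y' t) - integral {a..s} (\<lambda>t. 2 * y t * y' t)
          = integral {s..t} (\<lambda>t. 2 * y t * y' t)"
        using split[OF ai, of s t] st by auto
      \<comment> \<open>The difference of squares is factored, and its second factor is written as
        the integral of \<open>y'\<close>.\<close>
      have "D t - D s = (y t + y s) * integral {s..t} y' - integral {s..t} (\<lambda>t. 2 * y t * y' t)"
        unfolding D_def yst[symmetric] spl[symmetric]
        by (simp add: algebra_simps power2_eq_square)
      also have "\<dots> = integral {s..t} (\<lambda>r. (y t + y s - 2 * y r) * y' r)"
      proof -
        have i1: "(\<lambda>r. (y t + y s) * y' r) integrable_on {s..t}"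
          by (intro integrable_on_mult_right sub[OF y']) (use st in auto)
        have i2: "(\<lambda>r. 2 * y r * y' r) integrable_on {s..t}"
          by (intro sub[OF ai]) (use st in auto)
        show ?thesis
          using integral_diff[OF i1 i2] by (simp only: integral_mult_right left_diff_distrib)
      qed
      also have "\<bar>\<dots>\<bar> \<le> integral {s..t} (\<lambda>r. e * \<bar>y' r\<bar>)"
      proof (rule integral_abs_bound_integral)
        show "(\<lambda>r. (y t + y s - 2 * y r) * y' r) integrable_on {s..t}"
          by (rule sub) (use st in \<open>auto intro!: absolutely_integrable_continuous_mult y' continuous_intros cont\<close>)
        show "(\<lambda>r. e * \<bar>y' r\<bar>) integrable_on {s..t}"
          by (intro integrable_on_mult_right sub[OF ay']) (use st in auto)
        fix r assume r: "r \<in> {s..t}"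
        have "\<bar>y t - y r\<bar> < e/2" "\<bar>y s - y r\<bar> < e/2"
          using d(2)[of r t] d(2)[of r s] r st by (auto simp: dist_real_def)
        then have "\<bar>y t + y s - 2 * y r\<bar> \<le> e" by linarith
        then show "\<bar>(y t + y s - 2 * y r) * y' r\<bar> \<le> e * \<bar>y' r\<bar>"
          by (simp add: abs_mult mult_right_mono)
      qed
      also have "\<dots> = e * (n t - n s)"
        unfolding n_def using split[OF ay', of s t] st by auto
      finally show "\<bar>D t - D s\<bar> \<le> e * (n t - n s)" .
    qed
  qed
  then show "(y b)\<^sup>2 - (y a)\<^sup>2 = integral {a..b} (\<lambda>t. 2 * y t * y' t)"
    by (simp add: D_def)
qed

text \<open>At a point \<open>c\<close> where the modulus of \<open>y\<close> is maximal, the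
  identity for the square of \<open>y\<close> loses its damping part by sign, and division by the
  modulus of \<open>y c\<close> gives the bound. No bound on \<open>d\<close> enters: the damping
  coefficient will be a multiple of the square of the trace, on which nothing is known in advance.
  Working with the square costs the factor 2.\<close>

lemma damped_ac_bound:
  fixes y f d :: "real \<Rightarrow> real"
  assumes ab: "a \<le> b" and y: "\<And>t. t \<in> {a..b} \<Longrightarrow> y t - y a = integral {a..t} (\<lambda>s. f s - d s * y s)"
    and f: "f absolutely_integrable_on {a..b}"
    and g: "(\<lambda>s. f s - d s * y s) absolutely_integrable_on {a..b}"
    and d: "\<And>s. d s \<ge> 0"
  shows "\<bar>y b\<bar> \<le> \<bar>y a\<bar> + 2 * integral {a..b} (\<lambda>s. \<bar>f s\<bar>)"
proof -
  have cont: "continuous_on {a..b} y"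
    using y g by (rule ac_continuous_on)
  have "continuous_on {a..b} (\<lambda>t. \<bar>y t\<bar>)"
    using cont by (intro continuous_intros)
  then obtain c where c: "c \<in> {a..b}" "\<And>t. t \<in> {a..b} \<Longrightarrow> \<bar>y t\<bar> \<le> \<bar>y c\<bar>"
    using continuous_attains_sup[of "{a..b}" "\<lambda>t. \<bar>y t\<bar>"] ab by auto
  have sub: "{a..c} \<subseteq> {a..b}" using c by auto
  have af: "(\<lambda>s. \<bar>f s\<bar>) absolutely_integrable_on {a..b}"
    using f by (rule set_integrable_abs)
  have F: "integral {a..c} (\<lambda>s. \<bar>f s\<bar>) \<le> integral {a..b} (\<lambda>s. \<bar>f s\<bar>)"
    using af sub by (intro integral_subset_le) (auto simp: absolutely_integrable_on_def intro: integrable_on_subinterval)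
  have sq: "(y c)\<^sup>2 - (y a)\<^sup>2 = integral {a..c} (\<lambda>t. 2 * y t * (f t - d t * y t))"
    and ai: "(\<lambda>t. 2 * y t * (f t - d t * y t)) absolutely_integrable_on {a..c}"
    using ac_square[OF _ _ absolutely_integrable_on_subinterval[OF g sub], of y] y c by auto
  have "integral {a..c} (\<lambda>t. 2 * y t * (f t - d t * y t)) \<le> integral {a..c} (\<lambda>t. 2 * \<bar>y c\<bar> * \<bar>f t\<bar>)"
  proof (rule integral_le)
    show "(\<lambda>t. 2 * y t * (f t - d t * y t)) integrable_on {a..c}"
      using ai absolutely_integrable_on_def by blast
    show "(\<lambda>t. 2 * \<bar>y c\<bar> * \<bar>f t\<bar>) integrable_on {a..c}"
      using af sub by (auto simp: absolutely_integrable_on_def intro!: integrable_on_mult_right intro: integrable_on_subinterval)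
    fix t assume t: "t \<in> {a..c}"
    have "2 * y t * (f t - d t * y t) = 2 * (y t * f t) - 2 * (d t * (y t)\<^sup>2)"
      by (simp add: algebra_simps power2_eq_square)
    also have "\<dots> \<le> 2 * (\<bar>y t\<bar> * \<bar>f t\<bar>)"
    proof -
      have "0 \<le> d t * (y t)\<^sup>2" using d[of t] by simp
      moreover have "y t * f t \<le> \<bar>y t\<bar> * \<bar>f t\<bar>" by (metis abs_ge_self abs_mult)
      ultimately show ?thesis by linarith
    qed
    also have "\<dots> \<le> 2 * \<bar>y c\<bar> * \<bar>f t\<bar>"
      using c(2)[of t] t sub by (auto intro!: mult_right_mono)
    finally show "2 * y t * (f t - d t * y t) \<le> 2 * \<bar>y c\<bar> * \<bar>f t\<bar>" .
  qed
  also have "\<dots> \<le> 2 * \<bar>y c\<bar> * integral {a..b} (\<lambda>s. \<bar>f s\<bar>)"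
    using F by (simp add: mult_left_mono)
  finally have *: "(y c)\<^sup>2 \<le> (y a)\<^sup>2 + 2 * \<bar>y c\<bar> * integral {a..b} (\<lambda>s. \<bar>f s\<bar>)"
    using sq by linarith
  have ya: "\<bar>y a\<bar> \<le> \<bar>y c\<bar>" using c ab by auto
  have "\<bar>y c\<bar> \<le> \<bar>y a\<bar> + 2 * integral {a..b} (\<lambda>s. \<bar>f s\<bar>)"
  proof (cases "y c = 0")
    case True
    then show ?thesis using ya af integral_nonneg[of "\<lambda>s. \<bar>f s\<bar>" "{a..b}"]
      by (auto simp: absolutely_integrable_on_def)
  next
    case False
    have "\<bar>y c\<bar> * \<bar>y c\<bar> \<le> \<bar>y c\<bar> * (\<bar>y a\<bar> + 2 * integral {a..b} (\<lambda>s. \<bar>f s\<bar>))"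
      using * mult_right_mono[OF ya, of "\<bar>y a\<bar>"] by (auto simp: power2_eq_square algebra_simps abs_mult[symmetric])
    from mult_left_le_imp_le[OF this] False show ?thesis by simp
  qed
  moreover have "\<bar>y b\<bar> \<le> \<bar>y c\<bar>" using c ab by auto
  ultimately show ?thesis by linarith
qed

text \<open>The product is integrable because it is dominated by the sum of the squares; the
  inequality expresses that a nonnegative quadratic polynomial in \<open>l\<close> has no positive
  discriminant.\<close>

lemma cauchy_schwarz_integral:
  fixes f g :: "real \<Rightarrow> real"
  assumes S: "S \<in> sets lebesgue" and f: "f square_integrable_on S" and g: "g square_integrable_on S"
  shows "(\<lambda>x. f x * g x) absolutely_integrable_on S"
    and "(integral S (\<lambda>x. \<bar>f x * g x\<bar>))\<^sup>2 \<le> integral S (\<lambda>x. (f x)\<^sup>2) * integral S (\<lambda>x. (g x)\<^sup>2)"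
proof -
  have fm: "f \<in> borel_measurable (lebesgue_on S)" and f2: "(\<lambda>x. (f x)\<^sup>2) integrable_on S"
    and gm: "g \<in> borel_measurable (lebesgue_on S)" and g2: "(\<lambda>x. (g x)\<^sup>2) integrable_on S"
    using f g by (auto simp: square_integrable_on_def)
  show fg: "(\<lambda>x. f x * g x) absolutely_integrable_on S"
  proof (rule measurable_bounded_by_integrable_imp_absolutely_integrable[OF _ S])
    show "(\<lambda>x. f x * g x) \<in> borel_measurable (lebesgue_on S)" using fm gm by measurable
    show "(\<lambda>x. (f x)\<^sup>2 + (g x)\<^sup>2) integrable_on S" using f2 g2 by (rule integrable_add)
    show "norm (f x * g x) \<le> (f x)\<^sup>2 + (g x)\<^sup>2" for x
      using sum_squares_bound[of "\<bar>f x\<bar>" "\<bar>g x\<bar>"] mult_nonneg_nonneg[OF abs_ge_zero[of "f x"] abs_ge_zero[of "g x"]]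
      unfolding real_norm_def abs_mult power2_abs by linarith
  qed
  define I where "I = integral S (\<lambda>x. \<bar>f x * g x\<bar>)"
  define F where "F = integral S (\<lambda>x. (f x)\<^sup>2)"
  define G where "G = integral S (\<lambda>x. (g x)\<^sup>2)"
  have afg: "(\<lambda>x. \<bar>f x * g x\<bar>) integrable_on S"
    using fg by (simp add: absolutely_integrable_on_def)
  have quad: "0 \<le> l\<^sup>2 * F - 2 * l * I + G" for l
  proof -
    have eq: "(l * \<bar>f x\<bar> - \<bar>g x\<bar>)\<^sup>2 = l\<^sup>2 * (f x)\<^sup>2 - 2 * l * \<bar>f x * g x\<bar> + (g x)\<^sup>2" for x
      by (simp add: power2_diff power_mult_distrib abs_mult)
    have i1: "(\<lambda>x. l\<^sup>2 * (f x)\<^sup>2) integrable_on S" "(\<lambda>x. 2 * l * \<bar>f x * g x\<bar>) integrable_on S"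
      using f2 afg by (auto intro: integrable_on_mult_right simp del: abs_mult)
    have "0 \<le> integral S (\<lambda>x. (l * \<bar>f x\<bar> - \<bar>g x\<bar>)\<^sup>2)"
      unfolding eq by (intro integral_nonneg integrable_add integrable_diff i1 g2) (simp add: eq[symmetric])
    also have "\<dots> = l\<^sup>2 * F - 2 * l * I + G"
      unfolding eq F_def G_def I_def using i1 g2 by (simp add: integral_add integral_diff integrable_diff)
    finally show ?thesis .
  qed
  have F0: "F \<ge> 0" unfolding F_def using f2 by (simp add: integral_nonneg)
  have I0: "I \<ge> 0" unfolding I_def using afg by (simp add: integral_nonneg)
  have "I\<^sup>2 \<le> F * G"
  proof (cases "F = 0")
    case True
    have "I = 0"
    proof (rule ccontr)
      assume "I \<noteq> 0"
      \<comment> \<open>If \<open>F\<close> is zero the polynomial is affine in \<open>l\<close>; at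
        this value it equals -1.\<close>
      then show False using quad[of "(G + 1) / (2 * I)"] True I0 by (auto simp: field_simps)
    qed
    then show ?thesis using True by simp
  next
    case False
    have "0 \<le> F * ((I / F)\<^sup>2 * F - 2 * (I / F) * I + G)"
      using F0 quad by (intro mult_nonneg_nonneg)
    also have "\<dots> = F * G - I\<^sup>2" using False by (simp add: field_simps power2_eq_square)
    finally show ?thesis by simp
  qed
  then show "(integral S (\<lambda>x. \<bar>f x * g x\<bar>))\<^sup>2 \<le> integral S (\<lambda>x. (f x)\<^sup>2) * integral S (\<lambda>x. (g x)\<^sup>2)"
    by (simp add: I_def F_def G_def)
qed

lemma square_integrable_imp_absolutely_integrable:
  assumes f: "f square_integrable_on {a..b}"
  shows "f absolutely_integrable_on {a..b}" "(\<lambda>x. (f x)\<^sup>2) absolutely_integrable_on {a..b}"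
    and "(integral {a..b} (\<lambda>x. \<bar>f x\<bar>))\<^sup>2 \<le> \<bar>b - a\<bar> * integral {a..b} (\<lambda>x. (f x)\<^sup>2)"
proof -
  have 1: "(\<lambda>x. 1) square_integrable_on {a..b}"
    using integrable_const_ivl[of "1::real" a b] by (simp add: square_integrable_on_def)
  from cauchy_schwarz_integral[OF _ 1 f]
  show "f absolutely_integrable_on {a..b}"
    and *: "(integral {a..b} (\<lambda>x. \<bar>f x\<bar>))\<^sup>2 \<le> \<bar>b - a\<bar> * integral {a..b} (\<lambda>x. (f x)\<^sup>2)"
    by (auto split: if_splits)
  show "(\<lambda>x. (f x)\<^sup>2) absolutely_integrable_on {a..b}"
    using f by (auto simp: square_integrable_on_def intro: nonnegative_absolutely_integrable_1)
qed

lemma absolutely_integrable_imp_square_integrable: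
  assumes "f absolutely_integrable_on {a..b}" "(\<lambda>x. (f x)\<^sup>2) integrable_on {a..b::real}"
  shows "f square_integrable_on {a..b}"
  using assms absolutely_integrable_imp_borel_measurable[OF assms(1)]
  by (auto simp: square_integrable_on_def)

lemma square_integrable_on_subinterval:
  assumes "f square_integrable_on {a..b}" "{c..d} \<subseteq> {a..b::real}"
  shows "f square_integrable_on {c..d}"
proof (rule absolutely_integrable_imp_square_integrable)
  show "f absolutely_integrable_on {c..d}" "(\<lambda>x. (f x)\<^sup>2) integrable_on {c..d}"
    using square_integrable_imp_absolutely_integrable(1,2)[OF assms(1)] assms(2)
    by (auto simp: absolutely_integrable_on_def intro: integrable_on_subinterval)
qed

text \<open>Doubling argument: on a piece where the integral of \<open>q\<close> is at most one half, the right-hand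
  side at most doubles.\<close>

lemma gronwall_doubling:
  fixes f q :: "real \<Rightarrow> real"
  assumes mono: "\<And>s t. a \<le> s \<Longrightarrow> s \<le> t \<Longrightarrow> t \<le> b \<Longrightarrow> f s \<le> f t"
    and qf: "(\<lambda>s. q s * f s) integrable_on {a..b}"
    and q: "q integrable_on {a..b}" "\<And>s. s \<in> {a..b} \<Longrightarrow> q s \<ge> 0"
    and f0: "\<And>s. s \<in> {a..b} \<Longrightarrow> 0 \<le> f s"
    and le: "\<And>t. t \<in> {a..b} \<Longrightarrow> f t \<le> c + integral {a..t} (\<lambda>s. q s * f s)"
    and t: "t \<in> {a..b}" "integral {a..t} q \<le> real n / 2" and c: "0 \<le> c"
  shows "c + integral {a..t} (\<lambda>s. q s * f s) \<le> 2 ^ n * c"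
  using t
proof (induction n arbitrary: t)
  have sub: "h integrable_on {s..t}" if "h integrable_on {a..b}" "a \<le> s" "t \<le> b" for h :: "real \<Rightarrow> real" and s t
    using that by (meson atLeastatMost_subset_iff integrable_on_subinterval)
  have step: "integral {s..t} (\<lambda>r. q r * f r) \<le> f t * integral {s..t} q" if "a \<le> s" "s \<le> t" "t \<le> b" for s t
  proof -
    have "integral {s..t} (\<lambda>r. q r * f r) \<le> integral {s..t} (\<lambda>r. f t * q r)"
    proof (rule integral_le)
      show "(\<lambda>r. f t * q r) integrable_on {s..t}"
        using sub[OF q(1)] that by (auto intro: integrable_on_mult_right)
      show "q r * f r \<le> f t * q r" if "r \<in> {s..t}" for r
        using mono[of r t] q(2)[of r] that \<open>a \<le> s\<close> \<open>t \<le> b\<close> by (auto simp: mult.commute intro: mult_right_mono)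
    qed (use sub[OF qf] that in auto)
    then show ?thesis by simp
  qed
  {
    case 0
    have "integral {a..t} q = 0"
      using 0 integral_nonneg[OF sub[OF q(1)], of a t] q(2) by force
    then show ?case using step[of a t] 0 by auto
  next
    case (Suc n)
    have cont: "continuous_on {a..t} (\<lambda>s. integral {a..s} q)"
      using sub[OF q(1), of a t] Suc.prems by (intro indefinite_integral_continuous_1) auto
    have at: "a \<le> t" using Suc.prems by auto
    \<comment> \<open>The point \<open>s\<close> leaves at most half a unit of the mass of
      \<open>q\<close> to the right and at most n/2 to the left, where the induction hypothesis
      applies.\<close>
    obtain s where s: "a \<le> s" "s \<le> t" "integral {a..s} q \<le> real n / 2" "integral {s..t} q \<le> 1/2"
    proof (cases "integral {a..t} q \<le> real n / 2")
      case True then show ?thesis using that[of t] at by auto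
    next
      case False
      then obtain s where "a \<le> s" "s \<le> t" "integral {a..s} q = real n / 2"
        using IVT'[of "\<lambda>s. integral {a..s} q" a "real n/2" t] at cont by auto
      then show ?thesis
        using that[of s] Suc.prems sub[OF q(1), of a t]
          Henstock_Kurzweil_Integration.integral_combine[of a s t q]
        by (auto simp: field_simps)
    qed
    let ?G = "\<lambda>t. c + integral {a..t} (\<lambda>s. q s * f s)"
    have IH: "?G s \<le> 2 ^ n * c" using Suc.IH[of s] s Suc.prems by auto
    have G: "?G t = ?G s + integral {s..t} (\<lambda>r. q r * f r)"
      using Henstock_Kurzweil_Integration.integral_combine[of a s t "\<lambda>s. q s * f s"] s sub[OF qf, of a t] Suc.prems
      by auto
    have "integral {s..t} (\<lambda>r. q r * f r) \<le> f t * (1/2)"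
      using step[of s t] s Suc.prems mult_left_mono[OF s(4) f0[of t]] by auto
    moreover have "f t \<le> ?G t" using le Suc.prems by auto
    \<comment> \<open>The last piece contributes at most half of \<open>f t\<close>, hence at most
      half of the right-hand side at \<open>t\<close>, which is absorbed.\<close>
    ultimately have "?G t \<le> 2 * ?G s" using G by argo
    with IH show ?case by auto
  }
qed

text \<open>One doubling per half unit of mass, at most 1 + 2 times the integral of \<open>q\<close>
  of them, and 2 is at most e. The constant is cruder than the classical one, but \<open>f\<close>
  is only assumed monotone and \<open>q\<close> only integrable.\<close>

lemma gronwall_integral:
  fixes f q :: "real \<Rightarrow> real"
  assumes ab: "a \<le> b" and mono: "\<And>s t. a \<le> s \<Longrightarrow> s \<le> t \<Longrightarrow> t \<le> b \<Longrightarrow> f s \<le> f t"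
    and qf: "(\<lambda>s. q s * f s) integrable_on {a..b}"
    and q: "q integrable_on {a..b}" "\<And>s. s \<in> {a..b} \<Longrightarrow> q s \<ge> 0"
    and f0: "\<And>s. s \<in> {a..b} \<Longrightarrow> 0 \<le> f s"
    and le: "\<And>t. t \<in> {a..b} \<Longrightarrow> f t \<le> c + integral {a..t} (\<lambda>s. q s * f s)" and c: "0 \<le> c"
  shows "f b \<le> c * exp (1 + 2 * integral {a..b} q)"
proof -
  define n where "n = nat \<lceil>2 * integral {a..b} q\<rceil>"
  have I: "integral {a..b} q \<ge> 0" using q by (intro integral_nonneg) auto
  have n: "2 * integral {a..b} q \<le> real n" "real n \<le> 1 + 2 * integral {a..b} q"
    using I by (auto simp: n_def) linarith+
  have "f b \<le> c + integral {a..b} (\<lambda>s. q s * f s)" using le ab by auto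
  also have "\<dots> \<le> 2 ^ n * c"
    by (rule gronwall_doubling[OF mono qf q f0 le _ _ c]) (use n ab in auto)
  also have "\<dots> \<le> exp (1 + 2 * integral {a..b} q) * c"
  proof (rule mult_right_mono[OF _ c])
    have "(2::real) ^ n \<le> exp (real n)"
      using power_mono[of 2 "exp 1 :: real" n] exp_ge_add_one_self[of 1] by (simp add: exp_of_nat_mult[symmetric])
    also have "\<dots> \<le> exp (1 + 2 * integral {a..b} q)" using n by simp
    finally show "(2::real) ^ n \<le> exp (1 + 2 * integral {a..b} q)" .
  qed
  finally show ?thesis by (simp add: mult.commute)
qed

text \<open>The factor \<open>m\<close> is only Lebesgue measurable, while the product measure is
  formed over the Borel sets. So \<open>m\<close> is replaced by a Borel function equal to it almost
  everywhere, Fubini is applied there, and the result is carried back to the completed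
  measure.\<close>

lemma fubini_bounded_times_integrable:
  fixes F :: "real \<Rightarrow> real \<Rightarrow> real" and m :: "real \<Rightarrow> real"
  assumes F: "(\<lambda>(x,s). F x s) \<in> borel_measurable (borel \<Otimes>\<^sub>M borel)"
    and bd: "\<And>x s. x \<in> {a..b} \<Longrightarrow> s \<in> {c..d} \<Longrightarrow> \<bar>F x s\<bar> \<le> C"
    and m: "m absolutely_integrable_on {c..d}"
  shows "(\<lambda>s. integral {a..b} (\<lambda>x. F x s) * m s) absolutely_integrable_on {c..d}"
    and "(\<lambda>x. integral {c..d} (\<lambda>s. F x s * m s)) absolutely_integrable_on {a..b}"
    and "integral {a..b} (\<lambda>x. integral {c..d} (\<lambda>s. F x s * m s)) =
         integral {c..d} (\<lambda>s. integral {a..b} (\<lambda>x. F x s) * m s)"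
proof -
  have mi: "integrable lebesgue (\<lambda>s. indicator {c..d} s * m s)"
    using m by (simp add: set_integrable_def)
  obtain m' where m'[measurable]: "m' \<in> borel_measurable lborel" and
    eq: "AE s in lborel. indicator {c..d} s * m s = m' s"
    using completion_ex_borel_measurable_real[OF borel_measurable_integrable[OF mi]] by auto
  have eqL: "AE s in lebesgue. indicator {c..d} s * m s = m' s"
    using eq by (rule AE_completion)
  have m'i: "integrable lborel m'"
  proof -
    have "integrable lebesgue m'"
      using mi eqL by (subst integrable_cong_AE[of _ _ "\<lambda>s. indicator {c..d} s * m s"]) (auto intro: measurable_completion borel_measurable_integrable)
    then show ?thesis using m' by (subst (asm) integrable_completion) auto
  qed
  have [measurable]: "(\<lambda>p. F (fst p) (snd p)) \<in> borel_measurable (lborel \<Otimes>\<^sub>M lborel)"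
    using F by (simp add: split_beta' cong: measurable_cong_sets sets_pair_measure_cong)
  \<comment> \<open>Cutting off by both indicators makes the integrand globally dominated by a
    tensor product of integrable functions.\<close>
  define F' where "F' x s = indicator {a..b} x * (indicator {c..d} s * F x s)" for x s
  have F'bd: "\<bar>F' x s\<bar> \<le> \<bar>C\<bar> * indicator {a..b} x" for x s
    using bd[of x s] by (auto simp: F'_def split: split_indicator)
  have F'm[measurable]: "(\<lambda>p. F' (fst p) (snd p)) \<in> borel_measurable (lborel \<Otimes>\<^sub>M lborel)"
    unfolding F'_def by measurable
  define G where "G x s = F' x s * m' s" for x s
  have Gm[measurable]: "(\<lambda>p. G (fst p) (snd p)) \<in> borel_measurable (lborel \<Otimes>\<^sub>M lborel)"
    unfolding G_def by measurable
  have i0: "integrable (lborel \<Otimes>\<^sub>M lborel) (\<lambda>p. (\<bar>C\<bar> * indicator {a..b} (fst p)) * m' (snd p))"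
  proof (rule lborel_pair.Fubini_integrable)
    show "(\<lambda>p. (\<bar>C\<bar> * indicator {a..b} (fst p)) * m' (snd p)) \<in> borel_measurable (lborel \<Otimes>\<^sub>M lborel)"
      by measurable
    show "AE x in lborel. integrable lborel (\<lambda>y. (\<bar>C\<bar> * indicator {a..b} (fst (x, y))) * m' (snd (x, y)))"
      using m'i by simp
    have "integrable lborel (\<lambda>x. (\<bar>C\<bar> * (\<integral>y. \<bar>m' y\<bar> \<partial>lborel)) * indicator {a..b} x)"
      by (intro integrable_mult_right) (auto simp: integrable_indicator_iff emeasure_lborel_Icc_eq)
    then show "integrable lborel (\<lambda>x. \<integral>y. norm ((\<bar>C\<bar> * indicator {a..b} (fst (x, y))) * m' (snd (x, y))) \<partial>lborel)"
      by (auto simp: abs_mult mult_ac)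
  qed
  have Gi: "integrable (lborel \<Otimes>\<^sub>M lborel) (\<lambda>(x,s). G x s)"
  proof (rule Bochner_Integration.integrable_bound[OF i0])
    show "(\<lambda>(x, s). G x s) \<in> borel_measurable (lborel \<Otimes>\<^sub>M lborel)"
      using Gm by (simp add: split_beta')
    show "AE p in lborel \<Otimes>\<^sub>M lborel. norm (case p of (x, s) \<Rightarrow> G x s)
            \<le> norm (\<bar>C\<bar> * indicator {a..b} (fst p) * m' (snd p))"
      using F'bd by (auto simp: G_def abs_mult intro!: mult_right_mono AE_I2)
  qed
  have swap: "(\<integral>s. (\<integral>x. G x s \<partial>lborel) \<partial>lborel) = (\<integral>x. (\<integral>s. G x s \<partial>lborel) \<partial>lborel)"
    by (rule lborel_pair.Fubini_integral[OF Gi])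
  have i1: "integrable lborel (\<lambda>x. \<integral>s. G x s \<partial>lborel)"
    using lborel_pair.integrable_fst'[OF Gi] by simp
  have i2: "integrable lborel (\<lambda>s. \<integral>x. G x s \<partial>lborel)"
    using lborel_pair.integrable_snd[OF Gi] by simp
  have "(\<integral>x. G x s \<partial>lborel) = indicator {c..d} s * integral {a..b} (\<lambda>x. F x s) * m' s" for s
  proof (cases "s \<in> {c..d}")
    case True
    have sm: "(\<lambda>x. F x s) \<in> borel_measurable borel"
      using measurable_compose[OF _ F, of "\<lambda>x. (x, s)" borel] by simp
    have "set_integrable lborel {a..b} (\<lambda>x. F x s)"
      unfolding set_integrable_def
    proof (rule Bochner_Integration.integrable_bound)
      show "integrable lborel (\<lambda>x. C * indicator {a..b} x)"
        by (intro integrable_mult_right) (auto simp: integrable_indicator_iff emeasure_lborel_Icc_eq)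
      show "AE x in lborel. norm (indicat_real {a..b} x *\<^sub>R F x s) \<le> norm (C * indicat_real {a..b} x)"
        using bd True by (fastforce intro!: AE_I2 split: split_indicator)
      show "(\<lambda>x. indicat_real {a..b} x *\<^sub>R F x s) \<in> borel_measurable lborel" using sm by measurable
    qed
    from set_borel_integral_eq_integral(2)[OF this]
    have "(\<integral>x. indicator {a..b} x * F x s \<partial>lborel) = integral {a..b} (\<lambda>x. F x s)"
      by (simp add: set_lebesgue_integral_def)
    then show ?thesis using True by (simp add: G_def F'_def)
  qed (simp add: G_def F'_def)
  note e2 = this
  have e1: "(\<integral>s. G x s \<partial>lborel) = indicator {a..b} x * integral {c..d} (\<lambda>s. F x s * m s)" for x
  proof (cases "x \<in> {a..b}")
    case True
    have [measurable]: "(\<lambda>s. F x s) \<in> borel_measurable borel"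
      using measurable_compose[OF _ F, of "\<lambda>s. (x, s)" borel] by simp
    have ai: "(\<lambda>s. F x s * m s) absolutely_integrable_on {c..d}"
    proof (rule absolutely_integrable_bounded_measurable_product_real[OF _ _ _ m])
      show "F x \<in> borel_measurable (lebesgue_on {c..d})"
        by (intro measurable_restrict_space1 measurable_completion) simp
      show "bounded (F x ` {c..d})"
        unfolding bounded_real using bd[OF True] by blast
    qed auto
    have "integral {c..d} (\<lambda>s. F x s * m s) = (\<integral>s. indicator {c..d} s * (F x s * m s) \<partial>lebesgue)"
      using set_lebesgue_integral_eq_integral(2)[OF ai] by (simp add: set_lebesgue_integral_def)
    also have "\<dots> = (\<integral>s. G x s \<partial>lebesgue)"
    proof (rule integral_cong_AE)
      show "(\<lambda>s. indicator {c..d} s * (F x s * m s)) \<in> borel_measurable lebesgue"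
        using ai by (auto simp: set_integrable_def)
      have "(\<lambda>s. G x s) \<in> borel_measurable borel"
        unfolding G_def F'_def using m' by measurable
      then show "G x \<in> borel_measurable lebesgue" by (intro measurable_completion) simp
      show "AE s in lebesgue. indicator {c..d} s * (F x s * m s) = G x s"
        using eqL
      proof (eventually_elim)
        case (elim s)
        then show ?case using True unfolding G_def F'_def elim[symmetric] by (auto split: split_indicator)
      qed
    qed
    also have "\<dots> = (\<integral>s. G x s \<partial>lborel)"
      unfolding G_def F'_def using m' by (intro integral_completion) measurable
    finally show ?thesis using True by simp
  qed (simp add: G_def F'_def)
  have ae2: "AE s in lebesgue. (\<integral>x. G x s \<partial>lborel) = indicator {c..d} s * (integral {a..b} (\<lambda>x. F x s) * m s)"
    using eqL by eventually_elim (auto simp: e2 split: split_indicator)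
  have i2L: "integrable lebesgue (\<lambda>s. \<integral>x. G x s \<partial>lborel)"
    using i2 by (subst integrable_completion) (auto intro: borel_measurable_integrable)
  have mL: "(\<lambda>s. indicator {c..d} s * (integral {a..b} (\<lambda>x. F x s) * m s)) \<in> borel_measurable lebesgue"
    by (rule borel_measurable_AE[OF borel_measurable_integrable[OF i2L] ae2])
  show ai2: "(\<lambda>s. integral {a..b} (\<lambda>x. F x s) * m s) absolutely_integrable_on {c..d}"
    unfolding set_integrable_def
    using integrable_cong_AE[OF borel_measurable_integrable[OF i2L] mL ae2] i2L by simp
  have i1L: "integrable lebesgue (\<lambda>x. \<integral>s. G x s \<partial>lborel)"
    using i1 by (subst integrable_completion) (auto intro: borel_measurable_integrable)
  then show ai1: "(\<lambda>x. integral {c..d} (\<lambda>s. F x s * m s)) absolutely_integrable_on {a..b}"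
    by (simp add: e1 set_integrable_def)
  have "integral {a..b} (\<lambda>x. integral {c..d} (\<lambda>s. F x s * m s)) = (\<integral>x. (\<integral>s. G x s \<partial>lborel) \<partial>lebesgue)"
    using set_lebesgue_integral_eq_integral(2)[OF ai1] by (simp add: e1 set_lebesgue_integral_def)
  also have "\<dots> = (\<integral>x. (\<integral>s. G x s \<partial>lborel) \<partial>lborel)"
    using i1 by (intro integral_completion) auto
  also have "\<dots> = (\<integral>s. (\<integral>x. G x s \<partial>lborel) \<partial>lborel)" using swap by simp
  also have "\<dots> = (\<integral>s. (\<integral>x. G x s \<partial>lborel) \<partial>lebesgue)"
    using i2 by (intro integral_completion[symmetric]) auto
  also have "\<dots> = (\<integral>s. indicator {c..d} s * (integral {a..b} (\<lambda>x. F x s) * m s) \<partial>lebesgue)"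
    by (rule integral_cong_AE[OF borel_measurable_integrable[OF i2L] mL ae2])
  also have "\<dots> = integral {c..d} (\<lambda>s. integral {a..b} (\<lambda>x. F x s) * m s)"
    using set_lebesgue_integral_eq_integral(2)[OF ai2] by (simp add: set_lebesgue_integral_def)
  finally show "integral {a..b} (\<lambda>x. integral {c..d} (\<lambda>s. F x s * m s)) =
         integral {c..d} (\<lambda>s. integral {a..b} (\<lambda>x. F x s) * m s)" .
qed

section \<open>Measurability in time of the spatial norms\<close>

text \<open>A union of arbitrarily many nondegenerate intervals is open up to countably many end points. Superlevel
  sets of the spatial supremum norm are of this form, whether or not the boundary values are continuous.\<close>

lemma borel_if_locally_nondegenerate:
  fixes E :: "real set"
  assumes E: "\<And>t. t \<in> E \<Longrightarrow> \<exists>a b. a < b \<and> a \<le> t \<and> t \<le> b \<and> {a<..<b} \<subseteq> E"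
  shows "E \<in> sets borel"
proof -
  define L where "L = {t \<in> E - interior E. \<exists>b>t. {t<..<b} \<subseteq> E}"
  define R where "R = {t \<in> E - interior E. \<exists>a<t. {a<..<t} \<subseteq> E}"
  have intr: "{a<..<b} \<subseteq> interior E" if "{a<..<b} \<subseteq> E" for a b
    using that by (intro interior_maximal) auto
  have "countable L"
  proof -
    \<comment> \<open>A rational is chosen in the gap-free interval to the right of
      \<open>t\<close>. Two points cannot share it: the larger one would lie in the interval
      belonging to the smaller one, hence in the interior.\<close>
    have "\<exists>r\<in>\<rat>. t < r \<and> {t<..<r} \<subseteq> interior E" if "t \<in> L" for t
    proof -
      from that obtain b where b: "b > t" "{t<..<b} \<subseteq> E" by (auto simp: L_def)
      obtain r where "r \<in> \<rat>" "t < r" "r < b" using Rats_dense_in_real[OF b(1)] by auto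
      then show ?thesis using intr[OF b(2)] by (intro bexI[of _ r]) (auto simp: subset_iff)
    qed
    then obtain r where r: "\<And>t. t \<in> L \<Longrightarrow> r t \<in> \<rat> \<and> t < r t \<and> {t<..<r t} \<subseteq> interior E" by metis
    have "inj_on r L"
    proof (rule inj_onI)
      fix s t assume st: "s \<in> L" "t \<in> L" "r s = r t"
      have "t \<notin> interior E" "s \<notin> interior E" using st by (auto simp: L_def)
      then show "s = t" using r[OF st(1)] r[OF st(2)] st(3)
        by (metis greaterThanLessThan_iff linorder_neqE_linordered_idom subsetD)
    qed
    moreover have "countable (r ` L)"
      by (rule countable_subset[OF _ countable_rat]) (use r in auto)
    ultimately show ?thesis by (rule countable_image_inj_on[rotated])
  qed
  moreover have "countable R"
  proof -
    have "\<exists>r\<in>\<rat>. r < t \<and> {r<..<t} \<subseteq> interior E" if "t \<in> R" for t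
    proof -
      from that obtain b where b: "b < t" "{b<..<t} \<subseteq> E" by (auto simp: R_def)
      obtain r where "r \<in> \<rat>" "b < r" "r < t" using Rats_dense_in_real[OF b(1)] by auto
      then show ?thesis using intr[OF b(2)] by (intro bexI[of _ r]) (auto simp: subset_iff)
    qed
    then obtain r where r: "\<And>t. t \<in> R \<Longrightarrow> r t \<in> \<rat> \<and> r t < t \<and> {r t<..<t} \<subseteq> interior E" by metis
    have "inj_on r R"
    proof (rule inj_onI)
      fix s t assume st: "s \<in> R" "t \<in> R" "r s = r t"
      have "t \<notin> interior E" "s \<notin> interior E" using st by (auto simp: R_def)
      then show "s = t" using r[OF st(1)] r[OF st(2)] st(3)
        by (metis greaterThanLessThan_iff linorder_neqE_linordered_idom subsetD)
    qed
    moreover have "countable (r ` R)"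
      by (rule countable_subset[OF _ countable_rat]) (use r in auto)
    ultimately show ?thesis by (rule countable_image_inj_on[rotated])
  qed
  moreover have "E = interior E \<union> (L \<union> R)"
  proof (intro equalityI subsetI)
    fix t assume t: "t \<in> E"
    obtain a b where ab: "a < b" "a \<le> t" "t \<le> b" "{a<..<b} \<subseteq> E" using E[OF t] by auto
    consider "a < t \<and> t < b" | "t = a" | "t = b" using ab by linarith
    then show "t \<in> interior E \<union> (L \<union> R)"
    proof cases
      case 1 then show ?thesis using intr[OF ab(4)] by auto
    qed (use ab t in \<open>auto simp: L_def R_def\<close>)
  qed (use interior_subset in \<open>auto simp: L_def R_def\<close>)
  ultimately show ?thesis
    by (metis borel_open countable_Un open_interior sets.Un sets.countable borel_closed closed_singleton)
qed

text \<open>If the value at (x,t) exceeds \<open>a\<close>, then by continuity along the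
  characteristic it does so on a nondegenerate interval of times with \<open>t\<close> in it,
  possibly as an end point. So the superlevel sets have the shape treated before, although nothing
  is known across characteristics.\<close>

lemma sup_norm_measurable:
  assumes cont: "\<And>\<xi>. \<xi> \<ge> 0 \<Longrightarrow> continuous_on {max 0 (\<xi> - 1)..\<xi>} (\<lambda>t. w (\<xi> - t) t)"
  shows "(\<lambda>t. sup_norm (\<lambda>x. w x t)) \<in> borel_measurable (lebesgue_on {0..})"
proof (rule borel_measurableI_greater)
  fix a :: ennreal
  \<comment> \<open>Time 0 is split off because the characteristic through the corner x = 0, t = 0
    is a single point.\<close>
  define E where "E = {t. 0 < t \<and> (\<exists>x\<in>{0..1}. a < ennreal \<bar>w x t\<bar>)}"
  have "E \<in> sets borel"
  proof (rule borel_if_locally_nondegenerate)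
    fix t assume "t \<in> E"
    then obtain x where x: "0 < t" "0 \<le> x" "x \<le> 1" "a < ennreal \<bar>w x t\<bar>" by (auto simp: E_def)
    define m where "m = max 0 (x + t - 1)"
    have m: "m \<le> t" "m < x + t" "0 \<le> m" using x by (auto simp: m_def)
    have "continuous_on {m..x+t} (\<lambda>s. ennreal \<bar>w (x + t - s) s\<bar>)"
      using cont[of "x + t"] x unfolding m_def
      by (intro continuous_on_ennreal continuous_on_rabs) auto
    then have "openin (top_of_set {m..x+t}) ({m..x+t} \<inter> (\<lambda>s. ennreal \<bar>w (x + t - s) s\<bar>) -` {a<..})"
      by (intro continuous_openin_preimage_gen) auto
    moreover have "t \<in> {m..x+t} \<inter> (\<lambda>s. ennreal \<bar>w (x + t - s) s\<bar>) -` {a<..}"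
      using x m by auto
    ultimately obtain d where d0: "d > 0" and "\<forall>s\<in>{m..x+t}. dist s t < d \<longrightarrow>
        s \<in> {m..x+t} \<inter> (\<lambda>s. ennreal \<bar>w (x + t - s) s\<bar>) -` {a<..}"
      unfolding openin_euclidean_subtopology_iff by blast
    then have d: "d > 0" "\<And>s. s \<in> {m..x+t} \<Longrightarrow> \<bar>s - t\<bar> < d \<Longrightarrow> a < ennreal \<bar>w (x + t - s) s\<bar>"
      by (auto simp: dist_real_def)
    show "\<exists>p q. p < q \<and> p \<le> t \<and> t \<le> q \<and> {p<..<q} \<subseteq> E"
    proof (intro exI conjI)
      show "max m (t - d/2) < min (x + t) (t + d/2)" "max m (t - d/2) \<le> t" "t \<le> min (x + t) (t + d/2)"
        using m d x by auto
      show "{max m (t - d/2)<..<min (x + t) (t + d/2)} \<subseteq> E"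
      proof
        fix s assume s: "s \<in> {max m (t - d/2)<..<min (x + t) (t + d/2)}"
        then have "a < ennreal \<bar>w (x + t - s) s\<bar>" using d(1) by (intro d(2)) (auto simp: abs_if)
        moreover have "x + t - s \<in> {0..1}" using s by (auto simp: m_def)
        ultimately show "s \<in> E" using s m by (auto simp: E_def)
      qed
    qed
  qed
  moreover have "{t \<in> space (lebesgue_on {0..}). a < sup_norm (\<lambda>x. w x t)}
      = E \<union> {t. t = 0 \<and> a < sup_norm (\<lambda>x. w x t)}"
    by (auto simp: E_def sup_norm_def less_SUP_iff)
  moreover have "{t. t = 0 \<and> P t} \<in> sets borel" for P :: "real \<Rightarrow> bool"
    by (cases "P 0") (auto simp: conj_commute cong: conj_cong)
  ultimately have "{t \<in> space (lebesgue_on {0..}). a < sup_norm (\<lambda>x. w x t)} \<in> sets lebesgue"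
    by auto
  then show "{t \<in> space (lebesgue_on {0..}). a < sup_norm (\<lambda>x. w x t)} \<in> sets (lebesgue_on {0..})"
    by (subst sets_restrict_space_iff) auto
qed

section \<open>Translation of integrals, and continuity in time of the spatial norm\<close>

lemma integral_shift_left:
  fixes f :: "real \<Rightarrow> real"
  shows "integral {a..b} (\<lambda>x. f (c + x)) = integral {a+c..b+c} f"
  using integral_shift_Icc_real[of a b f c] by (simp add: o_def)

lemma integrable_shift_left:
  fixes f :: "real \<Rightarrow> real"
  shows "(\<lambda>x. f (c + x)) integrable_on {a..b} \<longleftrightarrow> f integrable_on {a+c..b+c}"
  using integrable_on_shift_Icc_real[of f c a b] by (simp add: o_def)

lemma absolutely_integrable_shift_left:
  fixes f :: "real \<Rightarrow> real"
  shows "(\<lambda>x. f (c + x)) absolutely_integrable_on {a..b} \<longleftrightarrow> f absolutely_integrable_on {a+c..b+c}"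
  unfolding absolutely_integrable_on_def
  using integrable_shift_left[of f c a b] integrable_shift_left[of "\<lambda>x. \<bar>f x\<bar>" c a b] by simp

lemma square_integrable_shift_left:
  fixes f :: "real \<Rightarrow> real"
  shows "(\<lambda>x. f (c + x)) square_integrable_on {a..b} \<longleftrightarrow> f square_integrable_on {a+c..b+c}"
proof
  assume "(\<lambda>x. f (c + x)) square_integrable_on {a..b}"
  from square_integrable_imp_absolutely_integrable(1,2)[OF this]
  show "f square_integrable_on {a+c..b+c}"
    by (intro absolutely_integrable_imp_square_integrable)
      (auto simp: absolutely_integrable_shift_left absolutely_integrable_shift_left[where f = "\<lambda>x. (f x)\<^sup>2"] dest: absolutely_integrable_integrable)
next
  assume "f square_integrable_on {a+c..b+c}"
  from square_integrable_imp_absolutely_integrable(1,2)[OF this]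
  show "(\<lambda>x. f (c + x)) square_integrable_on {a..b}"
    by (intro absolutely_integrable_imp_square_integrable)
      (auto simp: absolutely_integrable_shift_left absolutely_integrable_shift_left[where f = "\<lambda>x. (f x)\<^sup>2", symmetric] dest: absolutely_integrable_integrable)
qed

lemma l2_norm_nonneg: "l2_norm a \<ge> 0"
  by (cases "(\<lambda>x. (a x)\<^sup>2) integrable_on {0..1}")
     (auto simp: l2_norm_def not_integrable_integral intro: integral_nonneg)

text \<open>In the coordinate \<open>\<xi> = x + t\<close> the integrand is continuous in \<open>t\<close> for every \<open>\<xi>\<close>, so that
  dominated convergence applies.\<close>

lemma l2_norm_continuous_on:
  assumes cont: "\<And>\<xi>. \<xi> \<ge> 0 \<Longrightarrow> continuous_on {max 0 (\<xi> - 1)..\<xi>} (\<lambda>t. w (\<xi> - t) t)"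
    and sq: "\<And>t. t \<ge> 0 \<Longrightarrow> (\<lambda>x. w x t) square_integrable_on {0..1}"
    and H: "(\<lambda>\<xi>. (H \<xi>)\<^sup>2) integrable_on {0..T+1}"
    and bd: "\<And>x t. x \<in> {0..1} \<Longrightarrow> t \<in> {0..T} \<Longrightarrow> \<bar>w x t\<bar> \<le> H (x + t)"
  shows "continuous_on {0..T} (\<lambda>t. l2_norm (\<lambda>x. w x t))"
proof -
  \<comment> \<open>The window from \<open>t\<close> to \<open>t + 1\<close> moves with time. Its
    end points at the limit time \<open>c\<close>, where pointwise convergence may fail, are
    removed; they form a null set.\<close>
  define W where "W c t \<xi> = (if \<xi> \<in> {t..t+1} \<and> \<xi> \<noteq> c \<and> \<xi> \<noteq> c + 1 then (w (\<xi> - t) t)\<^sup>2 else 0)" for c t \<xi>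
  have W: "(W c t has_integral (l2_norm (\<lambda>x. w x t))\<^sup>2) {0..T+1}" if t: "t \<in> {0..T}" for c t
  proof -
    have i: "(\<lambda>x. (w x t)\<^sup>2) integrable_on {0..1}" using sq[of t] t by (auto simp: square_integrable_on_def)
    have "((\<lambda>x. (w (x - t) t)\<^sup>2) has_integral integral {0..1} (\<lambda>x. (w x t)\<^sup>2)) {t..t+1}"
      using has_integral_shift_Icc_real[of "\<lambda>x. (w (x - t) t)\<^sup>2" t _ 0 1] integrable_integral[OF i]
      by (auto simp: o_def add.commute)
    then have "((\<lambda>x. if x \<in> {t..t+1} then (w (x - t) t)\<^sup>2 else 0) has_integral integral {0..1} (\<lambda>x. (w x t)\<^sup>2)) {0..T+1}"
      using t by (subst has_integral_restrict) auto
    then have "(W c t has_integral integral {0..1} (\<lambda>x. (w x t)\<^sup>2)) {0..T+1}"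
      by (rule has_integral_spike_finite[where S = "{c, c+1}", rotated 2]) (auto simp: W_def)
    moreover have "integral {0..1} (\<lambda>x. (w x t)\<^sup>2) \<ge> 0" using i by (intro integral_nonneg) auto
    ultimately show ?thesis by (simp add: l2_norm_def)
  qed
  have "continuous_on {0..T} (\<lambda>t. (l2_norm (\<lambda>x. w x t))\<^sup>2)"
    unfolding continuous_on_sequentially comp_def
  proof safe
    fix X :: "nat \<Rightarrow> real" and t assume t: "t \<in> {0..T}" and X: "\<forall>n. X n \<in> {0..T}" "X \<longlonglongrightarrow> t"
    have "(\<lambda>n. integral {0..T+1} (W t (X n))) \<longlonglongrightarrow> integral {0..T+1} (W t t)"
    proof (rule dominated_convergence(2)[OF _ H])
      show "W t (X n) integrable_on {0..T+1}" for n
        using W[of "X n" t] X by (auto simp: integrable_on_def)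
      show "norm (W t (X n) \<xi>) \<le> (H \<xi>)\<^sup>2" if "\<xi> \<in> {0..T+1}" for n \<xi>
        using bd[of "\<xi> - X n" "X n"] X(1) power_mono[of "\<bar>w (\<xi> - X n) (X n)\<bar>" "H \<xi>" 2]
        by (auto simp: W_def)
      fix \<xi> assume xi: "\<xi> \<in> {0..T+1}"
      show "(\<lambda>n. W t (X n) \<xi>) \<longlonglongrightarrow> W t t \<xi>"
      proof (cases "\<xi> \<noteq> t \<and> \<xi> \<noteq> t + 1 \<and> \<xi> \<in> {t..t+1}")
        case True
        then have "\<forall>\<^sub>F n in sequentially. X n < \<xi>" "\<forall>\<^sub>F n in sequentially. X n > \<xi> - 1"
          using X(2) by (auto intro: order_tendstoD)
        then have ev: "\<forall>\<^sub>F n in sequentially. X n \<in> {max 0 (\<xi> - 1)..\<xi>}"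
          by eventually_elim (use X(1) in auto)
        have "(\<lambda>n. (w (\<xi> - X n) (X n))\<^sup>2) \<longlonglongrightarrow> (w (\<xi> - t) t)\<^sup>2"
          by (rule continuous_on_tendsto_compose[OF continuous_on_power[OF cont[of \<xi>]] X(2) _ ev])
            (use True t xi in auto)
        moreover have "\<forall>\<^sub>F n in sequentially. W t (X n) \<xi> = (w (\<xi> - X n) (X n))\<^sup>2"
          using ev by eventually_elim (use True in \<open>auto simp: W_def\<close>)
        ultimately show ?thesis using True by (simp add: W_def tendsto_cong)
      next
        case False
        have "\<forall>\<^sub>F n in sequentially. W t (X n) \<xi> = 0"
        proof (cases "\<xi> = t \<or> \<xi> = t + 1")
          case True then show ?thesis by (auto simp: W_def)
        next
          case F2: False
          then have "\<xi> < t \<or> \<xi> > t + 1" using False by auto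
          then have "(\<forall>\<^sub>F n in sequentially. \<xi> < X n) \<or> (\<forall>\<^sub>F n in sequentially. X n < \<xi> - 1)"
            using X(2) by (auto intro: order_tendstoD)
          then show ?thesis
          proof
            assume "\<forall>\<^sub>F n in sequentially. \<xi> < X n" then show ?thesis
              by eventually_elim (auto simp: W_def)
          next
            assume "\<forall>\<^sub>F n in sequentially. X n < \<xi> - 1" then show ?thesis
              by eventually_elim (auto simp: W_def)
          qed
        qed
        moreover have "W t t \<xi> = 0" using False by (auto simp: W_def)
        ultimately show ?thesis by (simp add: tendsto_eventually)
      qed
    qed
    then show "(\<lambda>n. (l2_norm (\<lambda>x. w x (X n)))\<^sup>2) \<longlonglongrightarrow> (l2_norm (\<lambda>x. w x t))\<^sup>2"
      using integral_unique[OF W[OF t, of t]] integral_unique[OF W[of "X _" t]] X(1) by simp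
  qed
  then have "continuous_on {0..T} (\<lambda>t. sqrt ((l2_norm (\<lambda>x. w x t))\<^sup>2))"
    by (rule continuous_on_real_sqrt)
  then show ?thesis by (simp only: real_sqrt_abs abs_of_nonneg l2_norm_nonneg)
qed

lemma nn_integral_halfline_le:
  fixes f :: "real \<Rightarrow> real"
  assumes f: "\<And>t. t \<ge> 0 \<Longrightarrow> 0 \<le> f t" "\<And>T. T \<ge> 0 \<Longrightarrow> f integrable_on {0..T}"
    and C: "\<And>T. T \<ge> 0 \<Longrightarrow> integral {0..T} f \<le> C"
  shows "(\<integral>\<^sup>+t. ennreal (f t) \<partial>lebesgue_on {0..}) \<le> ennreal C"
proof -
  define g where "g n t = ennreal (f t) * indicator {0..real n} t" for n :: nat and t :: real
  have fn: "f absolutely_integrable_on {0..real n}" for n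
    using f by (intro nonnegative_absolutely_integrable_1) auto
  have gm: "g n \<in> borel_measurable lebesgue" for n
  proof -
    have "(\<lambda>t. indicator {0..real n} t *\<^sub>R f t) \<in> borel_measurable lebesgue"
      using fn[of n] by (auto simp: set_integrable_def)
    then have "(\<lambda>t. ennreal (indicator {0..real n} t *\<^sub>R f t)) \<in> borel_measurable lebesgue" by measurable
    moreover have "ennreal (indicator {0..real n} t *\<^sub>R f t) = g n t" for t
      by (auto simp: g_def split: split_indicator)
    ultimately show ?thesis by (simp cong: measurable_cong)
  qed
  have "(\<integral>\<^sup>+t. ennreal (f t) \<partial>lebesgue_on {0..}) = (\<integral>\<^sup>+t. ennreal (f t) * indicator {0..} t \<partial>lebesgue)"
    by (subst nn_integral_restrict_space) auto
  also have "\<dots> = (\<integral>\<^sup>+t. (SUP n. g n t) \<partial>lebesgue)"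
  proof (rule nn_integral_cong)
    fix t :: real
    show "ennreal (f t) * indicator {0..} t = (SUP n. g n t)"
    proof (cases "t \<ge> 0")
      case True
      obtain N where "t \<le> real N" using real_arch_simple by auto
      then have "g N t = ennreal (f t)" using True by (simp add: g_def)
      moreover have "g n t \<le> ennreal (f t)" for n by (auto simp: g_def split: split_indicator)
      ultimately have "(SUP n. g n t) = ennreal (f t)"
        by (intro antisym SUP_least) (auto intro: SUP_upper2[of N])
      then show ?thesis using True by simp
    qed (auto simp: g_def)
  qed
  also have "\<dots> = (SUP n. \<integral>\<^sup>+t. g n t \<partial>lebesgue)"
  proof (rule nn_integral_monotone_convergence_SUP[OF _ gm])
    show "incseq g" by (auto simp: incseq_def le_fun_def g_def split: split_indicator)
  qed
  also have "\<dots> \<le> ennreal C"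
  proof (rule SUP_least)
    fix n
    have "(\<integral>\<^sup>+t. g n t \<partial>lebesgue) = (\<integral>\<^sup>+t. ennreal (indicator {0..real n} t *\<^sub>R f t) \<partial>lebesgue)"
      by (intro nn_integral_cong) (auto simp: g_def split: split_indicator)
    also have "\<dots> = ennreal (\<integral>t. indicator {0..real n} t *\<^sub>R f t \<partial>lebesgue)"
      using fn[of n] f(1) by (intro nn_integral_eq_integral) (auto simp: set_integrable_def split: split_indicator)
    also have "\<dots> = ennreal (integral {0..real n} f)"
      using set_lebesgue_integral_eq_integral(2)[OF fn[of n]] by (simp add: set_lebesgue_integral_def)
    also have "\<dots> \<le> ennreal C" using C[of "real n"] by (simp add: ennreal_leI)
    finally show "(\<integral>\<^sup>+t. g n t \<partial>lebesgue) \<le> ennreal C" .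
  qed
  finally show ?thesis .
qed

section \<open>The Volterra kernel\<close>

text \<open>The substitution y = z s moves the variable end point into the integrand, so that
  continuity of a parameter integral over a fixed interval applies.\<close>

lemma continuous_on_convolution:
  fixes \<psi> \<kappa> :: "real \<Rightarrow> real"
  assumes \<psi>: "continuous_on {0..1} \<psi>" and \<kappa>: "continuous_on {0..1} \<kappa>"
  shows "continuous_on {0..1} (\<lambda>z. integral {0..z} (\<lambda>y. \<psi> (z - y) * \<kappa> y))"
proof -
  have "continuous_on {0..1} (\<lambda>z. z * integral (cbox 0 1) (\<lambda>s. \<psi> (z - z * s) * \<kappa> (z * s)))"
  proof (intro continuous_intros integral_continuous_on_param)
    have 1: "z - z * s \<in> {0..1}" "z * s \<in> {0..1}" if "(z::real) \<in> {0..1}" "s \<in> {0..1}" for z s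

    proof -
      have "0 \<le> z * s" "z * s \<le> z" using that mult_left_le[of s z] by auto
      then show "z - z * s \<in> {0..1}" "z * s \<in> {0..1}" using that by (auto simp del: zero_le_mult_iff)
    qed
    show "continuous_on ({0..1} \<times> cbox 0 1) (\<lambda>(z, s). \<psi> (z - z * s) * \<kappa> (z * s))"
      unfolding split_beta'
      by (intro continuous_on_mult continuous_on_compose2[OF \<psi>] continuous_on_compose2[OF \<kappa>] continuous_intros)
        (use 1 in auto)
  qed
  then show ?thesis
  proof (rule continuous_on_eq)
    fix z :: real assume z: "z \<in> {0..1}"
    show "z * integral (cbox 0 1) (\<lambda>s. \<psi> (z - z * s) * \<kappa> (z * s)) = integral {0..z} (\<lambda>y. \<psi> (z - y) * \<kappa> y)"
      using integral_stretch_real[of z 0 z "\<lambda>y. \<psi> (z - y) * \<kappa> y"] z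
      by (cases "z = 0") (auto simp: image_divide_atLeastAtMost)
  qed
qed

text \<open>Gronwall is applied to the primitive \<open>N\<close> of the modulus of
  \<open>d\<close>, which is monotone, and the bound for \<open>N 1\<close> is inserted once more
  into the hypothesis. With \<open>c = 0\<close> this gives uniqueness, with \<open>c = B\<close>
  the bound for the kernel.\<close>

lemma volterra_gronwall:
  fixes d :: "real \<Rightarrow> real"
  assumes d: "continuous_on {0..1} d" and B: "B \<ge> 0" and c: "c \<ge> 0"
    and le: "\<And>x. x \<in> {0..1} \<Longrightarrow> \<bar>d x\<bar> \<le> c + B * integral {0..x} (\<lambda>y. \<bar>d y\<bar>)"
    and x: "x \<in> {0..1}"
  shows "\<bar>d x\<bar> \<le> c + B * (c * exp (1 + 2 * B))"
proof -
  define N where "N x = integral {0..x} (\<lambda>y. \<bar>d y\<bar>)" for x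
  have ad: "continuous_on {0..1} (\<lambda>y. \<bar>d y\<bar>)" using d by (intro continuous_intros)
  have adi: "(\<lambda>y. \<bar>d y\<bar>) integrable_on {s..t}" if "0 \<le> s" "t \<le> 1" for s t
    by (intro integrable_continuous_interval continuous_on_subset[OF ad]) (use that in auto)
  have Nc: "continuous_on {0..1} N"
    unfolding N_def by (intro indefinite_integral_continuous_1 adi) auto
  have N0: "N x \<ge> 0" if "x \<in> {0..1}" for x
    unfolding N_def using adi that by (intro integral_nonneg) auto
  have mono: "N s \<le> N t" if "0 \<le> s" "s \<le> t" "t \<le> 1" for s t
    unfolding N_def using that adi by (intro integral_subset_le) auto
  have BN: "(\<lambda>s. B * N s) integrable_on {s..t}" if "0 \<le> s" "t \<le> 1" for s t
    by (intro integrable_continuous_interval continuous_intros continuous_on_subset[OF Nc]) (use that in auto)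
  have "N 1 \<le> c * exp (1 + 2 * integral {0..1} (\<lambda>_::real. B))"
  proof (rule gronwall_integral[where a = 0 and b = 1 and f = N and q = "\<lambda>_. B" and c = c, OF _ mono _ _ _ _ _ c])
    show "(\<lambda>s. B * N s) integrable_on {0..1}" using BN by auto
    fix t :: real assume t: "t \<in> {0..1}"
    show "0 \<le> N t" using N0 t by auto
    have "N t \<le> integral {0..t} (\<lambda>s. c + B * N s)"
      unfolding N_def
      by (rule integral_le) (use t adi le BN[unfolded N_def] in \<open>auto intro!: integrable_add\<close>)
    also have "\<dots> = c * t + integral {0..t} (\<lambda>s. B * N s)"
      using BN[of 0 t] t by (subst integral_add) auto
    also have "c * t \<le> c" using t c by (auto intro: mult_left_le)
    finally show "N t \<le> c + integral {0..t} (\<lambda>s. B * N s)" by simp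
  qed (use B in auto)
  then have "N 1 \<le> c * exp (1 + 2 * B)" by simp
  then show ?thesis
    using le[OF x] mult_left_mono[of "N x" "c * exp (1 + 2 * B)" B] mono[of x 1] x B
    unfolding N_def[symmetric] by auto
qed

locale volterra_data =
  fixes \<phi> :: "real \<Rightarrow> real" and B :: real
  assumes phi_cont: "continuous_on {0..1} \<phi>" and B_pos: "B > 0"
    and phi_bound: "\<And>x. x \<in> {0..1} \<Longrightarrow> \<bar>\<phi> x\<bar> \<le> B"
begin

lemma conv_integrable:
  assumes "continuous_on {0..1} k" "x \<in> {0..1}"
  shows "(\<lambda>y. \<phi> (x - y) * k y) integrable_on {0..x}"
  by (intro integrable_continuous_interval continuous_on_mult continuous_on_compose2[OF phi_cont]
        continuous_on_subset[OF assms(1)] continuous_intros) (use assms in auto)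

lemma conv_bound:
  assumes "continuous_on {0..1} k" "x \<in> {0..1}"
  shows "\<bar>integral {0..x} (\<lambda>y. \<phi> (x - y) * k y)\<bar> \<le> B * integral {0..x} (\<lambda>y. \<bar>k y\<bar>)"
proof -
  have "\<bar>integral {0..x} (\<lambda>y. \<phi> (x - y) * k y)\<bar> \<le> integral {0..x} (\<lambda>y. B * \<bar>k y\<bar>)"
  proof (rule integral_abs_bound_integral)
    show "(\<lambda>y. B * \<bar>k y\<bar>) integrable_on {0..x}"
      by (intro integrable_continuous_interval continuous_intros continuous_on_subset[OF assms(1)])
        (use assms in auto)
    show "\<bar>\<phi> (x - y) * k y\<bar> \<le> B * \<bar>k y\<bar>" if "y \<in> {0..x}" for y
      using phi_bound[of "x - y"] that assms by (auto simp: abs_mult intro!: mult_right_mono)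
  qed (rule conv_integrable[OF assms])
  then show ?thesis by simp
qed

text \<open>With the weight \<open>exp (- 2 * B * x)\<close> the integral operator becomes a contraction for the supremum norm.\<close>

lemma volterra_exists:
  "\<exists>k. continuous_on {0..1} k \<and>
       (\<forall>x\<in>{0..1}. k x = - \<phi> x + integral {0..x} (\<lambda>y. \<phi> (x - y) * k y))"
proof -
  define \<psi> where "\<psi> x = exp (- (2 * B * x)) * \<phi> x" for x
  \<comment> \<open>Clamping extends functions from the unit interval to the line, so that the fixed
    point can be sought in the complete space of bounded continuous functions.\<close>
  define cl where "cl x = max 0 (min 1 x)" for x :: real
  have cl: "cl x \<in> {0..1}" for x by (auto simp: cl_def)
  have \<psi>: "continuous_on {0..1} \<psi>"
    unfolding \<psi>_def by (intro continuous_intros phi_cont)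
  define G where "G \<kappa> z = - \<psi> z + integral {0..z} (\<lambda>y. \<psi> (z - y) * \<kappa> y)" for \<kappa> z
  have Gc: "continuous_on {0..1} (G \<kappa>)" if "continuous_on {0..1} \<kappa>" for \<kappa>
    unfolding G_def by (intro continuous_on_add continuous_on_minus \<psi> continuous_on_convolution that)
  have Gb: "(\<lambda>x. G (apply_bcontfun \<kappa>) (cl x)) \<in> bcontfun" for \<kappa>
  proof -
    have "continuous_on UNIV (\<lambda>x. G \<kappa> (cl x))"
      by (rule continuous_on_compose2[OF Gc]) (auto simp: cl_def intro!: continuous_intros)
    moreover have "bounded (G \<kappa> ` {0..1})"
      by (intro compact_imp_bounded compact_continuous_image Gc) auto
    then have "bounded (range (\<lambda>x. G \<kappa> (cl x)))"
      by (rule bounded_subset) (use cl in auto)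
    ultimately show ?thesis by (auto simp: bcontfun_def)
  qed
  define T where "T \<kappa> = Bcontfun (\<lambda>x. G (apply_bcontfun \<kappa>) (cl x))" for \<kappa>
  have T: "apply_bcontfun (T \<kappa>) x = G \<kappa> (cl x)" for \<kappa> x
    unfolding T_def using Bcontfun_inverse[OF Gb] by simp
  have \<psi>i: "(\<lambda>y. \<psi> (z - y) * apply_bcontfun \<kappa> y) integrable_on {0..z}" if "z \<in> {0..1}" for z \<kappa>
    by (intro integrable_continuous_interval continuous_on_mult continuous_on_compose2[OF \<psi>]
         continuous_intros) (use that in auto)
  have "\<exists>!\<kappa>. T \<kappa> = \<kappa>"
  proof (rule banach_fix_type)
    show "\<forall>\<kappa> \<mu>. dist (T \<kappa>) (T \<mu>) \<le> 1/2 * dist \<kappa> \<mu>"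
    proof (intro allI dist_bound)
      fix \<kappa> \<mu> :: "real \<Rightarrow>\<^sub>C real" and x
      define z where "z = cl x"
      have z: "z \<in> {0..1}" using cl z_def by auto
      \<comment> \<open>The primitive of the weight times \<open>B\<close> is half the weight: this
        is the contraction factor 1/2.\<close>
      have e: "((\<lambda>y. B * exp (- (2 * B * (z - y)))) has_integral
            (exp (- (2 * B * (z - z))) / 2 - exp (- (2 * B * (z - 0))) / 2)) {0..z}"
        by (rule fundamental_theorem_of_calculus)
          (use z B_pos in \<open>auto intro!: derivative_eq_intros simp: has_real_derivative_iff_has_vector_derivative[symmetric]\<close>)
      have "\<bar>G \<kappa> z - G \<mu> z\<bar> = \<bar>integral {0..z} (\<lambda>y. \<psi> (z - y) * (\<kappa> y - \<mu> y))\<bar>"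
        unfolding G_def using integral_diff[OF \<psi>i[OF z, of \<kappa>] \<psi>i[OF z, of \<mu>]]
        by (simp add: right_diff_distrib)
      also have "\<dots> \<le> integral {0..z} (\<lambda>y. dist \<kappa> \<mu> * (B * exp (- (2 * B * (z - y)))))"
      proof (rule integral_abs_bound_integral)
        show "(\<lambda>y. \<psi> (z - y) * (\<kappa> y - \<mu> y)) integrable_on {0..z}"
          using integrable_diff[OF \<psi>i[OF z, of \<kappa>] \<psi>i[OF z, of \<mu>]] by (simp add: right_diff_distrib)
        show "(\<lambda>y. dist \<kappa> \<mu> * (B * exp (- (2 * B * (z - y))))) integrable_on {0..z}"
          by (rule integrable_on_mult_right[OF has_integral_integrable[OF e]])
        fix y assume y: "y \<in> {0..z}"
        have "\<bar>\<kappa> y - \<mu> y\<bar> \<le> dist \<kappa> \<mu>" using dist_bounded[of \<kappa> y \<mu>] by (simp add: dist_real_def)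
        moreover have "\<bar>\<psi> (z - y)\<bar> \<le> B * exp (- (2 * B * (z - y)))"
          using phi_bound[of "z - y"] y z unfolding \<psi>_def by (auto simp: abs_mult mult.commute)
        ultimately show "\<bar>\<psi> (z - y) * (\<kappa> y - \<mu> y)\<bar> \<le> dist \<kappa> \<mu> * (B * exp (- (2 * B * (z - y))))"
          using B_pos unfolding abs_mult by (subst mult.commute) (intro mult_mono, auto)
      qed
      also have "\<dots> = dist \<kappa> \<mu> * (1/2 - exp (- (2 * B * z)) / 2)"
        using integral_unique[OF e] by simp
      also have "\<dots> \<le> 1/2 * dist \<kappa> \<mu>"
        using mult_left_mono[of "1/2 - exp (- (2 * B * z)) / 2" "1/2" "dist \<kappa> \<mu>"] by simp
      finally show "dist (apply_bcontfun (T \<kappa>) x) (apply_bcontfun (T \<mu>) x) \<le> 1/2 * dist \<kappa> \<mu>"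
        by (simp add: T dist_real_def z_def)
    qed
  qed auto
  then obtain \<kappa> where \<kappa>: "T \<kappa> = \<kappa>" by auto
  define k where "k x = exp (2 * B * x) * \<kappa> x" for x
  have kc: "continuous_on {0..1} k" unfolding k_def by (intro continuous_intros) auto
  moreover have "k x = - \<phi> x + integral {0..x} (\<lambda>y. \<phi> (x - y) * k y)" if x: "x \<in> {0..1}" for x
  proof -
    have *: "exp (2 * B * x) * (\<psi> (x - y) * \<kappa> y) = \<phi> (x - y) * k y" for y
    proof -
      have "exp (2 * B * x) * exp (- (2 * B * (x - y))) = exp (2 * B * y)"
        by (simp add: exp_add[symmetric] algebra_simps)
      moreover have "exp (2 * B * x) * (\<psi> (x - y) * \<kappa> y)
          = (exp (2 * B * x) * exp (- (2 * B * (x - y)))) * (\<phi> (x - y) * \<kappa> y)"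
        by (simp add: \<psi>_def)
      ultimately show ?thesis unfolding k_def by (simp only: mult.left_commute)
    qed
    have "\<kappa> x = G \<kappa> x" using T[of \<kappa> x] \<kappa> x by (simp add: cl_def)
    then have "k x = exp (2 * B * x) * (- \<psi> x) + integral {0..x} (\<lambda>y. exp (2 * B * x) * (\<psi> (x - y) * \<kappa> y))"
      by (simp add: k_def G_def right_diff_distrib)
    also have "exp (2 * B * x) * (- \<psi> x) = - \<phi> x" by (simp add: \<psi>_def exp_minus)
    finally show ?thesis unfolding * .
  qed
  ultimately show ?thesis by blast
qed

lemma kernel_op_spec:
  "continuous_on {0..1} (kernel_op \<phi>)"
  "x \<in> {0..1} \<Longrightarrow> kernel_op \<phi> x = - \<phi> x + integral {0..x} (\<lambda>y. \<phi> (x - y) * kernel_op \<phi> y)"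
proof -
  let ?P = "\<lambda>k. continuous_on {0..1} k \<and>
             (\<forall>x\<in>{0..1}. k x = - \<phi> x + integral {0..x} (\<lambda>y. \<phi> (x - y) * k y)) \<and>
             (\<forall>x. x \<notin> {0..1} \<longrightarrow> k x = 0)"
  have "\<exists>!k. ?P k"
  proof (rule ex_ex1I)
    from volterra_exists obtain k where k1: "continuous_on {0..1} k"
      and k2: "\<forall>x\<in>{0..1}. k x = - \<phi> x + integral {0..x} (\<lambda>y. \<phi> (x - y) * k y)"
      by (elim exE conjE)
    note k = k1 bspec[OF k2]
    define k' where "k' x = (if x \<in> {0..1} then k x else 0)" for x
    have "continuous_on {0..1} k'"
      using k(1) by (rule continuous_on_eq) (simp add: k'_def)
    moreover have "\<forall>x\<in>{0..1}. k' x = - \<phi> x + integral {0..x} (\<lambda>y. \<phi> (x - y) * k' y)"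
    proof
      fix x :: real assume x: "x \<in> {0..1}"
      have eq: "integral {0..x} (\<lambda>y. \<phi> (x - y) * k y) = integral {0..x} (\<lambda>y. \<phi> (x - y) * k' y)"
        by (rule integral_cong) (use x in \<open>auto simp: k'_def\<close>)
      have "k' x = k x" using x by (simp add: k'_def)
      also note k(2)[OF x]
      also note eq
      finally show "k' x = - \<phi> x + integral {0..x} (\<lambda>y. \<phi> (x - y) * k' y)" .
    qed
    moreover have "\<forall>x. x \<notin> {0..1} \<longrightarrow> k' x = 0" by (simp add: k'_def)
    ultimately have "?P k'" by (intro conjI)
    then show "\<exists>k. ?P k" by (rule exI[of _ k'])
  next
    fix k l assume k: "?P k" and l: "?P l"
    note kc = conjunct1[OF k] and lc = conjunct1[OF l]
      and ke = bspec[OF conjunct1[OF conjunct2[OF k]]] and le = bspec[OF conjunct1[OF conjunct2[OF l]]]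
      and k0 = conjunct2[OF conjunct2[OF k], rule_format] and l0 = conjunct2[OF conjunct2[OF l], rule_format]
    define d where "d x = k x - l x" for x
    have dc: "continuous_on {0..1} d" unfolding d_def by (intro continuous_intros kc lc)
    have "\<bar>d x\<bar> \<le> 0 + B * integral {0..x} (\<lambda>y. \<bar>d y\<bar>)" if x: "x \<in> {0..1}" for x
    proof -
      have "d x = integral {0..x} (\<lambda>y. \<phi> (x - y) * k y) - integral {0..x} (\<lambda>y. \<phi> (x - y) * l y)"
        using ke[OF x] le[OF x] unfolding d_def by linarith
      also have "\<dots> = integral {0..x} (\<lambda>y. \<phi> (x - y) * d y)"
        unfolding d_def using integral_diff[OF conv_integrable[OF kc x] conv_integrable[OF lc x]]
        by (simp add: right_diff_distrib)
      finally show ?thesis using conv_bound[OF dc x] by simp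
    qed
    then have "\<bar>d x\<bar> \<le> 0" if "x \<in> {0..1}" for x
      using volterra_gronwall[OF dc, of B 0 x] that B_pos by auto
    then have kl: "k x = l x" if "x \<in> {0..1}" for x using that unfolding d_def by simp
    show "k = l"
    proof (rule ext)
      fix x show "k x = l x" using kl[of x] k0[of x] l0[of x] by (cases "x \<in> {0..1}") simp_all
    qed
  qed
  then have K: "?P (kernel_op \<phi>)" unfolding kernel_op_def by (rule theI')
  from K show "continuous_on {0..1} (kernel_op \<phi>)" by (rule conjunct1)
  show "kernel_op \<phi> x = - \<phi> x + integral {0..x} (\<lambda>y. \<phi> (x - y) * kernel_op \<phi> y)" if "x \<in> {0..1}"
    using conjunct1[OF conjunct2[OF K]] that by (rule bspec)
qed

text \<open>The bound depends on \<open>B\<close> alone, so it is uniform over all estimates that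
  the projection admits, hence over all times.\<close>

lemma kernel_op_bound:
  assumes "x \<in> {0..1}"
  shows "\<bar>kernel_op \<phi> x\<bar> \<le> B + B * (B * exp (1 + 2 * B))"
proof (rule volterra_gronwall[OF kernel_op_spec(1) _ _ _ assms])
  show "\<bar>kernel_op \<phi> x\<bar> \<le> B + B * integral {0..x} (\<lambda>y. \<bar>kernel_op \<phi> y\<bar>)" if "x \<in> {0..1}" for x
    using kernel_op_spec(2)[OF that] phi_bound[OF that] conv_bound[OF kernel_op_spec(1) that] by linarith
qed (use B_pos in auto)

end

section \<open>The projection and the observer error\<close>

lemma sup_norm_le_iff:
  assumes "c \<ge> 0"
  shows "sup_norm a \<le> ennreal c \<longleftrightarrow> (\<forall>x\<in>{0..1}. \<bar>a x\<bar> \<le> c)"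
  unfolding sup_norm_def SUP_le_iff using assms by (simp add: ennreal_le_iff)

lemma Proj_cases: "Proj B a b = 0 \<or> Proj B a b = a"
  by (simp add: Proj_def)

text \<open>The projection takes only the two values 0 and \<open>a\<close>, and the segment between
  them is closed and convex.\<close>

lemma filippov_Proj_segment:
  assumes "w \<in> filippov D (Proj B a) b"
  shows "w \<in> closed_segment 0 a"
proof -
  have "closure (convex hull (Proj B a ` (D \<inter> ball b 1))) \<subseteq> closed_segment 0 a"
  proof (intro closure_minimal hull_minimal)
    show "Proj B a ` (D \<inter> ball b 1) \<subseteq> closed_segment 0 a"
    proof (rule image_subsetI)
      fix y show "Proj B a y \<in> closed_segment 0 a" using Proj_cases[of B a y] by auto
    qed
  qed auto
  then show ?thesis using assms by (auto simp: filippov_def)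
qed

lemma filippov_Proj_eq:
  assumes w: "w \<in> filippov D (Proj B a) b" and r: "r > 0"
    and eq: "\<And>y. y \<in> D \<Longrightarrow> \<bar>y - b\<bar> < r \<Longrightarrow> Proj B a y = a"
  shows "w = a"
proof -
  have "closure (convex hull (Proj B a ` (D \<inter> ball b r))) \<subseteq> {a}"
  proof (intro closure_minimal hull_minimal)
    show "Proj B a ` (D \<inter> ball b r) \<subseteq> {a}"
      using eq by (auto simp: dist_real_def abs_minus_commute)
  qed auto
  then show ?thesis using w r by (auto simp: filippov_def)
qed

text \<open>Here \<open>c\<close> stands for the true parameter and \<open>b\<close> for the
  estimate. If \<open>a\<close> pushes outwards at an end point, then \<open>(c - b) * a\<close> has
  the right sign because \<open>c\<close> lies inside, and any element of the segment inherits it.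
  In all other cases the projection is inactive near \<open>b\<close> and the convexification
  reduces to \<open>a\<close>.\<close>

lemma filippov_Proj:
  assumes w: "w \<in> filippov {-B..B} (Proj B a) b" and b: "\<bar>b\<bar> \<le> B" and c: "\<bar>c\<bar> \<le> B" and B: "B > 0"
  shows "\<bar>w\<bar> \<le> \<bar>a\<bar>" and "(c - b) * (a - w) \<le> 0"
proof -
  have seg: "w \<in> closed_segment 0 a" using w by (rule filippov_Proj_segment)
  then obtain s where s: "0 \<le> s" "s \<le> 1" "w = s * a" by (auto simp: in_segment)
  show "\<bar>w\<bar> \<le> \<bar>a\<bar>" using s by (auto simp: abs_mult intro: mult_left_le_one_le)
  show "(c - b) * (a - w) \<le> 0"
  proof (cases "\<bar>b\<bar> = B \<and> a * b > 0")
    case True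
    have "(c - b) * a \<le> 0"
      using True b c by (auto simp: abs_if zero_less_mult_iff mult_le_0_iff split: if_splits)
    then have "(1 - s) * ((c - b) * a) \<le> 0"
      by (rule mult_nonneg_nonpos[rotated]) (use s(2) in simp)
    moreover have "(c - b) * (a - w) = (1 - s) * ((c - b) * a)" unfolding s(3) by (simp only: algebra_simps)
    ultimately show ?thesis by (simp only:)
  next
    case False
    have "w = a"
    proof (cases "\<bar>b\<bar> = B")
      case F: False
      show ?thesis
        \<comment> \<open>Within this radius the modulus stays strictly below
          \<open>B\<close>.\<close>
        by (rule filippov_Proj_eq[OF w, of "B - \<bar>b\<bar>"]) (use F b in \<open>auto simp: Proj_def\<close>)
    next
      case T: True
      then have ab: "a * b \<le> 0" using False by auto
      show ?thesis
      \<comment> \<open>Within distance \<open>B\<close> of an end point the sign of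
        \<open>y\<close> is that of \<open>b\<close>, so \<open>a\<close> points inwards at all
        these points too.\<close>
      proof (rule filippov_Proj_eq[OF w B])
        fix y assume y: "\<bar>y - b\<bar> < B"
        have "a * y \<le> 0" using ab y T B by (auto simp: mult_le_0_iff abs_if split: if_splits)
        then show "Proj B a y = a" by (simp add: Proj_def)
      qed
    qed
    then show ?thesis by simp
  qed
qed

text \<open>Contains the data but no solution. Every constant of the final estimate is defined in
  this locale, which is what makes it independent of the particular solution;
  \<open>closed_loop\<close> then adds one solution.\<close>

locale control_setting =
  fixes B \<gamma> \<gamma>\<^sub>0 M K \<epsilon> :: real
    and \<beta> \<sigma> :: "real \<Rightarrow> real"
    and Khat :: "(real \<Rightarrow> real) \<Rightarrow> real \<Rightarrow> real"
  assumes B: "B > 0" and gam: "\<gamma> > 0" and gam0: "\<gamma>\<^sub>0 > 0"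
    and MB: "M \<ge> B" and K: "K > 0"
    and beta_cont: "continuous_on {0..1} \<beta>" and beta_sup: "sup_norm \<beta> \<le> ennreal B"
    and eps: "0 < \<epsilon>" "\<epsilon> < exp (- 3 / 2) / (sqrt 2 * (1 + B))"
    and NO: "neural_operator (admissible_set M K) \<sigma> \<epsilon> Khat"

section \<open>Traces, characteristics and continuity of the observer error\<close>

locale closed_loop = control_setting +
  fixes u uh bh :: "real \<Rightarrow> real \<Rightarrow> real"
  assumes sol: "closed_loop_solution B \<gamma> \<gamma>\<^sub>0 \<beta> Khat u uh bh"
    and lip: "\<And>t. t \<ge> 0 \<Longrightarrow> K-lipschitz_on {0..1} (\<lambda>x. bh x t)"
begin

definition v where "v t = u 0 t"
definition e where "e x t = u x t - uh x t"
definition bt where "bt x t = \<beta> x - bh x t"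
definition U where "U t = control_law Khat uh bh t"
definition N where "N s t = integral {s..t} (\<lambda>r. \<bar>v r\<bar>)"
definition A where "A s t = integral {s..t} (\<lambda>r. (v r)\<^sup>2)"

lemma beta_bound: "x \<in> {0..1} \<Longrightarrow> \<bar>\<beta> x\<bar> \<le> B"
  using beta_sup B by (simp add: sup_norm_le_iff)

lemma bh_bound: "x \<in> {0..1} \<Longrightarrow> t \<ge> 0 \<Longrightarrow> \<bar>bh x t\<bar> \<le> B"
  using sol B by (auto simp: closed_loop_solution_def sup_norm_le_iff)

lemma bt_bound: "x \<in> {0..1} \<Longrightarrow> t \<ge> 0 \<Longrightarrow> \<bar>bt x t\<bar> \<le> 2 * B"
  using beta_bound[of x] bh_bound[of x t] by (simp add: bt_def)

lemma u_sq: "t \<ge> 0 \<Longrightarrow> (\<lambda>x. u x t) square_integrable_on {0..1}"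
  and uh_sq: "t \<ge> 0 \<Longrightarrow> (\<lambda>x. uh x t) square_integrable_on {0..1}"
  using sol by (auto simp: closed_loop_solution_def)

lemma e_sq: assumes "t \<ge> 0" shows "(\<lambda>x. e x t) square_integrable_on {0..1}"
proof (rule absolutely_integrable_imp_square_integrable)
  note sq = square_integrable_imp_absolutely_integrable(1,2)[OF u_sq[OF assms]]
    square_integrable_imp_absolutely_integrable(1,2)[OF uh_sq[OF assms]]
  have uv: "(\<lambda>x. u x t * uh x t) absolutely_integrable_on {0..1}"
    by (rule cauchy_schwarz_integral(1)[OF _ u_sq uh_sq]) (use assms in auto)
  show "(\<lambda>x. e x t) absolutely_integrable_on {0..1}"
    unfolding e_def using sq(1,3) by (rule set_integral_diff(1))
  have "(\<lambda>x. ((u x t)\<^sup>2 + (uh x t)\<^sup>2) - 2 * (u x t * uh x t)) integrable_on {0..1}"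
    using sq uv by (intro integrable_diff integrable_add integrable_on_mult_right) (auto intro: absolutely_integrable_integrable)
  then show "(\<lambda>x. (e x t)\<^sup>2) integrable_on {0..1}"
    by (simp add: e_def power2_diff algebra_simps)
qed

lemma v_sq: assumes "0 \<le> s" shows "v square_integrable_on {s..t}"
proof (rule square_integrable_on_subinterval)
  show "v square_integrable_on {0..max 0 t}"
    using sol unfolding closed_loop_solution_def v_def by auto
qed (use assms in auto)

lemma v_ai: "0 \<le> s \<Longrightarrow> v absolutely_integrable_on {s..t}"
  and v2_ai: "0 \<le> s \<Longrightarrow> (\<lambda>r. (v r)\<^sup>2) absolutely_integrable_on {s..t}"
  and N_A: "0 \<le> s \<Longrightarrow> (N s t)\<^sup>2 \<le> \<bar>t - s\<bar> * A s t"
  unfolding N_def A_def by (simp_all add: square_integrable_imp_absolutely_integrable[OF v_sq])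

lemma av_ai: "0 \<le> s \<Longrightarrow> (\<lambda>r. \<bar>v r\<bar>) absolutely_integrable_on {s..t}"
  using v_ai by (rule set_integrable_abs)

lemmas v2_int = v2_ai[THEN absolutely_integrable_integrable]
  and av_int = av_ai[THEN absolutely_integrable_integrable]

lemma N_nonneg: "0 \<le> s \<Longrightarrow> 0 \<le> N s t" and A_nonneg: "0 \<le> s \<Longrightarrow> 0 \<le> A s t"
  unfolding N_def A_def by (auto intro!: integral_nonneg av_int v2_int)

lemma N_mono: "0 \<le> s' \<Longrightarrow> s' \<le> s \<Longrightarrow> t \<le> t' \<Longrightarrow> N s t \<le> N s' t'"
  and A_mono: "0 \<le> s' \<Longrightarrow> s' \<le> s \<Longrightarrow> t \<le> t' \<Longrightarrow> A s t \<le> A s' t'"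
  unfolding N_def A_def by (intro integral_subset_le av_int v2_int; auto)+

lemma N_split: "0 \<le> r \<Longrightarrow> r \<le> s \<Longrightarrow> s \<le> t \<Longrightarrow> N r s + N s t = N r t"
  and A_split: "0 \<le> r \<Longrightarrow> r \<le> s \<Longrightarrow> s \<le> t \<Longrightarrow> A r s + A s t = A r t"
  unfolding N_def A_def
  by (intro Henstock_Kurzweil_Integration.integral_combine av_int v2_int; auto)+

lemma N_cont: "0 \<le> s \<Longrightarrow> continuous_on {s..T} (N s)"
  and A_cont: "0 \<le> s \<Longrightarrow> continuous_on {s..T} (A s)"
  unfolding N_def A_def by (intro continuous_on_indefinite_integral av_ai v2_ai; simp)+

lemma u_char:
  assumes "0 \<le> \<xi>" "max 0 (\<xi> - 1) \<le> a" "a \<le> b" "b \<le> \<xi>"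
  shows "u (\<xi> - b) b - u (\<xi> - a) a = integral {a..b} (\<lambda>s. \<beta> (\<xi> - s) * v s)"
    and "(\<lambda>s. \<beta> (\<xi> - s) * v s) absolutely_integrable_on {a..b}"
  using sol assms unfolding closed_loop_solution_def transport_solution_def ac_deriv_on_def v_def
  by auto

lemma uh_char:
  assumes "0 \<le> \<xi>" "max 0 (\<xi> - 1) \<le> a" "a \<le> b" "b \<le> \<xi>"
  shows "uh (\<xi> - b) b - uh (\<xi> - a) a =
      integral {a..b} (\<lambda>s. bh (\<xi> - s) s * v s + \<gamma>\<^sub>0 * e (\<xi> - s) s * (v s)\<^sup>2)"
    and "(\<lambda>s. bh (\<xi> - s) s * v s + \<gamma>\<^sub>0 * e (\<xi> - s) s * (v s)\<^sup>2) absolutely_integrable_on {a..b}"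
  using sol assms unfolding closed_loop_solution_def transport_solution_def ac_deriv_on_def v_def e_def
  by auto

lemma e_right: "t \<ge> 0 \<Longrightarrow> e 1 t = 0" and u_right: "t \<ge> 0 \<Longrightarrow> u 1 t = U t"
  using sol by (auto simp: closed_loop_solution_def e_def U_def)

lemma bh_ac:
  assumes "x \<in> {0..1}"
  obtains w where "ac_deriv_on (\<lambda>t. bh x t) w {0..}"
    "AE t in lebesgue_on {0..}. w t \<in> filippov {-B..B} (Proj B (\<gamma> * e x t * v t)) (bh x t)"
  using sol assms unfolding closed_loop_solution_def e_def v_def by blast

lemma bh_cont_time:
  assumes "x \<in> {0..1}" shows "continuous_on {0..} (\<lambda>t. bh x t)"
proof -
  obtain w where w: "ac_deriv_on (\<lambda>t. bh x t) w {0..}" using bh_ac[OF assms] by blast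
  show ?thesis
  proof (rule continuous_on_halfline)
    fix T :: real assume "T \<ge> 0"
    then show "continuous_on {0..T} (\<lambda>t. bh x t)"
      using w by (intro ac_continuous_on[of 0 T _ w]) (auto simp: ac_deriv_on_def)
  qed
qed

text \<open>The Lipschitz constant \<open>K\<close> in space is the same for all times, which
  upgrades continuity in time at each fixed point to joint continuity.\<close>

lemma bh_cont: "continuous_on ({0..1} \<times> {0..}) (\<lambda>p. bh (fst p) (snd p))"
  unfolding continuous_on_iff
proof (intro ballI allI impI)
  fix p :: "real \<times> real" and d :: real assume p: "p \<in> {0..1} \<times> {0..}" and d: "d > 0"
  obtain x t where pe: "p = (x, t)" by (cases p)
  have xt: "x \<in> {0..1}" "t \<ge> 0" using p pe by auto
  obtain r where r: "r > 0" "\<And>t'. t' \<ge> 0 \<Longrightarrow> \<bar>t' - t\<bar> < r \<Longrightarrow> \<bar>bh x t' - bh x t\<bar> < d/2"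
    using bh_cont_time[OF xt(1)] xt(2) d unfolding continuous_on_iff dist_real_def
    by (metis atLeast_iff half_gt_zero)
  show "\<exists>r>0. \<forall>q\<in>{0..1} \<times> {0..}. dist q p < r \<longrightarrow> dist (bh (fst q) (snd q)) (bh (fst p) (snd p)) < d"
  proof (intro exI[of _ "min r (d / (2 * K))"] conjI ballI impI)
    show "min r (d / (2 * K)) > 0" using r d K by auto
    fix q :: "real \<times> real" assume q: "q \<in> {0..1} \<times> {0..}" and dq: "dist q p < min r (d / (2 * K))"
    obtain x' t' where qe: "q = (x', t')" by (cases q)
    have xt': "x' \<in> {0..1}" "t' \<ge> 0" using q qe by auto
    have "\<bar>x' - x\<bar> \<le> dist q p" "\<bar>t' - t\<bar> \<le> dist q p"
      using dist_fst_le[of q p] dist_snd_le[of q p] by (auto simp: pe qe dist_real_def)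
    then have *: "\<bar>x' - x\<bar> < d / (2 * K)" "\<bar>t' - t\<bar> < r" using dq by auto
    have "\<bar>bh x' t' - bh x t'\<bar> \<le> K * \<bar>x' - x\<bar>"
      using lipschitz_onD[OF lip[OF xt'(2)] xt'(1) xt(1)] by (simp add: dist_real_def)
    also have "\<dots> < d / 2" using *(1) K by (simp add: field_simps)
    finally show "dist (bh (fst q) (snd q)) (bh (fst p) (snd p)) < d"
      using r(2)[OF xt'(2) *(2)] unfolding pe qe dist_real_def fst_conv snd_conv by linarith
  qed
qed

lemma bt_cont: "continuous_on ({0..1} \<times> {0..}) (\<lambda>p. bt (fst p) (snd p))"
  unfolding bt_def
  by (intro continuous_on_diff bh_cont continuous_on_compose2[OF beta_cont] continuous_intros) auto

lemma bt_char_cont: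
  assumes "max 0 (\<xi> - 1) \<le> a" "b \<le> \<xi>"
  shows "continuous_on {a..b} (\<lambda>s. bt (\<xi> - s) s)"
  by (rule continuous_on_compose2[OF bt_cont, of "{a..b}" "\<lambda>s. (\<xi> - s, s)", simplified])
    (use assms in \<open>auto intro!: continuous_intros\<close>)

text \<open>The difference of plant and observer, written as forcing minus a nonnegative coefficient
  times \<open>e\<close>, the form required by \<open>damped_ac_bound\<close>.\<close>

lemma e_char:
  assumes "0 \<le> \<xi>" "max 0 (\<xi> - 1) \<le> a" "a \<le> b" "b \<le> \<xi>"
  shows "e (\<xi> - b) b - e (\<xi> - a) a =
      integral {a..b} (\<lambda>s. bt (\<xi> - s) s * v s - (\<gamma>\<^sub>0 * (v s)\<^sup>2) * e (\<xi> - s) s)"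
    and "(\<lambda>s. bt (\<xi> - s) s * v s - (\<gamma>\<^sub>0 * (v s)\<^sup>2) * e (\<xi> - s) s) absolutely_integrable_on {a..b}"
    and "(\<lambda>s. bt (\<xi> - s) s * v s) absolutely_integrable_on {a..b}"
proof -
  have eq: "bt (\<xi> - s) s * v s - (\<gamma>\<^sub>0 * (v s)\<^sup>2) * e (\<xi> - s) s =
      \<beta> (\<xi> - s) * v s - (bh (\<xi> - s) s * v s + \<gamma>\<^sub>0 * e (\<xi> - s) s * (v s)\<^sup>2)" for s
    by (simp add: bt_def algebra_simps)
  show "(\<lambda>s. bt (\<xi> - s) s * v s - (\<gamma>\<^sub>0 * (v s)\<^sup>2) * e (\<xi> - s) s) absolutely_integrable_on {a..b}"
    unfolding eq using u_char(2)[OF assms] uh_char(2)[OF assms] by (rule set_integral_diff(1))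
  show "e (\<xi> - b) b - e (\<xi> - a) a =
      integral {a..b} (\<lambda>s. bt (\<xi> - s) s * v s - (\<gamma>\<^sub>0 * (v s)\<^sup>2) * e (\<xi> - s) s)"
    unfolding eq using u_char[OF assms] uh_char[OF assms]
    by (subst integral_diff) (auto simp: e_def dest: absolutely_integrable_integrable)
  show "(\<lambda>s. bt (\<xi> - s) s * v s) absolutely_integrable_on {a..b}"
    using assms by (intro absolutely_integrable_continuous_mult bt_char_cont v_ai) auto
qed

lemma e_char_bound:
  assumes "0 \<le> \<xi>" "max 0 (\<xi> - 1) \<le> a" "a \<le> b" "b \<le> \<xi>"
  shows "\<bar>e (\<xi> - b) b\<bar> \<le> \<bar>e (\<xi> - a) a\<bar> + 4 * B * N a b"
proof -
  have "\<bar>e (\<xi> - b) b\<bar> \<le> \<bar>e (\<xi> - a) a\<bar> + 2 * integral {a..b} (\<lambda>s. \<bar>bt (\<xi> - s) s * v s\<bar>)"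
    by (rule damped_ac_bound[where y = "\<lambda>t. e (\<xi> - t) t" and d = "\<lambda>s. \<gamma>\<^sub>0 * (v s)\<^sup>2"])
      (use assms gam0 e_char[OF assms] e_char(1)[OF assms(1,2)] in auto)
  also have "integral {a..b} (\<lambda>s. \<bar>bt (\<xi> - s) s * v s\<bar>) \<le> integral {a..b} (\<lambda>s. 2 * B * \<bar>v s\<bar>)"
  proof (rule integral_le)
    show "(\<lambda>s. \<bar>bt (\<xi> - s) s * v s\<bar>) integrable_on {a..b}"
      using set_integrable_abs[OF e_char(3)[OF assms]] by (rule absolutely_integrable_integrable)
    show "(\<lambda>s. 2 * B * \<bar>v s\<bar>) integrable_on {a..b}"
      using assms by (intro integrable_on_mult_right av_int) auto
    show "\<bar>bt (\<xi> - s) s * v s\<bar> \<le> 2 * B * \<bar>v s\<bar>" if "s \<in> {a..b}" for s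
      unfolding abs_mult using that assms by (intro mult_right_mono bt_bound) auto
  qed
  finally show ?thesis by (simp add: N_def)
qed

lemma e_bound_right:
  assumes "x \<in> {0..1}" "t \<ge> 0" "x + t \<ge> 1"
  shows "\<bar>e x t\<bar> \<le> 4 * B * N (x + t - 1) t"
  using e_char_bound[of "x + t" "x + t - 1" t] assms e_right[of "x + t - 1"] by auto

lemma e_bound_left:
  assumes "x \<in> {0..1}" "t \<ge> 0" "x + t \<le> 1"
  shows "\<bar>e x t\<bar> \<le> \<bar>e (x + t) 0\<bar> + 4 * B * N 0 t"
  using e_char_bound[of "x + t" 0 t] assms by auto

text \<open>Unlike in the amplitude bound, the damping term is kept, since an increment does not
  benefit from its sign; this brings in \<open>A\<close>. Because \<xi> is at least 1, the
  characteristic starts at the boundary x = 1 and \<open>e\<close> on it is already bounded by the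
  trace.\<close>

lemma e_char_modulus:
  assumes xi: "1 \<le> \<xi>" and a: "\<xi> - 1 \<le> a" and ab: "a \<le> b" "b \<le> \<xi>" and T: "b \<le> T"
  shows "\<bar>e (\<xi> - b) b - e (\<xi> - a) a\<bar> \<le> 2 * B * N a b + \<gamma>\<^sub>0 * (4 * B * N 0 T) * A a b"
proof -
  have as: "0 \<le> \<xi>" "max 0 (\<xi> - 1) \<le> a" using xi a by auto
  have "\<bar>e (\<xi> - b) b - e (\<xi> - a) a\<bar> \<le>
      integral {a..b} (\<lambda>s. 2 * B * \<bar>v s\<bar> + \<gamma>\<^sub>0 * (4 * B * N 0 T) * (v s)\<^sup>2)"
    unfolding e_char(1)[OF as ab]
  proof (rule integral_abs_bound_integral)
    show "(\<lambda>s. bt (\<xi> - s) s * v s - (\<gamma>\<^sub>0 * (v s)\<^sup>2) * e (\<xi> - s) s) integrable_on {a..b}"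
      by (rule absolutely_integrable_integrable[OF e_char(2)[OF as ab]])
    show "(\<lambda>s. 2 * B * \<bar>v s\<bar> + \<gamma>\<^sub>0 * (4 * B * N 0 T) * (v s)\<^sup>2) integrable_on {a..b}"
      using as by (intro integrable_add integrable_on_mult_right av_int v2_int) auto
    fix s assume s: "s \<in> {a..b}"
    have "\<bar>e (\<xi> - s) s\<bar> \<le> 4 * B * N (\<xi> - 1) s"
      using e_bound_right[of "\<xi> - s" s] s as ab xi a by auto
    also have "\<dots> \<le> 4 * B * N 0 T"
      using s as ab xi T B by (intro mult_left_mono N_mono) auto
    finally have "\<bar>(\<gamma>\<^sub>0 * (v s)\<^sup>2) * e (\<xi> - s) s\<bar> \<le> \<gamma>\<^sub>0 * (v s)\<^sup>2 * (4 * B * N 0 T)"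
      unfolding abs_mult[of "\<gamma>\<^sub>0 * (v s)\<^sup>2"] using gam0 by (simp add: mult_left_mono)
    moreover have "\<bar>bt (\<xi> - s) s * v s\<bar> \<le> 2 * B * \<bar>v s\<bar>"
      unfolding abs_mult using s as ab by (intro mult_right_mono bt_bound) auto
    ultimately show "\<bar>bt (\<xi> - s) s * v s - (\<gamma>\<^sub>0 * (v s)\<^sup>2) * e (\<xi> - s) s\<bar>
        \<le> 2 * B * \<bar>v s\<bar> + \<gamma>\<^sub>0 * (4 * B * N 0 T) * (v s)\<^sup>2"
      by (simp add: mult_ac)
  qed
  also have "\<dots> = 2 * B * N a b + \<gamma>\<^sub>0 * (4 * B * N 0 T) * A a b"
    unfolding N_def[of a b] A_def using as
    by (subst integral_add) (auto intro!: integrable_on_mult_right av_int v2_int)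
  finally show ?thesis .
qed

text \<open>The difference of two neighbouring characteristics solves the same damped equation.\<close>

lemma e_char_diff:
  assumes xi: "1 \<le> \<xi>" "\<xi> \<le> \<eta>" and s: "\<eta> - 1 \<le> s" "s \<le> \<xi>" "s \<le> T"
    and d: "\<And>r. r \<in> {\<eta> - 1..s} \<Longrightarrow> \<bar>bt (\<xi> - r) r - bt (\<eta> - r) r\<bar> \<le> d"
  shows "\<bar>e (\<xi> - s) s - e (\<eta> - s) s\<bar> \<le> 4 * B * N (\<xi> - 1) (\<eta> - 1) + 2 * (d * N 0 T)"
proof -
  define a where "a = \<eta> - 1"
  have a: "0 \<le> a" "\<xi> - 1 \<le> a" "a \<le> s" "\<eta> - a = 1" using xi s by (auto simp: a_def)
  have as1: "0 \<le> \<xi>" "max 0 (\<xi> - 1) \<le> a" and as2: "0 \<le> \<eta>" "max 0 (\<eta> - 1) \<le> a"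
    using xi a by (auto simp: a_def)
  have eta: "s \<le> \<eta>" using s xi by auto
  let ?f = "\<lambda>r. (bt (\<xi> - r) r - bt (\<eta> - r) r) * v r"
  let ?y = "\<lambda>t. e (\<xi> - t) t - e (\<eta> - t) t"
  have eq: "?f r - (\<gamma>\<^sub>0 * (v r)\<^sup>2) * ?y r = (bt (\<xi> - r) r * v r - (\<gamma>\<^sub>0 * (v r)\<^sup>2) * e (\<xi> - r) r)
      - (bt (\<eta> - r) r * v r - (\<gamma>\<^sub>0 * (v r)\<^sup>2) * e (\<eta> - r) r)" for r
    by (simp add: algebra_simps)
  have fai: "?f absolutely_integrable_on {a..s}"
    using set_integral_diff(1)[OF e_char(3)[OF as1 a(3) s(2)] e_char(3)[OF as2 a(3) eta]]
    by (simp add: left_diff_distrib)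
  have "\<bar>?y s\<bar> \<le> \<bar>?y a\<bar> + 2 * integral {a..s} (\<lambda>r. \<bar>?f r\<bar>)"
  proof (rule damped_ac_bound[where d = "\<lambda>s. \<gamma>\<^sub>0 * (v s)\<^sup>2", OF a(3) _ fai])
    show "(\<lambda>s. ?f s - (\<gamma>\<^sub>0 * (v s)\<^sup>2) * ?y s) absolutely_integrable_on {a..s}"
      unfolding eq by (rule set_integral_diff(1)[OF e_char(2)[OF as1 a(3) s(2)] e_char(2)[OF as2 a(3) eta]])
    show "0 \<le> \<gamma>\<^sub>0 * (v s)\<^sup>2" for s using gam0 by simp
    fix t assume t: "t \<in> {a..s}"
    then have t': "a \<le> t" "t \<le> \<xi>" "t \<le> \<eta>" using s eta by auto
    show "?y t - ?y a = integral {a..t} (\<lambda>s. ?f s - (\<gamma>\<^sub>0 * (v s)\<^sup>2) * ?y s)"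
      unfolding eq using e_char(1)[OF as1 t'(1,2)] e_char(1)[OF as2 t'(1,3)]
        integral_diff[OF absolutely_integrable_integrable[OF e_char(2)[OF as1 t'(1,2)]]
          absolutely_integrable_integrable[OF e_char(2)[OF as2 t'(1,3)]]]
      by linarith
  qed
  \<comment> \<open>At time \<open>a\<close> the characteristic \<eta> just leaves x = 1, where the
    error vanishes; only the older one contributes.\<close>
  also have "\<bar>?y a\<bar> = \<bar>e (\<xi> - a) a\<bar>" using e_right[OF a(1)] a(4) by simp
  also have "\<dots> \<le> 4 * B * N (\<xi> - 1) a"
    using e_bound_right[of "\<xi> - a" a] a xi s by auto
  also have "integral {a..s} (\<lambda>r. \<bar>?f r\<bar>) \<le> integral {a..s} (\<lambda>r. d * \<bar>v r\<bar>)"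
  proof (rule integral_le)
    show "(\<lambda>r. \<bar>?f r\<bar>) integrable_on {a..s}"
      using set_integrable_abs[OF fai] by (rule absolutely_integrable_integrable)
    show "(\<lambda>r. d * \<bar>v r\<bar>) integrable_on {a..s}" using a by (intro integrable_on_mult_right av_int)
    show "\<bar>?f r\<bar> \<le> d * \<bar>v r\<bar>" if "r \<in> {a..s}" for r
      unfolding abs_mult using that by (intro mult_right_mono d) (auto simp: a_def)
  qed
  also have "\<dots> = d * N a s" by (simp add: N_def)
  also have "\<dots> \<le> d * N 0 T"
    using a s d[of a] by (intro mult_left_mono N_mono) (auto simp: a_def)
  finally show ?thesis by (simp add: a_def)
qed

text \<open>The two points are joined by a path that follows the characteristic of the first,
  crosses to that of the second at time \<open>t1\<close>, and follows the latter. The three pieces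
  along characteristics cost d/8 each, the crossing d/2.\<close>

lemma e_cont_aux:
  assumes T: "T \<ge> 1" and d: "d > 0"
  shows "\<exists>r>0. \<forall>x\<in>{0..1}. \<forall>y\<in>{0..1}. \<forall>s\<in>{1..T}. \<forall>t\<in>{1..T}.
    x + s \<le> y + t \<longrightarrow> \<bar>x - y\<bar> < r \<longrightarrow> \<bar>s - t\<bar> < r \<longrightarrow> \<bar>e x s - e y t\<bar> < d"
proof -
  \<comment> \<open>A common modulus: the increments of \<open>m\<close> dominate those of
    \<open>e\<close> along every characteristic at once.\<close>
  define m where "m t = 2 * B * N 0 t + \<gamma>\<^sub>0 * (4 * B * N 0 T) * A 0 t" for t
  have mod: "\<bar>e (\<xi> - b) b - e (\<xi> - a) a\<bar> \<le> \<bar>m b - m a\<bar>"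
    if "1 \<le> \<xi>" "\<xi> - 1 \<le> a" "a \<le> b" "b \<le> \<xi>" "b \<le> T" for \<xi> a b
  proof -
    have "N 0 a + N a b = N 0 b" "A 0 a + A a b = A 0 b" using that by (intro N_split A_split; auto)+
    then have "m b - m a = 2 * B * N a b + \<gamma>\<^sub>0 * (4 * B * N 0 T) * A a b"
      unfolding m_def by (metis (no_types, opaque_lifting) add_diff_add add_diff_cancel_left' right_diff_distrib)
    then show ?thesis using e_char_modulus[OF that] by linarith
  qed
  have mc: "continuous_on {0..T+1} m" unfolding m_def by (intro continuous_intros N_cont A_cont) auto
  have nc: "continuous_on {0..T+1} (N 0)" by (intro N_cont) auto
  have muc: "uniformly_continuous_on {0..T+1} m" "uniformly_continuous_on {0..T+1} (N 0)"
    using mc nc by (auto intro: compact_uniformly_continuous)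
  have NT: "N 0 T \<ge> 0" by (simp add: N_nonneg)
  define d1 where "d1 = d / (16 * B)"
  define d2 where "d2 = d / (8 * (N 0 T + 1))"
  have d12: "d1 > 0" "d2 > 0" using d B NT by (auto simp: d1_def d2_def)
  obtain r1 where r1: "r1 > 0" "\<And>s t. s \<in> {0..T+1} \<Longrightarrow> t \<in> {0..T+1} \<Longrightarrow> \<bar>s - t\<bar> < r1 \<Longrightarrow> \<bar>m s - m t\<bar> < d/8"
    using muc(1) d unfolding uniformly_continuous_on_def dist_real_def by (metis zero_less_divide_iff zero_less_numeral)
  obtain r2 where r2: "r2 > 0" "\<And>s t. s \<in> {0..T+1} \<Longrightarrow> t \<in> {0..T+1} \<Longrightarrow> \<bar>s - t\<bar> < r2 \<Longrightarrow> \<bar>N 0 s - N 0 t\<bar> < d1"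
    using muc(2) d12(1) unfolding uniformly_continuous_on_def dist_real_def by metis
  have "uniformly_continuous_on ({0..1} \<times> {0..T}) (\<lambda>p. bt (fst p) (snd p))"
    by (intro compact_uniformly_continuous continuous_on_subset[OF bt_cont] compact_Times) auto
  then obtain r3 where r3: "r3 > 0" "\<And>p q. p \<in> {0..1} \<times> {0..T} \<Longrightarrow> q \<in> {0..1} \<times> {0..T} \<Longrightarrow> dist p q < r3 \<Longrightarrow>
      \<bar>bt (fst p) (snd p) - bt (fst q) (snd q)\<bar> < d2"
    using d12(2) unfolding uniformly_continuous_on_def dist_real_def by metis
  \<comment> \<open>The time offset between \<open>t1\<close> and \<open>t2\<close> is below 5 r,
    that between the two characteristics below 2 r; the divisor 6 covers all of them.\<close>
  define r where "r = min 1 (min r1 (min r2 r3)) / 6"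
  have r: "r > 0" "6 * r \<le> 1" "6 * r \<le> r1" "6 * r \<le> r2" "6 * r \<le> r3"
    using r1(1) r2(1) r3(1) by (auto simp: r_def)
  show ?thesis
  proof (intro exI[of _ r] conjI ballI impI r)
    fix x y s t
    assume as: "x \<in> {0..1}" "y \<in> {0..1}" "s \<in> {1..T}" "t \<in> {1..T}" "x + s \<le> y + t" "\<bar>x - y\<bar> < r" "\<bar>s - t\<bar> < r"
    define \<xi> where "\<xi> = x + s"
    define \<eta> where "\<eta> = y + t"
    \<comment> \<open>The first time from \<open>s\<close> on at which the later characteristic has
      entered the strip.\<close>
    define t1 where "t1 = max s (\<eta> - 1)"
    define t2 where "t2 = min t \<xi>"
    have xe: "1 \<le> \<xi>" "\<xi> \<le> \<eta>" "\<eta> - \<xi> < 2 * r" "\<xi> \<le> T + 1" "\<eta> \<le> T + 1" using as by (auto simp: \<xi>_def \<eta>_def)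
    have t1: "\<xi> - 1 \<le> s" "s \<le> t1" "t1 \<le> \<xi>" "\<eta> - 1 \<le> t1" "t1 \<le> T" "t1 - s < 2 * r"
      using as xe r(2) by (auto simp: t1_def \<xi>_def \<eta>_def)
    have t2: "\<eta> - 1 \<le> t2" "t2 \<le> t" "t \<le> \<eta>" "t2 \<le> T" "t - t2 < 2 * r" "0 \<le> t2"
      using as xe r(2) by (auto simp: t2_def \<xi>_def \<eta>_def)
    have a1: "\<bar>e (\<xi> - t1) t1 - e x s\<bar> < d/8"
    proof -
      have "\<bar>e (\<xi> - t1) t1 - e (\<xi> - s) s\<bar> \<le> \<bar>m t1 - m s\<bar>" by (rule mod) (use xe t1 in auto)
      also have "\<dots> < d/8" by (rule r1(2)) (use t1 as r in auto)
      finally show ?thesis by (simp add: \<xi>_def)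
    qed
    have a3: "\<bar>e (\<eta> - t1) t1 - e (\<eta> - t2) t2\<bar> < d/8"
    proof -
      have "\<bar>e (\<eta> - t1) t1 - e (\<eta> - t2) t2\<bar> \<le> \<bar>m t1 - m t2\<bar>"
        using mod[of \<eta> t1 t2] mod[of \<eta> t2 t1] xe t1 t2 by (cases "t1 \<le> t2") (auto simp: abs_minus_commute)
      also have "\<dots> < d/8" by (rule r1(2)) (use t1 t2 as r in auto)
      finally show ?thesis .
    qed
    have a4: "\<bar>e y t - e (\<eta> - t2) t2\<bar> < d/8"
    proof -
      have "\<bar>e (\<eta> - t) t - e (\<eta> - t2) t2\<bar> \<le> \<bar>m t - m t2\<bar>" by (rule mod) (use xe t2 as in auto)
      also have "\<dots> < d/8" by (rule r1(2)) (use t2 as r in auto)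
      finally show ?thesis by (simp add: \<eta>_def)
    qed
    have "\<bar>e (\<xi> - t1) t1 - e (\<eta> - t1) t1\<bar> \<le> 4 * B * N (\<xi> - 1) (\<eta> - 1) + 2 * (d2 * N 0 T)"
    proof (rule e_char_diff)
      fix q assume q: "q \<in> {\<eta> - 1..t1}"
      have "dist (\<xi> - q, q) (\<eta> - q, q) < r3"
        using xe r by (simp add: dist_Pair_Pair dist_real_def)
      then show "\<bar>bt (\<xi> - q) q - bt (\<eta> - q) q\<bar> \<le> d2"
        using r3(2)[of "(\<xi> - q, q)" "(\<eta> - q, q)"] q xe t1 by auto
    qed (use xe t1 in auto)
    also have "N (\<xi> - 1) (\<eta> - 1) = N 0 (\<eta> - 1) - N 0 (\<xi> - 1)"
      using N_split[of 0 "\<xi> - 1" "\<eta> - 1"] xe by auto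
    also have "\<dots> \<le> d1"
      using r2(2)[of "\<eta> - 1" "\<xi> - 1"] xe r by auto
    also have "4 * B * d1 = d/4" using B by (simp add: d1_def)
    also have "d2 * N 0 T \<le> d/8"
      using NT d by (simp add: d2_def field_simps)
    finally have a2: "\<bar>e (\<xi> - t1) t1 - e (\<eta> - t1) t1\<bar> \<le> d/4 + 2 * (d/8)"
      using B by simp
    show "\<bar>e x s - e y t\<bar> < d" using a1 a2 a3 a4 by linarith
  qed
qed

lemma e_cont: "continuous_on ({0..1} \<times> {1..}) (\<lambda>p. e (fst p) (snd p))"
  unfolding continuous_on_iff
proof (intro ballI allI impI)
  fix p :: "real \<times> real" and d :: real assume p: "p \<in> {0..1} \<times> {1..}" and d: "d > 0"
  obtain x t where pe: "p = (x, t)" by (cases p)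
  have xt: "x \<in> {0..1}" "t \<ge> 1" using p pe by auto
  obtain r where r: "r > 0" "\<And>x y s q. x\<in>{0..1} \<Longrightarrow> y\<in>{0..1} \<Longrightarrow> s\<in>{1..t+1} \<Longrightarrow> q\<in>{1..t+1} \<Longrightarrow>
    x + s \<le> y + q \<Longrightarrow> \<bar>x - y\<bar> < r \<Longrightarrow> \<bar>s - q\<bar> < r \<Longrightarrow> \<bar>e x s - e y q\<bar> < d"
    using e_cont_aux[of "t+1" d] xt d by (meson add_increasing2 zero_le_one)
  show "\<exists>r>0. \<forall>q\<in>{0..1} \<times> {1..}. dist q p < r \<longrightarrow> dist (e (fst q) (snd q)) (e (fst p) (snd p)) < d"
  proof (intro exI[of _ "min r 1"] conjI ballI impI)
    show "min r 1 > 0" using r by auto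
    fix q :: "real \<times> real" assume q: "q \<in> {0..1} \<times> {1..}" and dq: "dist q p < min r 1"
    obtain x' t' where qe: "q = (x', t')" by (cases q)
    have xt': "x' \<in> {0..1}" "t' \<ge> 1" using q qe by auto
    have "\<bar>x' - x\<bar> \<le> dist q p" "\<bar>t' - t\<bar> \<le> dist q p"
      using dist_fst_le[of q p] dist_snd_le[of q p] by (auto simp: pe qe dist_real_def)
    then have *: "\<bar>x' - x\<bar> < r" "\<bar>t' - t\<bar> < r" "t' \<le> t + 1" using dq by auto
    have "\<bar>e x' t' - e x t\<bar> < d"
    proof (cases "x' + t' \<le> x + t")
      case True
      then show ?thesis using r(2)[of x' x t' t] xt xt' * by auto
    next
      case False
      then show ?thesis using r(2)[of x x' t t'] xt xt' * by (auto simp: abs_minus_commute)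
    qed
    then show "dist (e (fst q) (snd q)) (e (fst p) (snd p)) < d" by (simp add: pe qe dist_real_def)
  qed
qed

end

section \<open>Dissipation of the Lyapunov function\<close>

lemma clamped_extension:
  fixes G :: "real \<Rightarrow> real \<Rightarrow> real"
  assumes G: "continuous_on ({0..1} \<times> {c..d}) (\<lambda>p. G (fst p) (snd p))" and cd: "c \<le> d"
  defines "G' \<equiv> \<lambda>x s. G (max 0 (min 1 x)) (max c (min d s))"
  shows "continuous_on UNIV (\<lambda>p. G' (fst p) (snd p))"
    and "\<exists>C. \<forall>x s. \<bar>G' x s\<bar> \<le> C"
    and "\<And>x s. x \<in> {0..1} \<Longrightarrow> s \<in> {c..d} \<Longrightarrow> G' x s = G x s"
proof -
  show "continuous_on UNIV (\<lambda>p. G' (fst p) (snd p))"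
    unfolding G'_def
    by (rule continuous_on_compose2[OF G, of UNIV "\<lambda>p. (max 0 (min 1 (fst p)), max c (min d (snd p)))", simplified])
      (use cd in \<open>auto intro!: continuous_intros\<close>)
  have "bounded ((\<lambda>p. G (fst p) (snd p)) ` ({0..1} \<times> {c..d}))"
    by (intro compact_imp_bounded compact_continuous_image G compact_Times) auto
  then obtain C where C: "\<And>x s. x \<in> {0..1} \<Longrightarrow> s \<in> {c..d} \<Longrightarrow> \<bar>G x s\<bar> \<le> C"
    unfolding bounded_real by fastforce
  have "\<bar>G' x s\<bar> \<le> C" for x s
    unfolding G'_def by (rule C) (use cd in auto)
  then show "\<exists>C. \<forall>x s. \<bar>G' x s\<bar> \<le> C" by blast
qed (auto simp: G'_def)

lemma absolutely_integrable_cong: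
  fixes f g :: "real \<Rightarrow> real"
  assumes "f absolutely_integrable_on S" "\<And>x. x \<in> S \<Longrightarrow> f x = g x"
  shows "g absolutely_integrable_on S"
  using assms(1) by (subst set_integrable_cong[OF refl refl assms(2)[symmetric]])

lemma rectangle_fubini:
  fixes G :: "real \<Rightarrow> real \<Rightarrow> real"
  assumes G: "continuous_on ({0..1} \<times> {c..d}) (\<lambda>p. G (fst p) (snd p))" and cd: "c \<le> d"
    and m: "m absolutely_integrable_on {c..d}"
  shows "(\<lambda>s. integral {0..1} (\<lambda>x. G x s) * m s) absolutely_integrable_on {c..d}"
    and "(\<lambda>x. integral {c..d} (\<lambda>s. G x s * m s)) absolutely_integrable_on {0..1}"
    and "integral {0..1} (\<lambda>x. integral {c..d} (\<lambda>s. G x s * m s)) =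
         integral {c..d} (\<lambda>s. integral {0..1} (\<lambda>x. G x s) * m s)"
proof -
  define F where "F x s = G (max 0 (min 1 x)) (max c (min d s))" for x s
  note F = clamped_extension[OF G cd, folded F_def]
  have Fm: "(\<lambda>(x, s). F x s) \<in> borel_measurable (borel \<Otimes>\<^sub>M borel)"
    using borel_measurable_continuous_onI[OF F(1)] unfolding split_beta' borel_prod .
  obtain C where C: "\<And>x s. \<bar>F x s\<bar> \<le> C" using F(2) by blast
  have eq1: "integral {c..d} (\<lambda>s. F x s * m s) = integral {c..d} (\<lambda>s. G x s * m s)" if "x \<in> {0..1}" for x
    by (rule integral_cong) (use F(3) that in auto)
  have eq2: "integral {0..1} (\<lambda>x. F x s) * m s = integral {0..1} (\<lambda>x. G x s) * m s" if "s \<in> {c..d}" for s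
    using integral_cong[of "{0..1}" "\<lambda>x. F x s" "\<lambda>x. G x s"] F(3) that by auto
  note fub = fubini_bounded_times_integrable[OF Fm C m, of 0 1]
  show "(\<lambda>s. integral {0..1} (\<lambda>x. G x s) * m s) absolutely_integrable_on {c..d}"
    using fub(1) eq2 by (rule absolutely_integrable_cong)
  show "(\<lambda>x. integral {c..d} (\<lambda>s. G x s * m s)) absolutely_integrable_on {0..1}"
    using fub(2) eq1 by (rule absolutely_integrable_cong)
  have "integral {0..1} (\<lambda>x. integral {c..d} (\<lambda>s. G x s * m s)) = integral {0..1} (\<lambda>x. integral {c..d} (\<lambda>s. F x s * m s))"
    by (rule integral_cong) (use eq1 in auto)
  also have "\<dots> = integral {c..d} (\<lambda>s. integral {0..1} (\<lambda>x. F x s) * m s)" by (rule fub(3))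
  also have "\<dots> = integral {c..d} (\<lambda>s. integral {0..1} (\<lambda>x. G x s) * m s)"
    by (rule integral_cong) (use eq2 in auto)
  finally show "integral {0..1} (\<lambda>x. integral {c..d} (\<lambda>s. G x s * m s)) =
         integral {c..d} (\<lambda>s. integral {0..1} (\<lambda>x. G x s) * m s)" .
qed

text \<open>The coordinate change \<xi> = x + s. In the new coordinates the strip is given by \<xi>
  between \<open>s\<close> and \<open>s + 1\<close>, and its section at fixed \<xi> is the part of a
  characteristic inside the time interval.\<close>

lemma strip_fubini:
  fixes G :: "real \<Rightarrow> real \<Rightarrow> real"
  assumes G: "continuous_on ({0..1} \<times> {c..d}) (\<lambda>p. G (fst p) (snd p))" and cd: "c \<le> d"
    and m: "m absolutely_integrable_on {c..d}"
  shows "(\<lambda>\<xi>. integral {max c (\<xi> - 1)..min d \<xi>} (\<lambda>s. G (\<xi> - s) s * m s)) absolutely_integrable_on {c..d+1}"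
    and "integral {c..d+1} (\<lambda>\<xi>. integral {max c (\<xi> - 1)..min d \<xi>} (\<lambda>s. G (\<xi> - s) s * m s)) =
         integral {c..d} (\<lambda>s. integral {0..1} (\<lambda>x. G x s) * m s)"
proof -
  define H where "H x s = G (max 0 (min 1 x)) (max c (min d s))" for x s
  note H = clamped_extension[OF G cd, folded H_def]
  define F where "F \<xi> s = (if \<xi> \<in> {s..s+1} then H (\<xi> - s) s else 0)" for \<xi> s
  have "(\<lambda>p. H (fst p - snd p) (snd p)) \<in> borel_measurable (borel :: (real \<times> real) measure)"
    by (rule borel_measurable_continuous_onI)
      (rule continuous_on_compose2[OF H(1), of UNIV "\<lambda>p. (fst p - snd p, snd p)", simplified], intro continuous_intros)
  then have [measurable]: "(\<lambda>p. H (fst p - snd p) (snd p)) \<in> borel_measurable (borel \<Otimes>\<^sub>M borel)"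
    by (simp add: borel_prod)
  have Fm: "(\<lambda>(\<xi>, s). F \<xi> s) \<in> borel_measurable (borel \<Otimes>\<^sub>M borel)"
    unfolding F_def split_beta' atLeastAtMost_iff by measurable
  obtain C where C: "\<And>x s. \<bar>H x s\<bar> \<le> C" using H(2) by blast
  have C0: "\<bar>F x s\<bar> \<le> C" for x s using C[of "x - s" s] abs_ge_zero[of "H (x - s) s"] unfolding F_def by auto
  have eq1: "integral {c..d} (\<lambda>s. F \<xi> s * m s) =
      integral {max c (\<xi> - 1)..min d \<xi>} (\<lambda>s. G (\<xi> - s) s * m s)" for \<xi>
  proof -
    have "integral {c..d} (\<lambda>s. F \<xi> s * m s) = integral {c..d} (\<lambda>s. if s \<in> {\<xi>-1..\<xi>} then G (\<xi> - s) s * m s else 0)"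
      by (rule integral_cong) (auto simp: F_def H(3))
    also have "\<dots> = integral ({\<xi>-1..\<xi>} \<inter> {c..d}) (\<lambda>s. G (\<xi> - s) s * m s)"
      by (rule Henstock_Kurzweil_Integration.integral_restrict_Int)
    also have "{\<xi>-1..\<xi>} \<inter> {c..d} = {max c (\<xi> - 1)..min d \<xi>}" by auto
    finally show ?thesis .
  qed
  have eq2: "integral {c..d+1} (\<lambda>\<xi>. F \<xi> s) * m s = integral {0..1} (\<lambda>x. G x s) * m s" if s: "s \<in> {c..d}" for s
  proof -
    have "integral {c..d+1} (\<lambda>\<xi>. F \<xi> s) = integral ({s..s+1} \<inter> {c..d+1}) (\<lambda>\<xi>. H (\<xi> - s) s)"
      unfolding F_def by (rule Henstock_Kurzweil_Integration.integral_restrict_Int)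
    also have "{s..s+1} \<inter> {c..d+1} = {0+s..1+s}" using s by auto
    also have "integral {0+s..1+s} (\<lambda>\<xi>. H (\<xi> - s) s) = integral {0..1} (\<lambda>x. H x s)"
      using integral_shift_left[of 0 1 "\<lambda>\<xi>. H (\<xi> - s) s" s] by simp
    also have "\<dots> = integral {0..1} (\<lambda>x. G x s)"
      by (rule integral_cong) (use H(3) s in auto)
    finally show ?thesis by simp
  qed
  note fub = fubini_bounded_times_integrable[OF Fm C0 m, of c "d+1"]
  show "(\<lambda>\<xi>. integral {max c (\<xi> - 1)..min d \<xi>} (\<lambda>s. G (\<xi> - s) s * m s)) absolutely_integrable_on {c..d+1}"
    using fub(2) by (simp add: eq1)
  have "integral {c..d+1} (\<lambda>\<xi>. integral {max c (\<xi> - 1)..min d \<xi>} (\<lambda>s. G (\<xi> - s) s * m s)) =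
     integral {c..d} (\<lambda>s. integral {c..d+1} (\<lambda>\<xi>. F \<xi> s) * m s)"
    using fub(3) by (simp add: eq1)
  also have "\<dots> = integral {c..d} (\<lambda>s. integral {0..1} (\<lambda>x. G x s) * m s)"
    by (rule integral_cong) (use eq2 in auto)
  finally show "integral {c..d+1} (\<lambda>\<xi>. integral {max c (\<xi> - 1)..min d \<xi>} (\<lambda>s. G (\<xi> - s) s * m s)) =
         integral {c..d} (\<lambda>s. integral {0..1} (\<lambda>x. G x s) * m s)" .
qed

section \<open>Energy identities for the error and for the estimate\<close>

context closed_loop
begin

definition E2 where "E2 t = integral {0..1} (\<lambda>x. (e x t)\<^sup>2)"

lemma e_cont_on: "1 \<le> c \<Longrightarrow> continuous_on ({0..1} \<times> {c..d}) (\<lambda>p. e (fst p) (snd p))"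
  and bt_cont_on: "0 \<le> c \<Longrightarrow> continuous_on ({0..1} \<times> {c..d}) (\<lambda>p. bt (fst p) (snd p))"
  by (rule continuous_on_subset[OF e_cont], auto)
    (rule continuous_on_subset[OF bt_cont], auto)

lemma e_cont_space: "1 \<le> t \<Longrightarrow> continuous_on {0..1} (\<lambda>x. e x t)"
  and e_cont_time: "x \<in> {0..1} \<Longrightarrow> 1 \<le> c \<Longrightarrow> continuous_on {c..d} (\<lambda>t. e x t)"
  and bt_cont_space: "0 \<le> t \<Longrightarrow> continuous_on {0..1} (\<lambda>x. bt x t)"
  and bt_cont_time: "x \<in> {0..1} \<Longrightarrow> 0 \<le> c \<Longrightarrow> continuous_on {c..d} (\<lambda>t. bt x t)"
proof -
  show "continuous_on {0..1} (\<lambda>x. e x t)" if "1 \<le> t"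
    by (rule continuous_on_compose2[OF e_cont, of "{0..1}" "\<lambda>x. (x, t)", simplified])
      (use that in \<open>auto intro!: continuous_intros\<close>)
  show "continuous_on {c..d} (\<lambda>t. e x t)" if "x \<in> {0..1}" "1 \<le> c"
    by (rule continuous_on_compose2[OF e_cont, of "{c..d}" "\<lambda>t. (x, t)", simplified])
      (use that in \<open>auto intro!: continuous_intros\<close>)
  show "continuous_on {0..1} (\<lambda>x. bt x t)" if "0 \<le> t"
    by (rule continuous_on_compose2[OF bt_cont, of "{0..1}" "\<lambda>x. (x, t)", simplified])
      (use that in \<open>auto intro!: continuous_intros\<close>)
  show "continuous_on {c..d} (\<lambda>t. bt x t)" if "x \<in> {0..1}" "0 \<le> c"
    by (rule continuous_on_compose2[OF bt_cont, of "{c..d}" "\<lambda>t. (x, t)", simplified])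
      (use that in \<open>auto intro!: continuous_intros\<close>)
qed

lemma bh_rate:
  assumes x: "x \<in> {0..1}" and st: "0 \<le> s" "s \<le> t"
    and g: "g integrable_on {s..t}" and le: "\<And>r. r \<in> {s..t} \<Longrightarrow> \<gamma> * \<bar>e x r\<bar> * \<bar>v r\<bar> \<le> g r"
  shows "\<bar>bh x t - bh x s\<bar> \<le> integral {s..t} g"
proof -
  obtain w where w: "ac_deriv_on (\<lambda>t. bh x t) w {0..}"
    "AE t in lebesgue_on {0..}. w t \<in> filippov {-B..B} (Proj B (\<gamma> * e x t * v t)) (bh x t)"
    using bh_ac[OF x] by blast
  have ai: "w absolutely_integrable_on {s..t}" and eq: "bh x t - bh x s = integral {s..t} w"
    using w(1) st by (auto simp: ac_deriv_on_def)
  have "AE r in lebesgue. r \<in> {0..} \<longrightarrow> w r \<in> filippov {-B..B} (Proj B (\<gamma> * e x r * v r)) (bh x r)"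
    using w(2) by (subst (asm) AE_restrict_space_iff) auto
  then have AE: "AE r in lebesgue. r \<ge> 0 \<longrightarrow> \<bar>w r\<bar> \<le> \<bar>\<gamma> * e x r * v r\<bar>"
  proof eventually_elim
    case (elim r)
    show ?case
    proof
      assume r: "r \<ge> 0"
      then have "w r \<in> filippov {-B..B} (Proj B (\<gamma> * e x r * v r)) (bh x r)" using elim by simp
      from filippov_Proj(1)[OF this bh_bound[OF x r] beta_bound[OF x] B]
      show "\<bar>w r\<bar> \<le> \<bar>\<gamma> * e x r * v r\<bar>" .
    qed
  qed
  have gai: "g absolutely_integrable_on {s..t}"
  proof (rule nonnegative_absolutely_integrable_1[OF g])
    show "0 \<le> g r" if "r \<in> {s..t}" for r
      using le[OF that] gam by (meson abs_ge_zero less_imp_le mult_nonneg_nonneg order_trans)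
  qed
  have "\<bar>integral {s..t} w\<bar> \<le> integral {s..t} (\<lambda>r. \<bar>w r\<bar>)"
    by (rule integral_abs_bound_integral)
      (auto intro: absolutely_integrable_integrable ai set_integrable_abs[OF ai])
  also have "\<dots> = (LINT r:{s..t}|lebesgue. \<bar>w r\<bar>)"
    by (rule set_lebesgue_integral_eq_integral(2)[OF set_integrable_abs[OF ai], symmetric])
  also have "\<dots> \<le> (LINT r:{s..t}|lebesgue. g r)"
  proof (rule set_integral_mono_AE[OF set_integrable_abs[OF ai] gai])
    show "AE r\<in>{s..t} in lebesgue. \<bar>w r\<bar> \<le> g r"
      using AE
    proof eventually_elim
      case (elim r)
      then show ?case using le[of r] gam st by (auto simp: abs_mult intro: order_trans)
    qed
  qed
  also have "\<dots> = integral {s..t} g" by (rule set_lebesgue_integral_eq_integral(2)[OF gai])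
  finally show ?thesis by (simp add: eq)
qed

text \<open>At each point of space the square of \<open>bt\<close> is differentiated in time; the
  projection can only decrease it further. The right-hand side is the cross term of the error
  energy, with the opposite sign and weighted by \<gamma>.\<close>

lemma bt_energy:
  assumes x: "x \<in> {0..1}" and T: "1 \<le> T"
  shows "(bt x T)\<^sup>2 - (bt x 1)\<^sup>2 \<le> - 2 * \<gamma> * integral {1..T} (\<lambda>s. (bt x s * e x s) * v s)"
proof -
  obtain w where w: "ac_deriv_on (\<lambda>t. bh x t) w {0..}"
    "AE t in lebesgue_on {0..}. w t \<in> filippov {-B..B} (Proj B (\<gamma> * e x t * v t)) (bh x t)"
    using bh_ac[OF x] by blast
  have "w absolutely_integrable_on {1..T}" using w(1) T unfolding ac_deriv_on_def by auto
  from set_integrable_mult_right[OF this, of "-1"]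
  have ai: "(\<lambda>r. - w r) absolutely_integrable_on {1..T}" by simp
  have y: "bt x t - bt x 1 = integral {1..t} (\<lambda>r. - w r)" if "t \<in> {1..T}" for t
  proof -
    have "bh x t - bh x 1 = integral {1..t} w" using w(1) that by (auto simp: ac_deriv_on_def)
    then show ?thesis by (simp add: bt_def)
  qed
  note sq = ac_square[OF T y ai]
  have bev: "(\<lambda>s. (bt x s * e x s) * v s) absolutely_integrable_on {1..T}"
    using x by (intro absolutely_integrable_continuous_mult continuous_intros bt_cont_time e_cont_time v_ai) auto
  then have bev2: "(\<lambda>s. - 2 * \<gamma> * ((bt x s * e x s) * v s)) absolutely_integrable_on {1..T}"
    by (rule set_integrable_mult_right)
  have "AE r in lebesgue. r \<in> {0..} \<longrightarrow> w r \<in> filippov {-B..B} (Proj B (\<gamma> * e x r * v r)) (bh x r)"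
    using w(2) by (subst (asm) AE_restrict_space_iff) auto
  then have AE: "AE r in lebesgue. r \<ge> 0 \<longrightarrow> 2 * bt x r * - w r \<le> - 2 * \<gamma> * ((bt x r * e x r) * v r)"
  proof eventually_elim
    case (elim r)
    show ?case
    proof
      assume r: "r \<ge> 0"
      have "bt x r * (\<gamma> * e x r * v r - w r) \<le> 0"
        unfolding bt_def
        by (rule filippov_Proj(2)[OF _ bh_bound[OF x r] beta_bound[OF x] B]) (use elim r in auto)
      then show "2 * bt x r * - w r \<le> - 2 * \<gamma> * ((bt x r * e x r) * v r)"
        by (simp add: algebra_simps)
    qed
  qed
  have "(bt x T)\<^sup>2 - (bt x 1)\<^sup>2 = (LINT r:{1..T}|lebesgue. 2 * bt x r * - w r)"
    using sq set_lebesgue_integral_eq_integral(2)[OF sq(1)] by simp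
  also have "\<dots> \<le> (LINT r:{1..T}|lebesgue. - 2 * \<gamma> * ((bt x r * e x r) * v r))"
  proof (rule set_integral_mono_AE[OF sq(1) bev2])
    show "AE r\<in>{1..T} in lebesgue. 2 * bt x r * - w r \<le> - 2 * \<gamma> * ((bt x r * e x r) * v r)"
      using AE by eventually_elim auto
  qed
  also have "\<dots> = integral {1..T} (\<lambda>s. - 2 * \<gamma> * ((bt x s * e x s) * v s))"
    by (rule set_lebesgue_integral_eq_integral(2)[OF bev2])
  also have "\<dots> = - 2 * \<gamma> * integral {1..T} (\<lambda>s. (bt x s * e x s) * v s)"
    by (rule integral_mult_right)
  finally show ?thesis .
qed

lemma e2v2_ai: "1 \<le> c \<Longrightarrow> (\<lambda>s. E2 s * (v s)\<^sup>2) absolutely_integrable_on {c..d}"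
proof (cases "c \<le> d")
  case True
  assume "1 \<le> c"
  then show ?thesis unfolding E2_def
    using True by (intro rectangle_fubini(1)[of _ _ "\<lambda>x s. (e x s)\<^sup>2"] continuous_intros e_cont_on v2_ai) auto
qed (simp add: absolutely_integrable_on_null)

text \<open>The identity for the square of \<open>e\<close> along a single characteristic is
  integrated over all characteristics that meet the time interval from 1 to \<open>T\<close>. Where
  they enter they contribute \<open>E2 1\<close> or, at x = 1, nothing; where they leave they
  contribute the boundary dissipation at x = 0 or \<open>E2 T\<close>.\<close>

lemma e_energy:
  assumes T: "1 \<le> T"
  shows "E2 T + integral {1..T} (\<lambda>t. (e 0 t)\<^sup>2) + 2 * \<gamma>\<^sub>0 * integral {1..T} (\<lambda>s. E2 s * (v s)\<^sup>2)
    = E2 1 + 2 * integral {1..T} (\<lambda>s. integral {0..1} (\<lambda>x. bt x s * e x s) * v s)"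
proof -
  \<comment> \<open>Entry and exit times of the characteristic \<xi>.\<close>
  define a b where "a \<xi> = max 1 (\<xi> - 1)" and "b \<xi> = min T \<xi>" for \<xi> :: real
  define J1 where "J1 \<xi> = integral {max 1 (\<xi> - 1)..min T \<xi>} (\<lambda>s. (bt (\<xi> - s) s * e (\<xi> - s) s) * v s)" for \<xi>
  define J2 where "J2 \<xi> = integral {max 1 (\<xi> - 1)..min T \<xi>} (\<lambda>s. (e (\<xi> - s) s)\<^sup>2 * (v s)\<^sup>2)" for \<xi>
  have be: "continuous_on ({0..1} \<times> {1..T}) (\<lambda>p. bt (fst p) (snd p) * e (fst p) (snd p))"
    by (intro continuous_intros e_cont_on bt_cont_on) auto
  have ee: "continuous_on ({0..1} \<times> {1..T}) (\<lambda>p. (e (fst p) (snd p))\<^sup>2)"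
    by (intro continuous_intros e_cont_on) auto
  note S1 = strip_fubini[of 1 T "\<lambda>x s. bt x s * e x s", OF be T v_ai, folded J1_def, simplified]
  note S2 = strip_fubini[of 1 T "\<lambda>x s. (e x s)\<^sup>2", OF ee T v2_ai, folded J2_def E2_def, simplified]
  have char: "(e (\<xi> - b \<xi>) (b \<xi>))\<^sup>2 - (e (\<xi> - a \<xi>) (a \<xi>))\<^sup>2 = 2 * J1 \<xi> - 2 * \<gamma>\<^sub>0 * J2 \<xi>"
    if xi: "\<xi> \<in> {1..T+1}" for \<xi>
  proof -
    have ab: "0 \<le> \<xi>" "max 0 (\<xi> - 1) \<le> a \<xi>" "a \<xi> \<le> b \<xi>" "b \<xi> \<le> \<xi>"
      using xi T by (auto simp: a_def b_def)
    let ?y = "\<lambda>t. e (\<xi> - t) t"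
    let ?f = "\<lambda>s. bt (\<xi> - s) s * v s - (\<gamma>\<^sub>0 * (v s)\<^sup>2) * e (\<xi> - s) s"
    have y: "?y t - ?y (a \<xi>) = integral {a \<xi>..t} ?f" if "t \<in> {a \<xi>..b \<xi>}" for t
      using e_char(1)[of \<xi> "a \<xi>" t] ab that by auto
    note sq = ac_square[OF ab(3) y e_char(2)[OF ab]]
    have ec: "continuous_on {a \<xi>..b \<xi>} (\<lambda>s. e (\<xi> - s) s)"
      by (rule continuous_on_compose2[OF e_cont, of "{a \<xi>..b \<xi>}" "\<lambda>s. (\<xi> - s, s)", simplified])
        (auto intro!: continuous_intros simp: a_def b_def)
    have i1: "(\<lambda>s. (bt (\<xi> - s) s * e (\<xi> - s) s) * v s) absolutely_integrable_on {a \<xi>..b \<xi>}"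
      using ab by (intro absolutely_integrable_continuous_mult continuous_intros ec bt_char_cont v_ai) (auto simp: a_def)
    have i2: "(\<lambda>s. (e (\<xi> - s) s)\<^sup>2 * (v s)\<^sup>2) absolutely_integrable_on {a \<xi>..b \<xi>}"
      by (intro absolutely_integrable_continuous_mult continuous_intros ec v2_ai) (auto simp: a_def)
    have "(?y (b \<xi>))\<^sup>2 - (?y (a \<xi>))\<^sup>2 = integral {a \<xi>..b \<xi>} (\<lambda>t. 2 * ?y t * ?f t)" by (rule sq(2))
    also have "\<dots> = integral {a \<xi>..b \<xi>} (\<lambda>s. 2 * ((bt (\<xi> - s) s * e (\<xi> - s) s) * v s)
        - 2 * \<gamma>\<^sub>0 * ((e (\<xi> - s) s)\<^sup>2 * (v s)\<^sup>2))"
      by (rule integral_cong) (simp add: algebra_simps power2_eq_square)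
    also have "\<dots> = 2 * J1 \<xi> - 2 * \<gamma>\<^sub>0 * J2 \<xi>"
      unfolding J1_def J2_def a_def[symmetric] b_def[symmetric]
      using i1 i2 by (subst integral_diff) (auto intro!: integrable_on_mult_right dest: absolutely_integrable_integrable)
    finally show ?thesis .
  qed
  have Jint: "J1 integrable_on {1..T+1}" "J2 integrable_on {1..T+1}"
    using S1(1) S2(1) by (auto dest: absolutely_integrable_integrable)
  have rhs: "((\<lambda>\<xi>. 2 * J1 \<xi> - 2 * \<gamma>\<^sub>0 * J2 \<xi>) has_integral
     (2 * integral {1..T+1} J1 - 2 * \<gamma>\<^sub>0 * integral {1..T+1} J2)) {1..T+1}"
    using Jint by (intro has_integral_diff has_integral_mult_right integrable_integral)
  have e0: "(\<lambda>t. (e 0 t)\<^sup>2) integrable_on {1..T}"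
    by (intro integrable_continuous_interval continuous_intros e_cont_time) auto
  have exT: "((\<lambda>\<xi>. (e (\<xi> - t) t)\<^sup>2) has_integral E2 t) {t..t+1}" if "t \<ge> 1" for t
  proof -
    have "(\<lambda>x. (e x t)\<^sup>2) integrable_on {0..1}"
      using that by (intro integrable_continuous_interval continuous_intros e_cont_space) auto
    then show ?thesis
      using has_integral_shift_Icc_real[of "\<lambda>x. (e (x - t) t)\<^sup>2" t "E2 t" 0 1]
      by (auto simp: o_def add.commute E2_def integrable_integral)
  qed
  have "((\<lambda>\<xi>. (e (\<xi> - b \<xi>) (b \<xi>))\<^sup>2) has_integral (integral {1..T} (\<lambda>t. (e 0 t)\<^sup>2) + E2 T)) {1..T+1}"
  proof (rule has_integral_combine[of 1 T "T+1"])
    show "((\<lambda>\<xi>. (e (\<xi> - b \<xi>) (b \<xi>))\<^sup>2) has_integral integral {1..T} (\<lambda>t. (e 0 t)\<^sup>2)) {1..T}"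
      by (rule has_integral_eq[OF _ integrable_integral[OF e0]]) (auto simp: b_def)
    show "((\<lambda>\<xi>. (e (\<xi> - b \<xi>) (b \<xi>))\<^sup>2) has_integral E2 T) {T..T+1}"
      by (rule has_integral_eq[OF _ exT[OF T]]) (auto simp: b_def)
  qed (use T in auto)
  moreover have "((\<lambda>\<xi>. (e (\<xi> - a \<xi>) (a \<xi>))\<^sup>2) has_integral (E2 1 + 0)) {1..T+1}"
  proof (rule has_integral_combine[of 1 2 "T+1"])
    show "((\<lambda>\<xi>. (e (\<xi> - a \<xi>) (a \<xi>))\<^sup>2) has_integral E2 1) {1..2}"
      by (rule has_integral_eq[OF _ exT[of 1, simplified]]) (auto simp: a_def)
    show "((\<lambda>\<xi>. (e (\<xi> - a \<xi>) (a \<xi>))\<^sup>2) has_integral 0) {2..T+1}"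
      by (rule has_integral_eq[OF _ has_integral_0]) (auto simp: a_def e_right)
  qed (use T in auto)
  ultimately have "((\<lambda>\<xi>. (e (\<xi> - b \<xi>) (b \<xi>))\<^sup>2 - (e (\<xi> - a \<xi>) (a \<xi>))\<^sup>2) has_integral
      (integral {1..T} (\<lambda>t. (e 0 t)\<^sup>2) + E2 T) - (E2 1 + 0)) {1..T+1}"
    by (rule has_integral_diff)
  then have "((\<lambda>\<xi>. 2 * J1 \<xi> - 2 * \<gamma>\<^sub>0 * J2 \<xi>) has_integral
      (integral {1..T} (\<lambda>t. (e 0 t)\<^sup>2) + E2 T) - (E2 1 + 0)) {1..T+1}"
    by (rule has_integral_eq[rotated]) (use char in auto)
  from has_integral_unique[OF this rhs] show ?thesis
    using S1(2) S2(2) by simp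
qed

definition V where "V t = E2 t + integral {0..1} (\<lambda>x. (bt x t)\<^sup>2) / \<gamma>"

text \<open>Dividing the energy of \<open>bt\<close> by \<gamma> makes the two cross terms cancel,
  once Fubini has brought the integrals into the same order.\<close>

lemma V_estimate:
  assumes T: "1 \<le> T"
  shows "V T + integral {1..T} (\<lambda>t. (e 0 t)\<^sup>2) + 2 * \<gamma>\<^sub>0 * integral {1..T} (\<lambda>s. E2 s * (v s)\<^sup>2) \<le> V 1"
proof -
  define J where "J = integral {1..T} (\<lambda>s. integral {0..1} (\<lambda>x. bt x s * e x s) * v s)"
  have be: "continuous_on ({0..1} \<times> {1..T}) (\<lambda>p. bt (fst p) (snd p) * e (fst p) (snd p))"
    by (intro continuous_intros e_cont_on bt_cont_on) auto
  note R = rectangle_fubini[of 1 T "\<lambda>x s. bt x s * e x s", OF be T v_ai, simplified]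
  have bti: "(\<lambda>x. (bt x t)\<^sup>2) integrable_on {0..1}" if "t \<ge> 0" for t
    using that by (intro integrable_continuous_interval continuous_intros bt_cont_space)
  have "integral {0..1} (\<lambda>x. (bt x T)\<^sup>2) - integral {0..1} (\<lambda>x. (bt x 1)\<^sup>2) =
     integral {0..1} (\<lambda>x. (bt x T)\<^sup>2 - (bt x 1)\<^sup>2)"
    using T by (intro integral_diff[symmetric] bti) auto
  also have "\<dots> \<le> integral {0..1} (\<lambda>x. - 2 * \<gamma> * integral {1..T} (\<lambda>s. (bt x s * e x s) * v s))"
    using T R(2) by (intro integral_le integrable_diff bti integrable_on_mult_right bt_energy) (auto dest: absolutely_integrable_integrable)
  also have "\<dots> = - 2 * \<gamma> * J"
    unfolding J_def using R(3) by simp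
  finally have "integral {0..1} (\<lambda>x. (bt x T)\<^sup>2) / \<gamma> \<le> integral {0..1} (\<lambda>x. (bt x 1)\<^sup>2) / \<gamma> - 2 * J"
    using gam by (simp add: field_simps)
  then show ?thesis using e_energy[OF T, folded J_def] by (simp add: V_def)
qed

end

section \<open>The delay equation for the boundary trace\<close>

lemma integral_reflect_shift:
  fixes f :: "real \<Rightarrow> real"
  shows "integral {a..b} (\<lambda>y. f (c - y)) = integral {c-b..c-a} f"
proof -
  have "integral {a..b} (\<lambda>y. f (c - y)) = integral {-b..-a} (\<lambda>y. f (c + y))"
    using Henstock_Kurzweil_Integration.integral_reflect_real[of "-a" "-b" "\<lambda>y. f (c + y)"] by simp
  also have "\<dots> = integral {-b+c..-a+c} f" by (rule integral_shift_left)
  finally show ?thesis by (simp add: algebra_simps)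
qed

lemma absolutely_integrable_reflect_shift:
  fixes f :: "real \<Rightarrow> real"
  shows "(\<lambda>y. f (c - y)) absolutely_integrable_on {a..b} \<longleftrightarrow> f absolutely_integrable_on {c-b..c-a}"
proof -
  have "(\<lambda>y. f (c - y)) absolutely_integrable_on {a..b} \<longleftrightarrow>
      (\<lambda>y. f (c + y)) absolutely_integrable_on {-b..-a}"
    using absolutely_integrable_reflect_real[where f = "\<lambda>y. f (c + y)" and a = "-b" and b = "-a"] by simp
  also have "\<dots> \<longleftrightarrow> f absolutely_integrable_on {c-b..c-a}"
    using absolutely_integrable_shift_left[where f = f and c = c and a = "-b" and b = "-a"] by simp
  finally show ?thesis .
qed

text \<open>A given time lies in the window starting at \<open>t\<close> only for \<open>t\<close>
  in a set of length at most 1, so averaging over windows does not increase the integral.\<close>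

lemma window_integral:
  fixes m :: "real \<Rightarrow> real"
  assumes cd: "c \<le> d" and m: "m absolutely_integrable_on {c..d+1}" "\<And>s. m s \<ge> 0"
  shows "(\<lambda>t. integral {t..t+1} m) absolutely_integrable_on {c..d}"
    and "integral {c..d} (\<lambda>t. integral {t..t+1} m) \<le> integral {c..d+1} m"
proof -
  define F where "F t s = (if s \<in> {t..t+1} then 1 else 0 :: real)" for t s :: real
  have Fm: "(\<lambda>(t,s). F t s) \<in> borel_measurable (borel \<Otimes>\<^sub>M borel)"
    unfolding F_def split_beta' atLeastAtMost_iff by measurable
  have eq: "integral {t..t+1} m = integral {c..d+1} (\<lambda>s. F t s * m s)" if t: "t \<in> {c..d}" for t
  proof -
    have "integral {c..d+1} (\<lambda>s. F t s * m s) = integral {c..d+1} (\<lambda>s. if s \<in> {t..t+1} then m s else 0)"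
      by (rule integral_cong) (simp add: F_def)
    also have "\<dots> = integral ({t..t+1} \<inter> {c..d+1}) m"
      by (rule Henstock_Kurzweil_Integration.integral_restrict_Int)
    also have "{t..t+1} \<inter> {c..d+1} = {t..t+1}" using t by auto
    finally show ?thesis by simp
  qed
  have inner: "0 \<le> integral {c..d} (\<lambda>t. F t s)" "integral {c..d} (\<lambda>t. F t s) \<le> 1" for s
  proof -
    have "integral {c..d} (\<lambda>t. F t s) = integral {c..d} (\<lambda>t. if t \<in> {s-1..s} then 1 else 0)"
      by (rule integral_cong) (auto simp: F_def)
    also have "\<dots> = integral ({s-1..s} \<inter> {c..d}) (\<lambda>_. 1)"
      by (rule Henstock_Kurzweil_Integration.integral_restrict_Int)
    also have "\<dots> = integral {max (s-1) c..min s d} (\<lambda>_. 1)" by (simp add: Int_atLeastAtMost)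
    finally have "integral {c..d} (\<lambda>t. F t s) = integral {max (s-1) c..min s d} (\<lambda>_. 1)" .
    then show "0 \<le> integral {c..d} (\<lambda>t. F t s)" "integral {c..d} (\<lambda>t. F t s) \<le> 1"
      by (cases "max (s-1) c \<le> min s d"; simp)+
  qed
  have F1: "\<bar>F t s\<bar> \<le> 1" for t s by (simp add: F_def)
  note fub = fubini_bounded_times_integrable[OF Fm F1 m(1), of c d]
  show "(\<lambda>t. integral {t..t+1} m) absolutely_integrable_on {c..d}"
    by (rule absolutely_integrable_cong[OF fub(2)]) (use eq in auto)
  have "integral {c..d} (\<lambda>t. integral {t..t+1} m) = integral {c..d} (\<lambda>t. integral {c..d+1} (\<lambda>s. F t s * m s))"
    by (rule integral_cong) (use eq in auto)
  also have "\<dots> = integral {c..d+1} (\<lambda>s. integral {c..d} (\<lambda>t. F t s) * m s)" by (rule fub(3))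
  also have "\<dots> \<le> integral {c..d+1} m"
    by (rule integral_le) (use fub(1) m inner in \<open>auto intro: absolutely_integrable_integrable mult_left_le_one_le\<close>)
  finally show "integral {c..d} (\<lambda>t. integral {t..t+1} m) \<le> integral {c..d+1} m" .
qed

section \<open>The kernel as a resolvent\<close>

context volterra_data
begin

definition conv where "conv m y = integral {0..y} (\<lambda>s. \<phi> (y - s) * m s)"

lemma conv_integrand_ai:
  assumes "m absolutely_integrable_on {0..1}" "y \<in> {0..1}"
  shows "(\<lambda>s. \<phi> (y - s) * m s) absolutely_integrable_on {0..y}"
proof (rule absolutely_integrable_continuous_mult)
  show "continuous_on {0..y} (\<lambda>s. \<phi> (y - s))"
    by (rule continuous_on_compose2[OF phi_cont]) (use assms in \<open>auto intro!: continuous_intros\<close>)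
  show "m absolutely_integrable_on {0..y}"
    by (rule absolutely_integrable_on_subinterval[OF assms(1)]) (use assms in auto)
qed

lemma conv_le:
  assumes "m absolutely_integrable_on {0..1}" "y \<in> {0..1}"
  shows "\<bar>conv m y\<bar> \<le> B * integral {0..1} (\<lambda>s. \<bar>m s\<bar>)"
proof -
  have am: "(\<lambda>s. \<bar>m s\<bar>) absolutely_integrable_on {0..1}" using assms(1) by (rule set_integrable_abs)
  have am': "(\<lambda>s. \<bar>m s\<bar>) integrable_on {0..y}"
    by (rule absolutely_integrable_integrable[OF absolutely_integrable_on_subinterval[OF am]]) (use assms in auto)
  have "\<bar>conv m y\<bar> \<le> integral {0..y} (\<lambda>s. B * \<bar>m s\<bar>)"
    unfolding conv_def
  proof (rule integral_abs_bound_integral)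
    show "(\<lambda>s. B * \<bar>m s\<bar>) integrable_on {0..y}" using am' by (rule integrable_on_mult_right)
    show "\<bar>\<phi> (y - s) * m s\<bar> \<le> B * \<bar>m s\<bar>" if "s \<in> {0..y}" for s
      unfolding abs_mult using that assms by (intro mult_right_mono phi_bound) auto
  qed (rule absolutely_integrable_integrable[OF conv_integrand_ai[OF assms]])
  also have "\<dots> = B * integral {0..y} (\<lambda>s. \<bar>m s\<bar>)" by simp
  also have "\<dots> \<le> B * integral {0..1} (\<lambda>s. \<bar>m s\<bar>)"
    using assms B_pos am' am by (intro mult_left_mono integral_subset_le) (auto intro: absolutely_integrable_integrable)
  finally show ?thesis .
qed

text \<open>The kernel is the resolvent of \<open>\<phi>\<close>: convolving with \<open>\<delta> - k\<close> undoes \<open>m - \<phi> * m\<close>, here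
  evaluated at the end point \<open>1\<close>.\<close>

lemma kernel_op_resolvent:
  assumes m: "m absolutely_integrable_on {0..1}"
  shows "conv m absolutely_integrable_on {0..1}"
    and "(\<lambda>y. kernel_op \<phi> (1 - y) * (m y - conv m y)) absolutely_integrable_on {0..1}"
    and "integral {0..1} (\<lambda>y. kernel_op \<phi> (1 - y) * (m y - conv m y)) = - conv m 1"
proof -
  let ?k = "kernel_op \<phi>"
  define cl where "cl x = max 0 (min 1 x)" for x :: real
  have cl: "cl x \<in> {0..1}" "x \<in> {0..1} \<Longrightarrow> cl x = x" for x by (auto simp: cl_def)
  have clc: "continuous_on S cl" for S unfolding cl_def by (intro continuous_intros)
  define k' where "k' x = ?k (cl x)" for x
  define \<phi>' where "\<phi>' x = \<phi> (cl x)" for x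
  \<comment> \<open>The clamped versions are continuous on the whole line, hence Borel, as the
    Fubini lemma requires.\<close>
  have k'c: "continuous_on UNIV k'" and \<phi>'c: "continuous_on UNIV \<phi>'"
    unfolding k'_def \<phi>'_def using cl(1)
    by (auto intro!: continuous_on_compose2[OF kernel_op_spec(1) clc] continuous_on_compose2[OF phi_cont clc])
  define F0 where "F0 y s = (if s \<le> y then \<phi>' (y - s) else 0)" for y s
  define F where "F y s = k' (1 - y) * F0 y s" for y s
  have [measurable]: "k' \<in> borel_measurable borel" "\<phi>' \<in> borel_measurable borel"
    using k'c \<phi>'c by (auto intro: borel_measurable_continuous_onI)
  have F0m: "(\<lambda>(y, s). F0 y s) \<in> borel_measurable (borel \<Otimes>\<^sub>M borel)"
    unfolding F0_def split_beta' by measurable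
  have Fm: "(\<lambda>(y, s). F y s) \<in> borel_measurable (borel \<Otimes>\<^sub>M borel)"
    unfolding F_def F0_def split_beta' by measurable
  define \<kappa> where "\<kappa> = B + B * (B * exp (1 + 2 * B))"
  have k'b: "\<bar>k' x\<bar> \<le> \<kappa>" for x unfolding k'_def \<kappa>_def by (rule kernel_op_bound[OF cl(1)])
  have F0b: "\<bar>F0 y s\<bar> \<le> B" for y s
    unfolding F0_def \<phi>'_def using phi_bound[OF cl(1)] B_pos by auto
  have Fb: "\<bar>F y s\<bar> \<le> \<kappa> * B" for y s
    unfolding F_def abs_mult
    by (rule mult_mono[OF k'b F0b]) (use order_trans[OF abs_ge_zero k'b] in auto)
  have conv_eq: "integral {0..1} (\<lambda>s. F0 y s * m s) = conv m y" if y: "y \<in> {0..1}" for y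
  proof -
    have "integral {0..1} (\<lambda>s. F0 y s * m s) = integral {0..1} (\<lambda>s. if s \<in> {..y} then \<phi>' (y - s) * m s else 0)"
      by (rule integral_cong) (simp add: F0_def)
    also have "\<dots> = integral ({..y} \<inter> {0..1}) (\<lambda>s. \<phi>' (y - s) * m s)"
      by (rule Henstock_Kurzweil_Integration.integral_restrict_Int)
    also have "{..y} \<inter> {0..1} = {0..y}" using y by auto
    also have "integral {0..y} (\<lambda>s. \<phi>' (y - s) * m s) = conv m y"
      unfolding conv_def by (rule integral_cong) (use y cl(2) in \<open>auto simp: \<phi>'_def\<close>)
    finally show ?thesis .
  qed
  show ca: "conv m absolutely_integrable_on {0..1}"
    by (rule absolutely_integrable_cong[OF fubini_bounded_times_integrable(2)[OF F0m F0b m, of 0 1]])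
      (use conv_eq in auto)
  have kr: "continuous_on {0..1} (\<lambda>y. ?k (1 - y))"
    by (rule continuous_on_compose2[OF kernel_op_spec(1)]) (auto intro!: continuous_intros)
  have i1: "(\<lambda>y. ?k (1 - y) * m y) absolutely_integrable_on {0..1}"
    and i2: "(\<lambda>y. ?k (1 - y) * conv m y) absolutely_integrable_on {0..1}"
    using kr m ca by (intro absolutely_integrable_continuous_mult; simp)+
  show "(\<lambda>y. ?k (1 - y) * (m y - conv m y)) absolutely_integrable_on {0..1}"
    using set_integral_diff(1)[OF i1 i2] by (simp add: right_diff_distrib)
  have \<phi>r: "(\<lambda>s. \<phi> (1 - s) * m s) absolutely_integrable_on {0..1}"
    using conv_integrand_ai[OF m, of 1] by simp
  have "integral {0..1} (\<lambda>y. ?k (1 - y) * conv m y) = integral {0..1} (\<lambda>y. integral {0..1} (\<lambda>s. F y s * m s))"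
  proof (rule integral_cong)
    fix y :: real assume y: "y \<in> {0..1}"
    have "integral {0..1} (\<lambda>s. F y s * m s) = integral {0..1} (\<lambda>s. k' (1 - y) * (F0 y s * m s))"
      by (simp add: F_def mult.assoc)
    also have "\<dots> = k' (1 - y) * conv m y" using conv_eq[OF y] by simp
    finally show "?k (1 - y) * conv m y = integral {0..1} (\<lambda>s. F y s * m s)"
      using cl(2)[of "1 - y"] y by (simp add: k'_def)
  qed
  also have "\<dots> = integral {0..1} (\<lambda>s. integral {0..1} (\<lambda>y. F y s) * m s)"
    by (rule fubini_bounded_times_integrable(3)[OF Fm Fb m])
  also have "\<dots> = integral {0..1} (\<lambda>s. ?k (1 - s) * m s + \<phi> (1 - s) * m s)"
  proof (rule integral_cong)
    fix s :: real assume s: "s \<in> {0..1}"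
    have "integral {0..1} (\<lambda>y. F y s) = integral {0..1} (\<lambda>y. if y \<in> {s..} then k' (1 - y) * \<phi>' (y - s) else 0)"
      by (rule integral_cong) (simp add: F_def F0_def)
    also have "\<dots> = integral ({s..} \<inter> {0..1}) (\<lambda>y. k' (1 - y) * \<phi>' (y - s))"
      by (rule Henstock_Kurzweil_Integration.integral_restrict_Int)
    also have "{s..} \<inter> {0..1} = {s..1}" using s by auto
    \<comment> \<open>Reflection turns the inner integral into the convolution in the Volterra
      equation at the point 1 - s.\<close>
    also have "integral {s..1} (\<lambda>y. k' (1 - y) * \<phi>' (y - s)) = integral {0..1-s} (\<lambda>q. k' q * \<phi>' (1 - s - q))"
      using integral_reflect_shift[of s 1 "\<lambda>q. k' q * \<phi>' (1 - s - q)" 1] by simp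
    also have "\<dots> = integral {0..1-s} (\<lambda>q. \<phi> (1 - s - q) * ?k q)"
      by (rule integral_cong) (use s cl(2) in \<open>auto simp: k'_def \<phi>'_def\<close>)
    also have "\<dots> = ?k (1 - s) + \<phi> (1 - s)"
      using kernel_op_spec(2)[of "1 - s"] s by auto
    finally show "integral {0..1} (\<lambda>y. F y s) * m s = ?k (1 - s) * m s + \<phi> (1 - s) * m s"
      by (simp add: distrib_right)
  qed
  also have "\<dots> = integral {0..1} (\<lambda>s. ?k (1 - s) * m s) + conv m 1"
    unfolding conv_def using i1 \<phi>r by (intro integral_add) (auto intro: absolutely_integrable_integrable)
  finally have c: "integral {0..1} (\<lambda>y. ?k (1 - y) * conv m y) = integral {0..1} (\<lambda>s. ?k (1 - s) * m s) + conv m 1" .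
  have "integral {0..1} (\<lambda>y. ?k (1 - y) * (m y - conv m y)) =
      integral {0..1} (\<lambda>y. ?k (1 - y) * m y) - integral {0..1} (\<lambda>y. ?k (1 - y) * conv m y)"
    using i1 i2 by (subst integral_diff[symmetric]) (auto simp: right_diff_distrib intro: absolutely_integrable_integrable)
  then show "integral {0..1} (\<lambda>y. ?k (1 - y) * (m y - conv m y)) = - conv m 1"
    using c by simp
qed

end

section \<open>Kernel bounds and the equation for the trace on a unit window\<close>

context control_setting
begin

definition \<kappa> where "\<kappa> = B + B * (B * exp (1 + 2 * B))"

definition \<kappa>\<^sub>1 where "\<kappa>\<^sub>1 = \<kappa> + \<epsilon>"

lemma kappa_nonneg: "0 \<le> \<kappa>" "0 \<le> \<kappa>\<^sub>1"
  using B eps by (auto simp: \<kappa>_def \<kappa>\<^sub>1_def)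

end

context closed_loop
begin

lemma bh_volterra: assumes "t \<ge> 0" shows "volterra_data (\<lambda>x. bh x t) B"
  by unfold_locales (use B bh_bound[OF _ assms] lipschitz_on_continuous_on[OF lip[OF assms]] in auto)

text \<open>Combines the projection, the inequality between \<open>M\<close> and \<open>B\<close>,
  and the Lipschitz assumption: at every time the estimate is an input for which the accuracy of the
  neural operator is guaranteed.\<close>

lemma bh_admissible: assumes "t \<ge> 0" shows "(\<lambda>x. bh x t) \<in> admissible_set M K"
proof -
  have "\<bar>bh x t\<bar> \<le> M" if "x \<in> {0..1}" for x using bh_bound[OF that assms] MB by linarith
  then show ?thesis
    using lipschitz_on_continuous_on[OF lip[OF assms]] lip[OF assms] MB B
    by (auto simp: admissible_set_def sup_norm_le_iff)
qed

definition k where "k t = kernel_op (\<lambda>x. bh x t)"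
definition kh where "kh t = Khat (\<lambda>x. bh x t)"

lemma k_cont: "t \<ge> 0 \<Longrightarrow> continuous_on {0..1} (k t)"
  and k_bound: "t \<ge> 0 \<Longrightarrow> x \<in> {0..1} \<Longrightarrow> \<bar>k t x\<bar> \<le> \<kappa>"
  unfolding k_def \<kappa>_def
  using volterra_data.kernel_op_spec(1)[OF bh_volterra] volterra_data.kernel_op_bound[OF bh_volterra] by auto

lemma kh_cont: "t \<ge> 0 \<Longrightarrow> continuous_on {0..1} (kh t)"
  and kh_close: "t \<ge> 0 \<Longrightarrow> x \<in> {0..1} \<Longrightarrow> \<bar>k t x - kh t x\<bar> \<le> \<epsilon>"
  using NO bh_admissible[of t] by (auto simp: neural_operator_def k_def kh_def less_imp_le)

lemma kh_bound: "t \<ge> 0 \<Longrightarrow> x \<in> {0..1} \<Longrightarrow> \<bar>kh t x\<bar> \<le> \<kappa>\<^sub>1"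
  using k_bound[of t x] kh_close[of t x] unfolding \<kappa>\<^sub>1_def by linarith

lemma U_eq: "U t = integral {0..1} (\<lambda>y. kh t (1 - y) * uh y t)"
  by (simp add: U_def control_law_def kh_def)

lemma uh_ai: "t \<ge> 0 \<Longrightarrow> (\<lambda>x. uh x t) absolutely_integrable_on {0..1}"
  and u_ai: "t \<ge> 0 \<Longrightarrow> (\<lambda>x. u x t) absolutely_integrable_on {0..1}"
  and e_ai: "t \<ge> 0 \<Longrightarrow> (\<lambda>x. e x t) absolutely_integrable_on {0..1}"
  by (intro square_integrable_imp_absolutely_integrable(1) uh_sq u_sq e_sq; simp)+

lemma reflect_cont: "continuous_on {0..1} f \<Longrightarrow> continuous_on {0..1} (\<lambda>y. f (1 - y :: real))"
  for f :: "real \<Rightarrow> real"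
  by (erule continuous_on_compose2) (auto intro!: continuous_intros)

lemma abs_integral_kernel_le:
  fixes f g :: "real \<Rightarrow> real"
  assumes "continuous_on {0..1} f" "\<And>x. x \<in> {0..1} \<Longrightarrow> \<bar>f x\<bar> \<le> c" "g absolutely_integrable_on {0..1}"
  shows "\<bar>integral {0..1} (\<lambda>y. f (1 - y) * g y)\<bar> \<le> c * integral {0..1} (\<lambda>y. \<bar>g y\<bar>)"
proof -
  have "\<bar>integral {0..1} (\<lambda>y. f (1 - y) * g y)\<bar> \<le> integral {0..1} (\<lambda>y. c * \<bar>g y\<bar>)"
  proof (rule integral_abs_bound_integral)
    show "(\<lambda>y. f (1 - y) * g y) integrable_on {0..1}"
      by (intro absolutely_integrable_integrable absolutely_integrable_continuous_mult reflect_cont assms)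
    show "(\<lambda>y. c * \<bar>g y\<bar>) integrable_on {0..1}"
      by (intro integrable_on_mult_right absolutely_integrable_integrable set_integrable_abs assms)
    show "\<bar>f (1 - y) * g y\<bar> \<le> c * \<bar>g y\<bar>" if "y \<in> {0..1}" for y
      unfolding abs_mult using that by (intro mult_right_mono assms(2)) auto
  qed
  then show ?thesis by simp
qed

lemma U_bound: "t \<ge> 0 \<Longrightarrow> \<bar>U t\<bar> \<le> \<kappa>\<^sub>1 * integral {0..1} (\<lambda>y. \<bar>uh y t\<bar>)"
  unfolding U_eq by (intro abs_integral_kernel_le kh_cont kh_bound uh_ai) auto

definition e0 where "e0 t = e 0 t"

text \<open>The defect of freezing the estimate at time \<open>t\<close>: the first integral is the
  drift of \<open>bh\<close> since then, the second the contribution of the observer's damping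
  term.\<close>

definition P where
  "P t y = integral {t..t+y} (\<lambda>s. (bh (t + y - s) s - bh (t + y - s) t) * v s)
     + \<gamma>\<^sub>0 * integral {t..t+y} (\<lambda>s. e (t + y - s) s * (v s)\<^sup>2)"

lemma e0_cont: "1 \<le> c \<Longrightarrow> continuous_on {c..d} e0"
  unfolding e0_def using e_cont_time[of 0] by auto

lemma e_char_cont: "1 \<le> t \<Longrightarrow> y \<in> {0..1} \<Longrightarrow> continuous_on {t..t+y} (\<lambda>s. e (t + y - s) s)"
  by (rule continuous_on_compose2[OF e_cont, of _ "\<lambda>s. (t + y - s, s)", simplified])
    (auto intro!: continuous_intros)

lemma bh_char_cont: "0 \<le> t \<Longrightarrow> y \<in> {0..1} \<Longrightarrow> continuous_on {t..t+y} (\<lambda>s. bh (t + y - s) s)"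
  and bh_fixed_char_cont: "0 \<le> t \<Longrightarrow> y \<in> {0..1} \<Longrightarrow> continuous_on {t..t+y} (\<lambda>s. bh (t + y - s) t)"
proof -
  show "continuous_on {t..t+y} (\<lambda>s. bh (t + y - s) s)" if "0 \<le> t" "y \<in> {0..1}"
    by (rule continuous_on_compose2[OF bh_cont, of _ "\<lambda>s. (t + y - s, s)", simplified])
      (use that in \<open>auto intro!: continuous_intros\<close>)
  show "continuous_on {t..t+y} (\<lambda>s. bh (t + y - s) t)" if "0 \<le> t" "y \<in> {0..1}"
    by (rule continuous_on_compose2[OF bh_cont, of _ "\<lambda>s. (t + y - s, t)", simplified])
      (use that in \<open>auto intro!: continuous_intros\<close>)
qed

lemma trace_window:
  assumes t: "1 \<le> t" and y: "y \<in> {0..1}"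
  shows "v (t + y) - volterra_data.conv (\<lambda>x. bh x t) (\<lambda>s. v (t + s)) y = uh y t + e0 (t + y) + P t y"
proof -
  interpret volterra_data "\<lambda>x. bh x t" B using t by (intro bh_volterra) auto
  have i1: "(\<lambda>s. bh (t + y - s) s * v s) integrable_on {t..t+y}"
    and i2: "(\<lambda>s. bh (t + y - s) t * v s) integrable_on {t..t+y}"
    and i3: "(\<lambda>s. e (t + y - s) s * (v s)\<^sup>2) integrable_on {t..t+y}"
    using t y by (auto intro!: absolutely_integrable_integrable absolutely_integrable_continuous_mult
        bh_char_cont bh_fixed_char_cont e_char_cont v_ai v2_ai)
  have "uh 0 (t + y) - uh y t =
      integral {t..t+y} (\<lambda>s. bh (t + y - s) s * v s + \<gamma>\<^sub>0 * e (t + y - s) s * (v s)\<^sup>2)"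
    using uh_char(1)[of "t + y" t "t + y"] t y by auto
  also have "\<dots> = integral {t..t+y} (\<lambda>s. bh (t + y - s) s * v s) +
      \<gamma>\<^sub>0 * integral {t..t+y} (\<lambda>s. e (t + y - s) s * (v s)\<^sup>2)"
    using integral_add[OF i1 integrable_on_mult_right[OF i3, of "\<gamma>\<^sub>0"]] by (simp add: mult.assoc)
  finally have 1: "uh 0 (t + y) - uh y t = \<dots>" .
  have 2: "integral {t..t+y} (\<lambda>s. (bh (t + y - s) s - bh (t + y - s) t) * v s) =
     integral {t..t+y} (\<lambda>s. bh (t + y - s) s * v s) - integral {t..t+y} (\<lambda>s. bh (t + y - s) t * v s)"
    using integral_diff[OF i1 i2] by (simp add: left_diff_distrib)
  have 3: "conv (\<lambda>s. v (t + s)) y = integral {t..t+y} (\<lambda>s. bh (t + y - s) t * v s)"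
    using integral_shift_left[of 0 y "\<lambda>s. bh (t + y - s) t * v s" t] unfolding conv_def
    by (simp add: add.commute)
  have "v (t + y) = uh 0 (t + y) + e0 (t + y)" by (simp add: v_def e0_def e_def)
  then show ?thesis using 1 2 3 by (simp add: P_def)
qed

text \<open>By the window identity, \<open>P t\<close> is a combination of functions already known
  to be integrable, so its integrals along characteristics need not be examined.\<close>

lemma P_ai: assumes t: "1 \<le> t" shows "P t absolutely_integrable_on {0..1}"
proof -
  interpret volterra_data "\<lambda>x. bh x t" B using t by (intro bh_volterra) auto
  have m: "(\<lambda>s. v (t + s)) absolutely_integrable_on {0..1}"
    using t v_ai[of t "t+1"] by (subst absolutely_integrable_shift_left) (auto simp: add.commute)
  have e0i: "(\<lambda>y. e0 (t + y)) absolutely_integrable_on {0..1}"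
    using t by (subst absolutely_integrable_shift_left)
      (auto intro!: absolutely_integrable_continuous_real e0_cont)
  have "(\<lambda>y. ((v (t + y) - conv (\<lambda>s. v (t + s)) y) - uh y t) - e0 (t + y)) absolutely_integrable_on {0..1}"
    using t by (intro set_integral_diff(1) m kernel_op_resolvent(1) uh_ai e0i) auto
  then show ?thesis
    by (rule absolutely_integrable_cong) (use trace_window[OF t] in auto)
qed

text \<open>The window identity is used twice. At y = 1 the resolvent identity replaces the
  convolution by the integral of the kernel against uh + e0 + P, and the control cancels the part
  with \<open>uh\<close> up to the difference of the two kernels. That difference is at most
  \<epsilon> and multiplies the mean of \<open>uh\<close>, which the identity read backwards bounds
  by 1 + B times the mean of the trace: this is the origin of the factor 1 + B in the
  threshold.\<close>

lemma trace_bound: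
  assumes t: "1 \<le> t"
  shows "\<bar>v (t + 1)\<bar> \<le> \<epsilon> * (1 + B) * N t (t + 1) + \<bar>e0 (t + 1)\<bar>
     + \<kappa>\<^sub>1 * integral {t..t+1} (\<lambda>s. \<bar>e0 s\<bar>) + \<bar>P t 1\<bar> + \<kappa>\<^sub>1 * integral {0..1} (\<lambda>y. \<bar>P t y\<bar>)"
proof -
  have t0: "t \<ge> 0" using t by auto
  interpret volterra_data "\<lambda>x. bh x t" B using t0 by (rule bh_volterra)
  define m where "m s = v (t + s)" for s
  define r where "r y = m y - conv m y" for y
  have m: "m absolutely_integrable_on {0..1}"
    unfolding m_def using t v_ai[of t "t+1"] by (subst absolutely_integrable_shift_left) (auto simp: add.commute)
  have e0i: "(\<lambda>y. e0 (t + y)) absolutely_integrable_on {0..1}"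
    using t by (subst absolutely_integrable_shift_left)
      (auto intro!: absolutely_integrable_continuous_real e0_cont)
  have ca: "conv m absolutely_integrable_on {0..1}" using m by (rule kernel_op_resolvent(1))
  have r_eq: "r y = uh y t + e0 (t + y) + P t y" if "y \<in> {0..1}" for y
    using trace_window[OF t that] by (simp add: r_def m_def[abs_def])
  have ra: "r absolutely_integrable_on {0..1}" unfolding r_def[abs_def] using m ca by (rule set_integral_diff(1))
  note ai = uh_ai[OF t0] e0i P_ai[OF t]
  have abs_i: "(\<lambda>y. \<bar>g y\<bar>) integrable_on {0..1}" if "g absolutely_integrable_on {0..1}" for g :: "real \<Rightarrow> real"
    using set_integrable_abs[OF that] by (rule absolutely_integrable_integrable)
  have ki: "(\<lambda>y. k t (1 - y) * g y) integrable_on {0..1}" if "g absolutely_integrable_on {0..1}" for g :: "real \<Rightarrow> real"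
    by (intro absolutely_integrable_integrable absolutely_integrable_continuous_mult reflect_cont k_cont t0 that)
  have khi: "(\<lambda>y. kh t (1 - y) * uh y t) integrable_on {0..1}"
    by (intro absolutely_integrable_integrable absolutely_integrable_continuous_mult reflect_cont kh_cont t0 ai)
  have kr: "integral {0..1} (\<lambda>y. k t (1 - y) * r y) = integral {0..1} (\<lambda>y. k t (1 - y) * uh y t)
     + integral {0..1} (\<lambda>y. k t (1 - y) * e0 (t + y)) + integral {0..1} (\<lambda>y. k t (1 - y) * P t y)"
  proof -
    have "integral {0..1} (\<lambda>y. k t (1 - y) * r y) =
        integral {0..1} (\<lambda>y. k t (1 - y) * uh y t + k t (1 - y) * e0 (t + y) + k t (1 - y) * P t y)"
      by (rule integral_cong) (simp add: r_eq algebra_simps)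
    then show ?thesis
      using ki[OF ai(1)] ki[OF ai(2)] ki[OF ai(3)] by (simp add: integral_add integrable_add)
  qed
  have "integral {0..1} (\<lambda>y. k t (1 - y) * r y) = - conv m 1"
    using kernel_op_resolvent(3)[OF m] by (simp add: k_def r_def)
  moreover have "r 1 = v (t + 1) - conv m 1" by (simp add: r_def m_def)
  moreover have "r 1 = U t + e0 (t + 1) + P t 1"
  proof -
    have "uh 1 t = U t" using e_right[OF t0] u_right[OF t0] by (simp add: e_def)
    then show ?thesis using r_eq[of 1] by simp
  qed
  moreover have "U t - integral {0..1} (\<lambda>y. k t (1 - y) * uh y t) = integral {0..1} (\<lambda>y. (kh t (1 - y) - k t (1 - y)) * uh y t)"
    unfolding U_eq using integral_diff[OF khi ki[OF ai(1)]] by (simp add: left_diff_distrib)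
  ultimately have v: "v (t + 1) = integral {0..1} (\<lambda>y. (kh t (1 - y) - k t (1 - y)) * uh y t)
      + e0 (t + 1) + P t 1 - integral {0..1} (\<lambda>y. k t (1 - y) * e0 (t + y)) - integral {0..1} (\<lambda>y. k t (1 - y) * P t y)"
    using kr by linarith
  have b1: "\<bar>integral {0..1} (\<lambda>y. (kh t (1 - y) - k t (1 - y)) * uh y t)\<bar> \<le> \<epsilon> * integral {0..1} (\<lambda>y. \<bar>uh y t\<bar>)"
    by (rule abs_integral_kernel_le[of "\<lambda>x. kh t x - k t x"])
      (use kh_close[OF t0] in \<open>auto intro!: continuous_intros kh_cont k_cont t0 ai simp: abs_minus_commute\<close>)
  have b2: "\<bar>integral {0..1} (\<lambda>y. k t (1 - y) * e0 (t + y))\<bar> \<le> \<kappa> * integral {0..1} (\<lambda>y. \<bar>e0 (t + y)\<bar>)"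
    and b3: "\<bar>integral {0..1} (\<lambda>y. k t (1 - y) * P t y)\<bar> \<le> \<kappa> * integral {0..1} (\<lambda>y. \<bar>P t y\<bar>)"
    by (rule abs_integral_kernel_le; use k_bound[OF t0] k_cont[OF t0] ai in auto)+
  \<comment> \<open>The window identity is solved for \<open>uh\<close>.\<close>
  have "integral {0..1} (\<lambda>y. \<bar>uh y t\<bar>) \<le> integral {0..1} (\<lambda>y. \<bar>m y\<bar> + B * integral {0..1} (\<lambda>y. \<bar>m y\<bar>) + \<bar>e0 (t + y)\<bar> + \<bar>P t y\<bar>)"
  proof (rule integral_le)
    show "(\<lambda>y. \<bar>m y\<bar> + B * integral {0..1} (\<lambda>y. \<bar>m y\<bar>) + \<bar>e0 (t + y)\<bar> + \<bar>P t y\<bar>) integrable_on {0..1}"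
      by (intro integrable_add abs_i ai m) auto
    show "\<bar>uh y t\<bar> \<le> \<bar>m y\<bar> + B * integral {0..1} (\<lambda>y. \<bar>m y\<bar>) + \<bar>e0 (t + y)\<bar> + \<bar>P t y\<bar>" if "y \<in> {0..1}" for y
      using r_eq[OF that] conv_le[OF m that] unfolding r_def by linarith
  qed (rule abs_i[OF ai(1)])
  also have "\<dots> = (1 + B) * integral {0..1} (\<lambda>y. \<bar>m y\<bar>) + integral {0..1} (\<lambda>y. \<bar>e0 (t + y)\<bar>) + integral {0..1} (\<lambda>y. \<bar>P t y\<bar>)"
  proof -
    have "((\<lambda>y. \<bar>m y\<bar> + B * integral {0..1} (\<lambda>y. \<bar>m y\<bar>) + \<bar>e0 (t + y)\<bar> + \<bar>P t y\<bar>) has_integral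
      integral {0..1} (\<lambda>y. \<bar>m y\<bar>) + (1 - 0) *\<^sub>R (B * integral {0..1} (\<lambda>y. \<bar>m y\<bar>)) + integral {0..1} (\<lambda>y. \<bar>e0 (t + y)\<bar>)
      + integral {0..1} (\<lambda>y. \<bar>P t y\<bar>)) {0..1}"
      by (intro has_integral_add integrable_integral abs_i m ai has_integral_const_real[of _ 0 1, simplified])
        (use has_integral_const_real[of _ 0 1] in auto)
    from integral_unique[OF this] show ?thesis by (simp add: algebra_simps)
  qed
  finally have uhb: "integral {0..1} (\<lambda>y. \<bar>uh y t\<bar>) \<le> \<dots>" .
  have mN: "integral {0..1} (\<lambda>y. \<bar>m y\<bar>) = N t (t + 1)"
    unfolding N_def m_def using integral_shift_left[of 0 1 "\<lambda>s. \<bar>v s\<bar>" t] by (simp add: add.commute)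
  have eN: "integral {0..1} (\<lambda>y. \<bar>e0 (t + y)\<bar>) = integral {t..t+1} (\<lambda>s. \<bar>e0 s\<bar>)"
    using integral_shift_left[of 0 1 "\<lambda>s. \<bar>e0 s\<bar>" t] by (simp add: add.commute)
  have "\<epsilon> * integral {0..1} (\<lambda>y. \<bar>uh y t\<bar>) \<le> \<epsilon> * ((1 + B) * N t (t + 1) + integral {t..t+1} (\<lambda>s. \<bar>e0 s\<bar>) + integral {0..1} (\<lambda>y. \<bar>P t y\<bar>))"
    using uhb eps unfolding mN eN by (intro mult_left_mono) auto
  \<comment> \<open>The means of \<open>e0\<close> and \<open>P\<close> occur with \<kappa> directly
    and with \<epsilon> through the bound for \<open>uh\<close>; together this is
    \<open>\<kappa>\<^sub>1\<close>.\<close>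
  then show ?thesis
    using v b1 b2[unfolded eN] b3 unfolding \<kappa>\<^sub>1_def by (simp add: algebra_simps)
qed

end

lemma sum5_square_le:
  fixes a b c d e :: real
  shows "(a + b + c + d + e)\<^sup>2 \<le> 5 * (a\<^sup>2 + b\<^sup>2 + c\<^sup>2 + d\<^sup>2 + e\<^sup>2)"
proof -
  have "5 * (a\<^sup>2 + b\<^sup>2 + c\<^sup>2 + d\<^sup>2 + e\<^sup>2) - (a + b + c + d + e)\<^sup>2 =
    (a-b)\<^sup>2 + (a-c)\<^sup>2 + (a-d)\<^sup>2 + (a-e)\<^sup>2 + (b-c)\<^sup>2 + (b-d)\<^sup>2 + (b-e)\<^sup>2 + (c-d)\<^sup>2 + (c-e)\<^sup>2 + (d-e)\<^sup>2"
    by (simp add: power2_eq_square algebra_simps)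
  also have "\<dots> \<ge> 0" by simp
  finally show ?thesis by simp
qed

lemma sum2_square_le:
  fixes a b :: real
  shows "(a + b)\<^sup>2 \<le> 2 * (a\<^sup>2 + b\<^sup>2)"
  using zero_le_power2[of "a - b"] by (simp add: power2_eq_square algebra_simps)

lemma abs_le_square:
  fixes a b :: real
  assumes "\<bar>a\<bar> \<le> b" shows "a\<^sup>2 \<le> b\<^sup>2"
  using power_mono[OF assms, of 2] by simp

lemma integral_square_nonneg:
  fixes f :: "real \<Rightarrow> real"
  shows "0 \<le> integral S (\<lambda>x. (f x)\<^sup>2)"
  by (cases "(\<lambda>x. (f x)\<^sup>2) integrable_on S") (auto simp: not_integrable_integral intro: integral_nonneg)

context control_setting
begin

text \<open>The factor 10 is 5, from the square of a five-term sum, times 2, from the bound on the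
  square of \<open>P\<close>; the factor with \<open>\<kappa>\<^sub>1\<close> accounts for
  \<open>P\<close> at y = 1 and for its mean.\<close>

definition \<theta> where "\<theta> = 10 * (1 + \<kappa>\<^sub>1\<^sup>2) * (\<gamma>\<^sup>2 + \<gamma>\<^sub>0\<^sup>2)"

lemma theta_nonneg: "0 \<le> \<theta>"
  by (simp add: \<theta>_def)

end

section \<open>The freezing defect is controlled by dissipated quantities\<close>

context closed_loop
begin

text \<open>The density dissipated by the observer's damping, collected over a unit window of time.
  Its companion \<open>\<Phi>\<close> collects the same density along a single
  characteristic.\<close>

definition lam where "lam t = integral {t..t+1} (\<lambda>s. E2 s * (v s)\<^sup>2)"
definition \<Phi> where "\<Phi> t y = integral {t..t+y} (\<lambda>s. (e (t + y - s) s)\<^sup>2 * (v s)\<^sup>2)"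

lemma E2_nonneg: "0 \<le> E2 t"
  unfolding E2_def by (rule integral_square_nonneg)

lemma lam_nonneg: "1 \<le> t \<Longrightarrow> 0 \<le> lam t"
  unfolding lam_def
  by (intro integral_nonneg absolutely_integrable_integrable e2v2_ai) (auto intro!: mult_nonneg_nonneg E2_nonneg)

lemma \<Phi>_nonneg: "1 \<le> t \<Longrightarrow> y \<in> {0..1} \<Longrightarrow> 0 \<le> \<Phi> t y"
  unfolding \<Phi>_def
  by (intro integral_nonneg absolutely_integrable_integrable absolutely_integrable_continuous_mult
      continuous_intros e_char_cont v2_ai) auto

lemma mult_v_sq:
  assumes "continuous_on {a..b} f" "0 \<le> a"
  shows "(\<lambda>s. f s * v s) square_integrable_on {a..b}"
proof (rule absolutely_integrable_imp_square_integrable)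
  show "(\<lambda>s. f s * v s) absolutely_integrable_on {a..b}"
    by (intro absolutely_integrable_continuous_mult assms v_ai)
  have "(\<lambda>s. (f s)\<^sup>2 * (v s)\<^sup>2) absolutely_integrable_on {a..b}"
    by (intro absolutely_integrable_continuous_mult continuous_intros assms v2_ai)
  then show "(\<lambda>s. (f s * v s)\<^sup>2) integrable_on {a..b}"
    unfolding power_mult_distrib by (rule absolutely_integrable_integrable)
qed

lemma bh_increment:
  assumes t: "1 \<le> t" and s: "s \<in> {t..t+1}" and x: "x \<in> {0..1}"
  shows "(bh x s - bh x t)\<^sup>2 \<le> \<gamma>\<^sup>2 * integral {t..t+1} (\<lambda>r. (e x r)\<^sup>2 * (v r)\<^sup>2)"
proof -
  have sq: "(\<lambda>r. e x r * v r) square_integrable_on {t..u}" for u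
    using t x by (intro mult_v_sq e_cont_time) auto
  note si = square_integrable_imp_absolutely_integrable[OF sq]
  have "\<bar>bh x s - bh x t\<bar> \<le> integral {t..s} (\<lambda>r. \<gamma> * \<bar>e x r * v r\<bar>)"
    using t s x by (intro bh_rate integrable_on_mult_right absolutely_integrable_integrable set_integrable_abs si(1))
      (auto simp: abs_mult)
  then have "(bh x s - bh x t)\<^sup>2 \<le> (\<gamma> * integral {t..s} (\<lambda>r. \<bar>e x r * v r\<bar>))\<^sup>2"
    by (intro abs_le_square) simp
  also have "\<dots> = \<gamma>\<^sup>2 * (integral {t..s} (\<lambda>r. \<bar>e x r * v r\<bar>))\<^sup>2" by (simp add: power_mult_distrib)
  also have "\<dots> \<le> \<gamma>\<^sup>2 * integral {t..t+1} (\<lambda>r. (e x r * v r)\<^sup>2)"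
  proof (rule mult_left_mono)
    have "(integral {t..s} (\<lambda>r. \<bar>e x r * v r\<bar>))\<^sup>2 \<le> \<bar>s - t\<bar> * integral {t..s} (\<lambda>r. (e x r * v r)\<^sup>2)"
      by (rule si(3))
    also have "\<dots> \<le> 1 * integral {t..s} (\<lambda>r. (e x r * v r)\<^sup>2)"
      using s by (intro mult_right_mono integral_nonneg absolutely_integrable_integrable[OF si(2)]) auto
    also have "\<dots> \<le> integral {t..t+1} (\<lambda>r. (e x r * v r)\<^sup>2)"
      using s by (simp, intro integral_subset_le absolutely_integrable_integrable[OF si(2)]) auto
    finally show "(integral {t..s} (\<lambda>r. \<bar>e x r * v r\<bar>))\<^sup>2 \<le> integral {t..t+1} (\<lambda>r. (e x r * v r)\<^sup>2)" .
  qed auto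
  finally show ?thesis by (simp add: power_mult_distrib)
qed

text \<open>Cauchy-Schwarz against \<open>v\<close> in both parts of \<open>P\<close> splits off the
  trace energy of the window. What remains of the drift is an integral over a characteristic of
  squared increments at varying points of space, each bounded by an integral over the whole
  window.\<close>

lemma P_bound:
  assumes t: "1 \<le> t" and y: "y \<in> {0..1}"
  shows "(P t y)\<^sup>2 \<le> 2 * A t (t+1) * (\<gamma>\<^sup>2 * lam t + \<gamma>\<^sub>0\<^sup>2 * \<Phi> t y)"
proof -
  define D where "D s = bh (t + y - s) s - bh (t + y - s) t" for s
  define q where "q x = integral {t..t+1} (\<lambda>r. (e x r)\<^sup>2 * (v r)\<^sup>2)" for x
  have ee: "continuous_on ({0..1} \<times> {t..t+1}) (\<lambda>p. (e (fst p) (snd p))\<^sup>2)"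
    using t by (intro continuous_intros e_cont_on) auto
  have "(\<lambda>r. (v r)\<^sup>2) absolutely_integrable_on {t..t+1}" using t by (intro v2_ai) auto
  note R = rectangle_fubini[of t "t+1" "\<lambda>x s. (e x s)\<^sup>2", OF ee _ this, folded q_def E2_def lam_def, simplified]
  have Dc: "continuous_on {t..t+y} D"
    unfolding D_def using t y by (intro continuous_intros bh_char_cont bh_fixed_char_cont) auto
  have q0: "0 \<le> q x" if "x \<in> {0..1}" for x
    unfolding q_def using t that
    by (intro integral_nonneg absolutely_integrable_integrable absolutely_integrable_continuous_mult
        continuous_intros e_cont_time v2_ai) auto
  have Ay: "integral {t..t+y} (\<lambda>s. (v s)\<^sup>2) \<le> A t (t+1)" "0 \<le> integral {t..t+y} (\<lambda>s. (v s)\<^sup>2)"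
    using A_mono[of t t "t+y" "t+1"] A_nonneg[of t "t+y"] t y by (auto simp: A_def)
  have vs: "v square_integrable_on {t..t+y}" using t by (intro v_sq) auto
  have Dsq: "D square_integrable_on {t..t+y}"
    by (intro absolutely_integrable_imp_square_integrable absolutely_integrable_continuous_real
        integrable_continuous_interval continuous_intros Dc)
  have qr: "(\<lambda>s. q (t + y - s)) absolutely_integrable_on {t..t+y}"
    using y by (subst absolutely_integrable_reflect_shift) (auto intro: absolutely_integrable_on_subinterval[OF R(2)])
  have "integral {t..t+y} (\<lambda>s. (D s)\<^sup>2) \<le> integral {t..t+y} (\<lambda>s. \<gamma>\<^sup>2 * q (t + y - s))"
  proof (rule integral_le)
    show "(\<lambda>s. (D s)\<^sup>2) integrable_on {t..t+y}"
      by (intro integrable_continuous_interval continuous_intros Dc)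
    show "(\<lambda>s. \<gamma>\<^sup>2 * q (t + y - s)) integrable_on {t..t+y}"
      by (intro integrable_on_mult_right absolutely_integrable_integrable qr)
    show "(D s)\<^sup>2 \<le> \<gamma>\<^sup>2 * q (t + y - s)" if "s \<in> {t..t+y}" for s
      unfolding D_def q_def by (rule bh_increment[OF t]) (use that y in auto)
  qed
  also have "\<dots> = \<gamma>\<^sup>2 * integral {0..y} q"
    \<comment> \<open>Along the characteristic the space variable runs backwards from
      \<open>y\<close> to 0, so the time integral becomes a space integral, and Fubini turns it into
      \<open>lam\<close>.\<close>
    using integral_reflect_shift[of t "t+y" q "t+y"] by simp
  also have "\<dots> \<le> \<gamma>\<^sup>2 * integral {0..1} q"
    using y q0 by (intro mult_left_mono integral_subset_le absolutely_integrable_integrable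
        absolutely_integrable_on_subinterval[OF R(2)]) auto
  finally have D2: "integral {t..t+y} (\<lambda>s. (D s)\<^sup>2) \<le> \<gamma>\<^sup>2 * lam t" using R(3) by simp
  have p1: "(integral {t..t+y} (\<lambda>s. D s * v s))\<^sup>2 \<le> \<gamma>\<^sup>2 * lam t * A t (t+1)"
  proof -
    have "\<bar>integral {t..t+y} (\<lambda>s. D s * v s)\<bar> \<le> integral {t..t+y} (\<lambda>s. \<bar>D s * v s\<bar>)"
      by (rule integral_abs_bound_integral)
        (auto intro!: absolutely_integrable_integrable set_integrable_abs cauchy_schwarz_integral(1)[OF _ Dsq vs])
    then have "(integral {t..t+y} (\<lambda>s. D s * v s))\<^sup>2 \<le> (integral {t..t+y} (\<lambda>s. \<bar>D s * v s\<bar>))\<^sup>2"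
      by (rule abs_le_square)
    also have "\<dots> \<le> integral {t..t+y} (\<lambda>s. (D s)\<^sup>2) * integral {t..t+y} (\<lambda>s. (v s)\<^sup>2)"
      by (rule cauchy_schwarz_integral(2)[OF _ Dsq vs]) auto
    also have "\<dots> \<le> \<gamma>\<^sup>2 * lam t * A t (t+1)"
      using D2 Ay lam_nonneg[OF t] by (intro mult_mono) auto
    finally show ?thesis .
  qed
  define f where "f s = e (t + y - s) s * v s" for s
  have fsq: "f square_integrable_on {t..t+y}"
    unfolding f_def using t y by (intro mult_v_sq e_char_cont) auto
  have p2: "(integral {t..t+y} (\<lambda>s. e (t + y - s) s * (v s)\<^sup>2))\<^sup>2 \<le> \<Phi> t y * A t (t+1)"
  proof -
    have eq: "(\<lambda>s. e (t + y - s) s * (v s)\<^sup>2) = (\<lambda>s. f s * v s)"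
      by (simp add: f_def power2_eq_square mult.assoc)
    have "\<bar>integral {t..t+y} (\<lambda>s. f s * v s)\<bar> \<le> integral {t..t+y} (\<lambda>s. \<bar>f s * v s\<bar>)"
      by (rule integral_abs_bound_integral)
        (auto intro!: absolutely_integrable_integrable set_integrable_abs cauchy_schwarz_integral(1)[OF _ fsq vs])
    then have "(integral {t..t+y} (\<lambda>s. f s * v s))\<^sup>2 \<le> (integral {t..t+y} (\<lambda>s. \<bar>f s * v s\<bar>))\<^sup>2"
      by (rule abs_le_square)
    also have "\<dots> \<le> integral {t..t+y} (\<lambda>s. (f s)\<^sup>2) * integral {t..t+y} (\<lambda>s. (v s)\<^sup>2)"
      by (rule cauchy_schwarz_integral(2)[OF _ fsq vs]) auto
    also have "integral {t..t+y} (\<lambda>s. (f s)\<^sup>2) = \<Phi> t y"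
      by (simp add: \<Phi>_def f_def power_mult_distrib)
    also have "\<Phi> t y * integral {t..t+y} (\<lambda>s. (v s)\<^sup>2) \<le> \<Phi> t y * A t (t+1)"
      using Ay \<Phi>_nonneg[OF t y] by (intro mult_left_mono) auto
    finally show ?thesis unfolding eq .
  qed
  have "(P t y)\<^sup>2 \<le> 2 * ((integral {t..t+y} (\<lambda>s. D s * v s))\<^sup>2 +
      (\<gamma>\<^sub>0 * integral {t..t+y} (\<lambda>s. e (t + y - s) s * (v s)\<^sup>2))\<^sup>2)"
    unfolding P_def D_def[symmetric] by (rule sum2_square_le)
  also have "\<dots> \<le> 2 * (\<gamma>\<^sup>2 * lam t * A t (t+1) + \<gamma>\<^sub>0\<^sup>2 * (\<Phi> t y * A t (t+1)))"
    unfolding power_mult_distrib using p1 p2 by (intro mult_left_mono add_mono) auto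
  finally show ?thesis by (simp add: algebra_simps)
qed

text \<open>For a single \<open>y\<close> the quantity \<open>\<Phi> t y\<close> is not bounded by
  \<open>lam t\<close>, but its mean over \<open>y\<close> is: the characteristics involved sweep
  out part of the strip, each point once.\<close>

lemma P_mean_bound:
  assumes t: "1 \<le> t"
  shows "(integral {0..1} (\<lambda>y. \<bar>P t y\<bar>))\<^sup>2 \<le> 2 * A t (t+1) * (\<gamma>\<^sup>2 + \<gamma>\<^sub>0\<^sup>2) * lam t"
proof -
  define J where "J \<xi> = integral {max t (\<xi> - 1)..min (t+1) \<xi>} (\<lambda>s. (e (\<xi> - s) s)\<^sup>2 * (v s)\<^sup>2)" for \<xi>
  have ee: "continuous_on ({0..1} \<times> {t..t+1}) (\<lambda>p. (e (fst p) (snd p))\<^sup>2)"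
    using t by (intro continuous_intros e_cont_on) auto
  have v2: "(\<lambda>r. (v r)\<^sup>2) absolutely_integrable_on {t..t+1}" using t by (intro v2_ai) auto
  have t2: "t + 1 + 1 = t + 2" by simp
  note S = strip_fubini[of t "t+1" "\<lambda>x s. (e x s)\<^sup>2", OF ee less_imp_le[OF less_add_one] v2, folded J_def E2_def lam_def, unfolded t2]
  have \<Phi>J: "\<Phi> t y = J (t + y)" if "y \<in> {0..1}" for y
  proof -
    have "max t (t + y - 1) = t" "min (t + 1) (t + y) = t + y" using that by auto
    then show ?thesis by (simp add: \<Phi>_def J_def)
  qed
  have J0: "0 \<le> J \<xi>" if "\<xi> \<in> {t..t+2}" for \<xi>
    unfolding J_def
  proof (intro integral_nonneg absolutely_integrable_integrable absolutely_integrable_continuous_mult continuous_on_power v2_ai)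
    show "continuous_on {max t (\<xi> - 1)..min (t+1) \<xi>} (\<lambda>s. e (\<xi> - s) s)"
      by (rule continuous_on_compose2[OF e_cont, of _ "\<lambda>s. (\<xi> - s, s)", simplified])
        (use t in \<open>auto intro!: continuous_intros\<close>)
  qed (use t in auto)
  have Ji: "J absolutely_integrable_on {t..t+1}"
    by (rule absolutely_integrable_on_subinterval[OF S(1)]) auto
  have \<Phi>i: "\<Phi> t absolutely_integrable_on {0..1}"
  proof (rule absolutely_integrable_cong)
    show "(\<lambda>y. J (t + y)) absolutely_integrable_on {0..1}"
      using Ji by (subst absolutely_integrable_shift_left) (simp add: add.commute)
  qed (use \<Phi>J in auto)
  have "integral {0..1} (\<Phi> t) = integral {0..1} (\<lambda>y. J (t + y))"
    by (rule integral_cong) (use \<Phi>J in auto)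
  also have "\<dots> = integral {t..t+1} J" using integral_shift_left[of 0 1 J t] by (simp add: add.commute)
  also have "\<dots> \<le> integral {t..t+2} J"
    using J0 by (intro integral_subset_le absolutely_integrable_integrable Ji S(1)) auto
  also have "\<dots> = lam t" by (rule S(2))
  finally have \<Phi>l: "integral {0..1} (\<Phi> t) \<le> lam t" .
  have bi: "(\<lambda>y. 2 * A t (t+1) * (\<gamma>\<^sup>2 * lam t + \<gamma>\<^sub>0\<^sup>2 * \<Phi> t y)) integrable_on {0..1}"
    by (intro integrable_on_mult_right integrable_add absolutely_integrable_integrable[OF \<Phi>i]) auto
  have Pm: "P t \<in> borel_measurable (lebesgue_on {0..1})"
    using P_ai[OF t] by (rule absolutely_integrable_imp_borel_measurable) auto
  have P2: "(\<lambda>y. (P t y)\<^sup>2) absolutely_integrable_on {0..1}"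
    by (rule measurable_bounded_by_integrable_imp_absolutely_integrable[OF _ _ bi])
      (use Pm P_bound[OF t] in auto)
  have Psq: "P t square_integrable_on {0..1}"
    by (rule absolutely_integrable_imp_square_integrable[OF P_ai[OF t] absolutely_integrable_integrable[OF P2]])
  have "(integral {0..1} (\<lambda>y. \<bar>P t y\<bar>))\<^sup>2 \<le> integral {0..1} (\<lambda>y. (P t y)\<^sup>2)"
    using square_integrable_imp_absolutely_integrable(3)[OF Psq] by simp
  also have "\<dots> \<le> integral {0..1} (\<lambda>y. 2 * A t (t+1) * (\<gamma>\<^sup>2 * lam t + \<gamma>\<^sub>0\<^sup>2 * \<Phi> t y))"
    by (rule integral_le[OF absolutely_integrable_integrable[OF P2] bi P_bound[OF t]])
  also have "\<dots> = 2 * A t (t+1) * (\<gamma>\<^sup>2 * lam t + \<gamma>\<^sub>0\<^sup>2 * integral {0..1} (\<Phi> t))"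
    using integral_add[of "\<lambda>_. \<gamma>\<^sup>2 * lam t" "{0..1}" "\<lambda>y. \<gamma>\<^sub>0\<^sup>2 * \<Phi> t y"]
      integrable_on_mult_right[OF absolutely_integrable_integrable[OF \<Phi>i], of "\<gamma>\<^sub>0\<^sup>2"]
    by auto
  also have "\<dots> \<le> 2 * A t (t+1) * (\<gamma>\<^sup>2 * lam t + \<gamma>\<^sub>0\<^sup>2 * lam t)"
    using \<Phi>l A_nonneg[of t "t+1"] t by (intro mult_left_mono add_left_mono) auto
  finally show ?thesis by (simp add: algebra_simps)
qed

lemma e0_sq: "1 \<le> a \<Longrightarrow> e0 square_integrable_on {a..b}"
  by (intro absolutely_integrable_imp_square_integrable absolutely_integrable_continuous_real
      integrable_continuous_interval continuous_intros e0_cont)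

lemma trace_square_bound:
  assumes t: "1 \<le> t"
  shows "(v (t + 1))\<^sup>2 \<le> 5 * (\<epsilon> * (1 + B))\<^sup>2 * A t (t+1) + 5 * (e0 (t + 1))\<^sup>2
    + 5 * \<kappa>\<^sub>1\<^sup>2 * integral {t..t+1} (\<lambda>s. (e0 s)\<^sup>2) + \<theta> * ((lam t + \<Phi> t 1) * A t (t+1))"
proof -
  let ?A = "A t (t+1)"
  have A0: "0 \<le> ?A" using A_nonneg t by auto
  have l0: "0 \<le> lam t" "0 \<le> \<Phi> t 1" using lam_nonneg \<Phi>_nonneg t by auto
  have "(v (t + 1))\<^sup>2 \<le> (\<epsilon> * (1 + B) * N t (t + 1) + \<bar>e0 (t + 1)\<bar>
     + \<kappa>\<^sub>1 * integral {t..t+1} (\<lambda>s. \<bar>e0 s\<bar>) + \<bar>P t 1\<bar> + \<kappa>\<^sub>1 * integral {0..1} (\<lambda>y. \<bar>P t y\<bar>))\<^sup>2"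
    by (rule abs_le_square[OF trace_bound[OF t]])
  also have "\<dots> \<le> 5 * ((\<epsilon> * (1 + B) * N t (t + 1))\<^sup>2 + (\<bar>e0 (t + 1)\<bar>)\<^sup>2
     + (\<kappa>\<^sub>1 * integral {t..t+1} (\<lambda>s. \<bar>e0 s\<bar>))\<^sup>2 + (\<bar>P t 1\<bar>)\<^sup>2 + (\<kappa>\<^sub>1 * integral {0..1} (\<lambda>y. \<bar>P t y\<bar>))\<^sup>2)"
    by (rule sum5_square_le)
  also have "\<dots> \<le> 5 * ((\<epsilon> * (1 + B))\<^sup>2 * ?A + (e0 (t + 1))\<^sup>2
     + \<kappa>\<^sub>1\<^sup>2 * integral {t..t+1} (\<lambda>s. (e0 s)\<^sup>2) + 2 * ?A * (\<gamma>\<^sup>2 * lam t + \<gamma>\<^sub>0\<^sup>2 * \<Phi> t 1)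
     + \<kappa>\<^sub>1\<^sup>2 * (2 * ?A * (\<gamma>\<^sup>2 + \<gamma>\<^sub>0\<^sup>2) * lam t))"
  proof (intro mult_left_mono add_mono)
    show "(\<epsilon> * (1 + B) * N t (t + 1))\<^sup>2 \<le> (\<epsilon> * (1 + B))\<^sup>2 * ?A"
      unfolding power_mult_distrib[of "\<epsilon> * (1 + B)"] using N_A[of t "t+1"] t by (intro mult_left_mono) auto
    show "(\<kappa>\<^sub>1 * integral {t..t+1} (\<lambda>s. \<bar>e0 s\<bar>))\<^sup>2 \<le> \<kappa>\<^sub>1\<^sup>2 * integral {t..t+1} (\<lambda>s. (e0 s)\<^sup>2)"
      unfolding power_mult_distrib using square_integrable_imp_absolutely_integrable(3)[OF e0_sq[of t "t+1"]] t
      by (intro mult_left_mono) auto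
    show "(\<bar>P t 1\<bar>)\<^sup>2 \<le> 2 * ?A * (\<gamma>\<^sup>2 * lam t + \<gamma>\<^sub>0\<^sup>2 * \<Phi> t 1)"
      using P_bound[OF t, of 1] by simp
    show "(\<kappa>\<^sub>1 * integral {0..1} (\<lambda>y. \<bar>P t y\<bar>))\<^sup>2 \<le> \<kappa>\<^sub>1\<^sup>2 * (2 * ?A * (\<gamma>\<^sup>2 + \<gamma>\<^sub>0\<^sup>2) * lam t)"
      unfolding power_mult_distrib by (intro mult_left_mono P_mean_bound t) auto
  qed auto
  also have "\<dots> \<le> 5 * (\<epsilon> * (1 + B))\<^sup>2 * ?A + 5 * (e0 (t + 1))\<^sup>2
    + 5 * \<kappa>\<^sub>1\<^sup>2 * integral {t..t+1} (\<lambda>s. (e0 s)\<^sup>2) + \<theta> * ((lam t + \<Phi> t 1) * ?A)"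
  proof -
    have "\<gamma>\<^sup>2 * lam t + \<gamma>\<^sub>0\<^sup>2 * \<Phi> t 1 + \<kappa>\<^sub>1\<^sup>2 * ((\<gamma>\<^sup>2 + \<gamma>\<^sub>0\<^sup>2) * lam t)
       \<le> (1 + \<kappa>\<^sub>1\<^sup>2) * (\<gamma>\<^sup>2 + \<gamma>\<^sub>0\<^sup>2) * (lam t + \<Phi> t 1)"
    proof -
      \<comment> \<open>The difference of the two sides is a sum of nonnegative terms.\<close>
      have "(1 + \<kappa>\<^sub>1\<^sup>2) * (\<gamma>\<^sup>2 + \<gamma>\<^sub>0\<^sup>2) * (lam t + \<Phi> t 1) -
        (\<gamma>\<^sup>2 * lam t + \<gamma>\<^sub>0\<^sup>2 * \<Phi> t 1 + \<kappa>\<^sub>1\<^sup>2 * ((\<gamma>\<^sup>2 + \<gamma>\<^sub>0\<^sup>2) * lam t))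
        = \<gamma>\<^sub>0\<^sup>2 * lam t + \<gamma>\<^sup>2 * \<Phi> t 1 + \<kappa>\<^sub>1\<^sup>2 * ((\<gamma>\<^sup>2 + \<gamma>\<^sub>0\<^sup>2) * \<Phi> t 1)"
        by (simp add: algebra_simps)
      also have "\<dots> \<ge> 0" using l0 by simp
      finally show ?thesis by simp
    qed
    from mult_left_mono[OF this, of "10 * ?A"] A0 show ?thesis
      unfolding \<theta>_def by (simp add: algebra_simps)
  qed
  finally show ?thesis .
qed

end

context control_setting
begin

text \<open>Translates the threshold into the form used for absorption: the factor 5 comes from
  squaring the five-term bound of the trace, and the result 1/2 allows the delayed energy to be
  moved to the left-hand side.\<close>

lemma eps_small: "5 * (\<epsilon> * (1 + B))\<^sup>2 \<le> 1 / 2"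
proof -
  have "\<epsilon> * (1 + B) \<le> exp (- 3 / 2) / sqrt 2"
  proof -
    have "\<epsilon> * (1 + B) \<le> exp (- 3 / 2) / (sqrt 2 * (1 + B)) * (1 + B)"
      using eps B by (intro mult_right_mono) auto
    also have "\<dots> = exp (- 3 / 2) / sqrt 2" using B by simp
    finally show ?thesis .
  qed
  then have "(\<epsilon> * (1 + B))\<^sup>2 \<le> (exp (- 3 / 2) / sqrt 2)\<^sup>2"
    using eps B by (intro power_mono) auto
  also have "\<dots> = exp (- 3) / 2"
    by (simp add: power_divide power2_eq_square exp_add[symmetric])
  also have "exp (- 3 :: real) \<le> 1 / 5"
  proof -
    have "(5 :: real) \<le> (1 + 1) ^ 3" by simp
    also have "\<dots> \<le> exp 1 ^ 3" using exp_ge_add_one_self[of 1] by (intro power_mono) auto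
    also have "\<dots> = exp 3" by (simp add: exp_of_nat_mult[symmetric])
    finally show ?thesis by (simp add: exp_minus field_simps)
  qed
  finally show ?thesis by simp
qed

end

section \<open>Gronwall argument for the energy of the trace\<close>

context closed_loop
begin

lemma V_nonneg: "0 \<le> V t"
  unfolding V_def using gam by (intro add_nonneg_nonneg divide_nonneg_pos E2_nonneg integral_square_nonneg)

lemma dissipation_nonneg: "0 \<le> integral {1..T} (\<lambda>s. E2 s * (v s)\<^sup>2)"
  by (intro integral_nonneg absolutely_integrable_integrable e2v2_ai) (auto intro!: mult_nonneg_nonneg E2_nonneg)

lemma V_consequences:
  assumes "1 \<le> T"
  shows "integral {1..T} (\<lambda>t. (e0 t)\<^sup>2) \<le> V 1"
    and "2 * integral {1..T} (\<lambda>s. E2 s * (v s)\<^sup>2) \<le> V 1 / \<gamma>\<^sub>0"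
    and "V T \<le> V 1"
proof -
  have V: "V T + integral {1..T} (\<lambda>t. (e0 t)\<^sup>2) + 2 * \<gamma>\<^sub>0 * integral {1..T} (\<lambda>s. E2 s * (v s)\<^sup>2) \<le> V 1"
    using V_estimate[OF assms] by (simp add: e0_def)
  have n: "0 \<le> 2 * \<gamma>\<^sub>0 * integral {1..T} (\<lambda>s. E2 s * (v s)\<^sup>2)" "0 \<le> integral {1..T} (\<lambda>t. (e0 t)\<^sup>2)" "0 \<le> V T"
    using gam0 dissipation_nonneg V_nonneg integral_square_nonneg by auto
  show "integral {1..T} (\<lambda>t. (e0 t)\<^sup>2) \<le> V 1" "V T \<le> V 1" using V n by linarith+
  have "2 * \<gamma>\<^sub>0 * integral {1..T} (\<lambda>s. E2 s * (v s)\<^sup>2) \<le> V 1" using V n by linarith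
  then show "2 * integral {1..T} (\<lambda>s. E2 s * (v s)\<^sup>2) \<le> V 1 / \<gamma>\<^sub>0"
    using gam0 by (simp add: field_simps)
qed

text \<open>The Gronwall weight has finite total mass: both \<open>lam\<close> and
  \<open>\<Phi>\<close> at y = 1 integrate to at most the total dissipation \<open>D\<close>. For
  the latter, distinct times belong to distinct characteristics, which together cover at most the
  strip.\<close>

lemma q_integral:
  assumes T: "1 \<le> T"
  shows "(\<lambda>t. lam t + \<Phi> t 1) absolutely_integrable_on {1..T}"
    and "integral {1..T} (\<lambda>t. lam t + \<Phi> t 1) \<le> V 1 / \<gamma>\<^sub>0"
proof -
  define D where "D = integral {1..T+1} (\<lambda>s. E2 s * (v s)\<^sup>2)"
  have m0: "0 \<le> E2 s * (v s)\<^sup>2" for s by (intro mult_nonneg_nonneg E2_nonneg) auto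
  have mi: "(\<lambda>s. E2 s * (v s)\<^sup>2) absolutely_integrable_on {1..T+1}" by (rule e2v2_ai) simp
  note W = window_integral[OF T mi m0, folded lam_def D_def]
  define J where "J \<xi> = integral {max 1 (\<xi> - 1)..min (T+1) \<xi>} (\<lambda>s. (e (\<xi> - s) s)\<^sup>2 * (v s)\<^sup>2)" for \<xi>
  have ee: "continuous_on ({0..1} \<times> {1..T+1}) (\<lambda>p. (e (fst p) (snd p))\<^sup>2)"
    by (intro continuous_intros e_cont_on) auto
  have v2: "(\<lambda>r. (v r)\<^sup>2) absolutely_integrable_on {1..T+1}" by (intro v2_ai) auto
  have T1: "1 \<le> T + 1" using T by simp
  note S = strip_fubini[of 1 "T+1" "\<lambda>x s. (e x s)\<^sup>2", OF ee T1 v2, folded J_def E2_def D_def]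
  have \<Phi>J: "\<Phi> t 1 = J (1 + t)" if "t \<in> {1..T}" for t
  proof -
    have "max 1 (1 + t - 1) = t" "min (T+1) (1 + t) = t + 1" using that by auto
    then show ?thesis by (simp add: \<Phi>_def J_def add.commute)
  qed
  have J0: "0 \<le> J \<xi>" for \<xi>
    unfolding J_def
  proof (intro integral_nonneg absolutely_integrable_integrable absolutely_integrable_continuous_mult continuous_on_power v2_ai)
    show "continuous_on {max 1 (\<xi> - 1)..min (T+1) \<xi>} (\<lambda>s. e (\<xi> - s) s)"
      by (rule continuous_on_compose2[OF e_cont, of _ "\<lambda>s. (\<xi> - s, s)", simplified])
        (auto intro!: continuous_intros)
  qed auto
  have Ji: "J absolutely_integrable_on {1+1..T+1}"
    by (rule absolutely_integrable_on_subinterval[OF S(1)]) auto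
  have \<Phi>i: "(\<lambda>t. \<Phi> t 1) absolutely_integrable_on {1..T}"
  proof (rule absolutely_integrable_cong)
    show "(\<lambda>t. J (1 + t)) absolutely_integrable_on {1..T}"
      using Ji by (subst absolutely_integrable_shift_left)
  qed (use \<Phi>J in auto)
  have "integral {1..T} (\<lambda>t. \<Phi> t 1) = integral {1..T} (\<lambda>t. J (1 + t))"
    by (rule integral_cong) (use \<Phi>J in auto)
  also have "\<dots> = integral {1+1..T+1} J" by (rule integral_shift_left)
  also have "\<dots> \<le> integral {1..T+1+1} J"
    using J0 by (intro integral_subset_le absolutely_integrable_integrable Ji S(1)) auto
  also have "\<dots> = D" by (rule S(2))
  finally have \<Phi>D: "integral {1..T} (\<lambda>t. \<Phi> t 1) \<le> D" .
  show "(\<lambda>t. lam t + \<Phi> t 1) absolutely_integrable_on {1..T}"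
    using W(1) \<Phi>i by (rule set_integral_add(1))
  have "integral {1..T} (\<lambda>t. lam t + \<Phi> t 1) = integral {1..T} lam + integral {1..T} (\<lambda>t. \<Phi> t 1)"
    by (intro integral_add absolutely_integrable_integrable W(1) \<Phi>i)
  also have "\<dots> \<le> 2 * D" using W(2) \<Phi>D by linarith
  also have "\<dots> \<le> V 1 / \<gamma>\<^sub>0" unfolding D_def by (rule V_consequences(2)[OF T1])
  finally show "integral {1..T} (\<lambda>t. lam t + \<Phi> t 1) \<le> V 1 / \<gamma>\<^sub>0" .
qed

lemma q_nonneg: "1 \<le> t \<Longrightarrow> 0 \<le> lam t + \<Phi> t 1"
  using lam_nonneg \<Phi>_nonneg[of t 1] by auto

text \<open>The squared trace bound is integrated in time. The averaged delayed energy is at most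
  half of the left-hand side, which is finite, and is absorbed; this doubles the remaining
  constants. In the weighted term the window energy is enlarged to the energy since time 1.\<close>

lemma trace_gronwall_inequality:
  assumes T: "1 \<le> T"
  shows "A 1 (T+1) \<le> (2 * A 1 2 + 10 * (1 + \<kappa>\<^sub>1\<^sup>2) * V 1)
    + integral {1..T} (\<lambda>t. (2 * \<theta> * (lam t + \<Phi> t 1)) * A 1 (t+1))"
proof -
  let ?q = "\<lambda>t. lam t + \<Phi> t 1"
  let ?c = "5 * (\<epsilon> * (1 + B))\<^sup>2"
  have v2: "(\<lambda>r. (v r)\<^sup>2) absolutely_integrable_on {1..T+1}" by (intro v2_ai) auto
  have e02: "(\<lambda>r. (e0 r)\<^sup>2) absolutely_integrable_on {1..T+1}"
    by (intro absolutely_integrable_continuous_real continuous_intros e0_cont) auto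
  note WA = window_integral[OF T v2, folded A_def, simplified]
  note We = window_integral[OF T e02, simplified]
  have Ac: "continuous_on {1..T} (\<lambda>t. A 1 (t+1))"
    by (rule continuous_on_compose2[OF A_cont[of 1 "T+1"]]) (auto intro!: continuous_intros)
  have qA: "(\<lambda>t. ?q t * A 1 (t+1)) integrable_on {1..T}"
    using absolutely_integrable_continuous_mult[OF Ac q_integral(1)[OF T]]
    by (auto simp: mult.commute dest: absolutely_integrable_integrable)
  have e02s: "(\<lambda>t. (e0 (1 + t))\<^sup>2) integrable_on {1..T}"
    using integrable_shift_left[of "\<lambda>t. (e0 t)\<^sup>2" 1 1 T]
      absolutely_integrable_integrable[OF absolutely_integrable_on_subinterval[OF e02, of "1+1" "T+1"]] by auto
  have v2s: "(\<lambda>t. (v (1 + t))\<^sup>2) integrable_on {1..T}"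
    using integrable_shift_left[of "\<lambda>t. (v t)\<^sup>2" 1 1 T] v2_int[of "1+1" "T+1"] by auto
  have "A 2 (T+1) = integral {1..T} (\<lambda>t. (v (1 + t))\<^sup>2)"
    unfolding A_def using integral_shift_left[of 1 T "\<lambda>s. (v s)\<^sup>2" 1] by simp
  also have "\<dots> \<le> integral {1..T} (\<lambda>t. ?c * A t (t+1) + 5 * (e0 (1 + t))\<^sup>2
    + 5 * \<kappa>\<^sub>1\<^sup>2 * integral {t..t+1} (\<lambda>s. (e0 s)\<^sup>2) + \<theta> * (?q t * A 1 (t+1)))"
  proof (rule integral_le[OF v2s])
    show "(\<lambda>t. ?c * A t (t+1) + 5 * (e0 (1 + t))\<^sup>2
      + 5 * \<kappa>\<^sub>1\<^sup>2 * integral {t..t+1} (\<lambda>s. (e0 s)\<^sup>2) + \<theta> * (?q t * A 1 (t+1))) integrable_on {1..T}"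
      by (intro integrable_add integrable_on_mult_right absolutely_integrable_integrable[OF WA(1)]
          absolutely_integrable_integrable[OF We(1)] e02s qA)
    fix t assume t: "t \<in> {1..T}"
    have "\<theta> * (?q t * A t (t+1)) \<le> \<theta> * (?q t * A 1 (t+1))"
      using t q_nonneg[of t] theta_nonneg by (intro mult_left_mono A_mono) auto
    then show "(v (1 + t))\<^sup>2 \<le> ?c * A t (t+1) + 5 * (e0 (1 + t))\<^sup>2
      + 5 * \<kappa>\<^sub>1\<^sup>2 * integral {t..t+1} (\<lambda>s. (e0 s)\<^sup>2) + \<theta> * (?q t * A 1 (t+1))"
      using trace_square_bound[of t] t by (simp add: add.commute)
  qed
  also have "\<dots> = ?c * integral {1..T} (\<lambda>t. A t (t+1)) + 5 * integral {1..T} (\<lambda>t. (e0 (1 + t))\<^sup>2)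
    + 5 * \<kappa>\<^sub>1\<^sup>2 * integral {1..T} (\<lambda>t. integral {t..t+1} (\<lambda>s. (e0 s)\<^sup>2)) + \<theta> * integral {1..T} (\<lambda>t. ?q t * A 1 (t+1))"
    by (rule integral_unique)
      (intro has_integral_add has_integral_mult_right integrable_integral absolutely_integrable_integrable[OF WA(1)]
          absolutely_integrable_integrable[OF We(1)] e02s qA)
  also have "\<dots> \<le> 1/2 * A 1 (T+1) + 5 * V 1 + 5 * \<kappa>\<^sub>1\<^sup>2 * V 1 + \<theta> * integral {1..T} (\<lambda>t. ?q t * A 1 (t+1))"
  proof (intro add_mono order_refl)
    show "?c * integral {1..T} (\<lambda>t. A t (t+1)) \<le> 1/2 * A 1 (T+1)"
      using WA(2) eps_small A_nonneg
      by (intro mult_mono integral_nonneg absolutely_integrable_integrable[OF WA(1)]) auto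
    have "integral {1..T} (\<lambda>t. (e0 (1 + t))\<^sup>2) = integral {1+1..T+1} (\<lambda>t. (e0 t)\<^sup>2)"
      by (rule integral_shift_left)
    also have "\<dots> \<le> integral {1..T+1} (\<lambda>t. (e0 t)\<^sup>2)"
      by (intro integral_subset_le absolutely_integrable_integrable[OF e02]
        absolutely_integrable_integrable[OF absolutely_integrable_on_subinterval[OF e02]]) auto
    also have "\<dots> \<le> V 1" by (rule V_consequences(1)) (use T in auto)
    finally show "5 * integral {1..T} (\<lambda>t. (e0 (1 + t))\<^sup>2) \<le> 5 * V 1" by simp
    have "integral {1..T} (\<lambda>t. integral {t..t+1} (\<lambda>s. (e0 s)\<^sup>2)) \<le> V 1"
      using We(2) V_consequences(1)[of "T+1"] T by linarith
    then show "5 * \<kappa>\<^sub>1\<^sup>2 * integral {1..T} (\<lambda>t. integral {t..t+1} (\<lambda>s. (e0 s)\<^sup>2)) \<le> 5 * \<kappa>\<^sub>1\<^sup>2 * V 1"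
      by (intro mult_left_mono) auto
  qed
  finally have *: "A 2 (T+1) \<le> \<dots>" .
  have sp: "A 1 2 + A 2 (T+1) = A 1 (T+1)" using T by (intro A_split) auto
  have eq: "integral {1..T} (\<lambda>t. (2 * \<theta> * ?q t) * A 1 (t+1)) = 2 * (\<theta> * integral {1..T} (\<lambda>t. ?q t * A 1 (t+1)))"
    by (simp add: mult.assoc)
  show ?thesis
    using * sp unfolding eq by (simp add: algebra_simps)
qed

lemma trace_energy_bound:
  assumes T: "1 \<le> T"
  shows "A 1 (T+1) \<le> (2 * A 1 2 + 10 * (1 + \<kappa>\<^sub>1\<^sup>2) * V 1) * exp (1 + 4 * \<theta> * (V 1 / \<gamma>\<^sub>0))"
proof -
  let ?q = "\<lambda>t. 2 * \<theta> * (lam t + \<Phi> t 1)"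
  let ?c = "2 * A 1 2 + 10 * (1 + \<kappa>\<^sub>1\<^sup>2) * V 1"
  have c0: "0 \<le> ?c" using A_nonneg[of 1 2] V_nonneg[of 1] by (intro add_nonneg_nonneg mult_nonneg_nonneg) auto
  have qi: "?q absolutely_integrable_on {1..T}"
    by (intro set_integrable_mult_right q_integral T)
  have Ac: "continuous_on {1..T} (\<lambda>t. A 1 (t+1))"
    by (rule continuous_on_compose2[OF A_cont[of 1 "T+1"]]) (auto intro!: continuous_intros)
  have "A 1 (T+1) \<le> ?c * exp (1 + 2 * integral {1..T} ?q)"
  proof (rule gronwall_integral[where a = 1 and b = T and f = "\<lambda>t. A 1 (t+1)" and q = ?q and c = ?c, OF T])
    show "(\<lambda>t. ?q t * A 1 (t+1)) integrable_on {1..T}"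
      using absolutely_integrable_continuous_mult[OF Ac qi]
      by (auto simp: mult.commute dest: absolutely_integrable_integrable)
    show "A 1 (t+1) \<le> ?c + integral {1..t} (\<lambda>t. ?q t * A 1 (t+1))" if "t \<in> {1..T}" for t
      using trace_gronwall_inequality[of t] that by auto
    show "0 \<le> ?q s" if "s \<in> {1..T}" for s
      using that q_nonneg[of s] theta_nonneg by (intro mult_nonneg_nonneg) auto
    show "?q integrable_on {1..T}" using qi by (rule absolutely_integrable_integrable)
    show "0 \<le> ?c" by (rule c0)
  qed (auto intro: A_mono A_nonneg)
  also have "\<dots> \<le> ?c * exp (1 + 4 * \<theta> * (V 1 / \<gamma>\<^sub>0))"
  proof -
    have "integral {1..T} ?q = 2 * \<theta> * integral {1..T} (\<lambda>t. lam t + \<Phi> t 1)" by simp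
    also have "\<dots> \<le> 2 * \<theta> * (V 1 / \<gamma>\<^sub>0)"
      using q_integral(2)[OF T] theta_nonneg by (intro mult_left_mono) auto
    finally show ?thesis using c0 by (intro mult_left_mono) auto
  qed
  finally show ?thesis .
qed

end

section \<open>The initial time window\<close>

lemma square_integrable_add:
  assumes f: "f square_integrable_on {a..b::real}" and g: "g square_integrable_on {a..b}"
  shows "(\<lambda>x. f x + g x) square_integrable_on {a..b}"
proof (rule absolutely_integrable_imp_square_integrable)
  note sf = square_integrable_imp_absolutely_integrable[OF f] and sg = square_integrable_imp_absolutely_integrable[OF g]
  show "(\<lambda>x. f x + g x) absolutely_integrable_on {a..b}" using sf(1) sg(1) by (rule set_integral_add(1))
  have "(\<lambda>x. f x * g x) absolutely_integrable_on {a..b}" by (rule cauchy_schwarz_integral(1)[OF _ f g]) simp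
  then have "(\<lambda>x. (f x)\<^sup>2 + (g x)\<^sup>2 + 2 * (f x * g x)) integrable_on {a..b}"
    by (intro integrable_add integrable_on_mult_right absolutely_integrable_integrable sf(2) sg(2))
  then show "(\<lambda>x. (f x + g x)\<^sup>2) integrable_on {a..b}"
    by (simp add: power2_sum algebra_simps)
qed

lemma square_integrable_abs:
  assumes f: "f square_integrable_on {a..b::real}"
  shows "(\<lambda>x. \<bar>f x\<bar>) square_integrable_on {a..b}"
  using square_integrable_imp_absolutely_integrable(1,2)[OF f]
  by (intro absolutely_integrable_imp_square_integrable set_integrable_abs) (auto intro: absolutely_integrable_integrable)

lemma square_integrable_const: "(\<lambda>x. c) square_integrable_on {a..b::real}"
  by (intro absolutely_integrable_imp_square_integrable absolutely_integrable_continuous_real integrable_continuous_interval) auto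

text \<open>Extension by zero to the right of \<open>1\<close>: the contribution of the initial data is carried by the
  characteristics with \<open>x + t \<le> 1\<close> only.\<close>

definition cut :: "(real \<Rightarrow> real) \<Rightarrow> real \<Rightarrow> real" where
  "cut f z = (if z \<le> 1 then f z else 0)"

lemma cut_square_integrable:
  assumes f: "f square_integrable_on {0..1}" and a: "0 \<le> a"
  shows "cut f square_integrable_on {a..b}"
    and "integral {a..b} (\<lambda>z. (cut f z)\<^sup>2) \<le> integral {0..1} (\<lambda>z. (f z)\<^sup>2)"
    and "integral {a..b} (\<lambda>z. \<bar>cut f z\<bar>) \<le> integral {0..1} (\<lambda>z. \<bar>f z\<bar>)"
proof -
  note sf = square_integrable_imp_absolutely_integrable[OF f]
  have cutI: "(\<lambda>z. if z \<in> {..1} then g z else 0) absolutely_integrable_on {a..b}"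
    if g: "g absolutely_integrable_on {0..1}" for g :: "real \<Rightarrow> real"
  proof -
    have "(\<lambda>z. g z) absolutely_integrable_on ({..1} \<inter> {a..b})"
      using a by (intro set_integrable_subset[OF g]) auto
    moreover have "(\<lambda>z. indicat_real {a..b} z *\<^sub>R (if z \<in> {..1} then g z else 0)) =
        (\<lambda>z. indicat_real ({..1} \<inter> {a..b}) z *\<^sub>R g z)"
      by (auto simp: fun_eq_iff split: split_indicator)
    ultimately show ?thesis by (simp add: set_integrable_def)
  qed
  have c1: "cut f absolutely_integrable_on {a..b}"
    using cutI[OF sf(1)] by (simp add: cut_def[abs_def])
  have sq_eq: "(\<lambda>z. (cut f z)\<^sup>2) = (\<lambda>z. if z \<in> {..1} then (f z)\<^sup>2 else 0)"
    and abs_eq: "(\<lambda>z. \<bar>cut f z\<bar>) = (\<lambda>z. if z \<in> {..1} then \<bar>f z\<bar> else 0)"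
    by (auto simp: cut_def fun_eq_iff)
  show "cut f square_integrable_on {a..b}"
    using c1 cutI[OF sf(2)] unfolding sq_eq[symmetric]
    by (intro absolutely_integrable_imp_square_integrable) (auto intro: absolutely_integrable_integrable)
  have sub: "integral {a..b} (\<lambda>z. if z \<in> {..1} then g z else 0) \<le> integral {0..1} g"
    if g: "g absolutely_integrable_on {0..1}" "\<And>z. 0 \<le> g z" for g :: "real \<Rightarrow> real"
  proof -
    have "integral {a..b} (\<lambda>z. if z \<in> {..1} then g z else 0) = integral ({..1} \<inter> {a..b}) g"
      by (rule Henstock_Kurzweil_Integration.integral_restrict_Int)
    also have "{..1} \<inter> {a..b} = {a..min 1 b}" by auto
    also have "integral {a..min 1 b} g \<le> integral {0..1} g"
      using a g(2) by (intro integral_subset_le absolutely_integrable_integrable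
          absolutely_integrable_on_subinterval[OF g(1)]) auto
    finally show ?thesis .
  qed
  show "integral {a..b} (\<lambda>z. (cut f z)\<^sup>2) \<le> integral {0..1} (\<lambda>z. (f z)\<^sup>2)"
    unfolding sq_eq by (rule sub[OF sf(2)]) auto
  show "integral {a..b} (\<lambda>z. \<bar>cut f z\<bar>) \<le> integral {0..1} (\<lambda>z. \<bar>f z\<bar>)"
    unfolding abs_eq by (rule sub[OF set_integrable_abs[OF sf(1)]]) auto
qed

lemma integral_plus_const:
  fixes f :: "real \<Rightarrow> real"
  assumes "f integrable_on {a..b}" "a \<le> b"
  shows "integral {a..b} (\<lambda>x. f x + c) = integral {a..b} f + (b - a) * c"
  using integral_add[OF assms(1) integrable_const_ivl[of c a b]] assms(2) by simp

text \<open>Keeps the initial value of the Lyapunov function linear in \<open>S(0)\<close>, which makes the exponent of the final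
  estimate linear as well.\<close>

lemma le_linear_from_quadratic:
  fixes x s :: real
  assumes "x \<le> a * s + b * s\<^sup>2" "x \<le> c" "0 \<le> s" "0 \<le> a" "0 \<le> b" "0 \<le> c"
  shows "x \<le> (a + b + c) * s"
proof (cases "s \<le> 1")
  case True
  have "b * s\<^sup>2 \<le> b * s" using True assms by (intro mult_left_mono) (auto simp: power2_eq_square mult_left_le)
  moreover have "0 \<le> c * s" using assms by simp
  ultimately show ?thesis using assms(1) unfolding distrib_right by linarith
next
  case False
  have "c \<le> c * s" using False assms mult_left_mono[of 1 s c] by simp
  moreover have "0 \<le> a * s" "0 \<le> b * s" using assms by auto
  ultimately show ?thesis using assms(2) unfolding distrib_right by linarith
qed

section \<open>Constants and estimates for the first two time units\<close>

context control_setting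
begin

text \<open>\<open>C1\<close> is the Gronwall rate for the trace on [0,2]; \<open>C2\<close> and
  \<open>C3\<close> bound its integral by a multiple of the root of \<open>S0\<close> and its energy
  by a multiple of \<open>S0\<close>. \<open>C4\<close> bounds the drift of the estimate on [0,1],
  \<open>C5\<close> the energy of \<open>bt\<close> there, and \<open>C6\<close> the Lyapunov
  function at time 1.\<close>

definition C1 where "C1 = \<kappa>\<^sub>1 * (1 + 5 * B) + B"
definition C2 where "C2 = (1 + 4 * \<kappa>\<^sub>1) * exp (1 + 4 * C1)"
definition C3 where "C3 = 2 + 2 * (2 * \<kappa>\<^sub>1 + C1 * C2)\<^sup>2 * 2"
definition C4 where "C4 = \<gamma> * (sqrt (4 * C3) + 4 * B * C2\<^sup>2)"
definition C5 where "C5 = 2 + 2 * C4\<^sup>2 + 4 * B\<^sup>2"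
definition C6 where "C6 = 16 * B\<^sup>2 * C2\<^sup>2 + C5 / \<gamma>"

lemma C_nonneg: "0 \<le> C1" "0 \<le> C2" "0 \<le> C3" "0 \<le> C4" "0 \<le> C5" "0 \<le> C6"
proof -
  show 1: "0 \<le> C1" using kappa_nonneg B by (auto simp: C1_def)
  show 2: "0 \<le> C2" using kappa_nonneg by (auto simp: C2_def)
  show 3: "0 \<le> C3" by (simp add: C3_def)
  show 4: "0 \<le> C4" using B gam 3 by (auto simp: C4_def)
  show 5: "0 \<le> C5" by (simp add: C5_def)
  show "0 \<le> C6" using 5 gam by (simp add: C6_def)
qed

end

context closed_loop
begin

definition S0 where "S0 = S_fun \<beta> u uh bh 0"
definition h1 where "h1 = integral {0..1} (\<lambda>x. \<bar>e x 0\<bar>)"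

lemma l2_sq: "(l2_norm a)\<^sup>2 = integral {0..1} (\<lambda>x. (a x)\<^sup>2)"
  unfolding l2_norm_def by (simp add: integral_square_nonneg)

lemma S_eq: "S_fun \<beta> u uh bh t = integral {0..1} (\<lambda>x. (u x t)\<^sup>2) + integral {0..1} (\<lambda>x. (uh x t)\<^sup>2)
   + integral {0..1} (\<lambda>x. (bt x t)\<^sup>2)"
  by (simp add: S_fun_def l2_sq bt_def)

lemma S0_bounds:
  "0 \<le> S0" "integral {0..1} (\<lambda>x. (u x 0)\<^sup>2) \<le> S0" "integral {0..1} (\<lambda>x. (uh x 0)\<^sup>2) \<le> S0"
  "integral {0..1} (\<lambda>x. (bt x 0)\<^sup>2) \<le> S0"
  unfolding S0_def S_eq
  using integral_square_nonneg[of "{0..1}" "\<lambda>x. u x 0"] integral_square_nonneg[of "{0..1}" "\<lambda>x. uh x 0"]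
    integral_square_nonneg[of "{0..1}" "\<lambda>x. bt x 0"] by linarith+

lemma e_initial: "integral {0..1} (\<lambda>x. (e x 0)\<^sup>2) \<le> 4 * S0"
proof -
  have i: "(\<lambda>x. (u x 0)\<^sup>2) integrable_on {0..1}" "(\<lambda>x. (uh x 0)\<^sup>2) integrable_on {0..1}" "(\<lambda>x. (e x 0)\<^sup>2) integrable_on {0..1}"
    using u_sq[of 0] uh_sq[of 0] e_sq[of 0] by (auto simp: square_integrable_on_def)
  have "integral {0..1} (\<lambda>x. (e x 0)\<^sup>2) \<le> integral {0..1} (\<lambda>x. 2 * (u x 0)\<^sup>2 + 2 * (uh x 0)\<^sup>2)"
  proof (rule integral_le)
    show "(\<lambda>x. 2 * (u x 0)\<^sup>2 + 2 * (uh x 0)\<^sup>2) integrable_on {0..1}"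
      by (intro integrable_add integrable_on_mult_right i)
    show "(e x 0)\<^sup>2 \<le> 2 * (u x 0)\<^sup>2 + 2 * (uh x 0)\<^sup>2" for x
      using sum2_square_le[of "u x 0" "- uh x 0"] by (simp add: e_def)
  qed (rule i)
  also have "\<dots> = 2 * integral {0..1} (\<lambda>x. (u x 0)\<^sup>2) + 2 * integral {0..1} (\<lambda>x. (uh x 0)\<^sup>2)"
    using integral_add[OF integrable_on_mult_right[OF i(1), of 2] integrable_on_mult_right[OF i(2), of 2]] by simp
  finally show ?thesis using S0_bounds by linarith
qed

lemma h1_bound: "0 \<le> h1" "h1 \<le> 2 * sqrt S0" "h1\<^sup>2 \<le> 4 * S0"
proof -
  show "0 \<le> h1" unfolding h1_def
    by (intro integral_nonneg absolutely_integrable_integrable set_integrable_abs e_ai) auto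
  show h: "h1\<^sup>2 \<le> 4 * S0"
    using square_integrable_imp_absolutely_integrable(3)[OF e_sq[of 0]] e_initial unfolding h1_def by simp
  then have "h1 \<le> sqrt (4 * S0)" by (rule real_le_rsqrt)
  then show "h1 \<le> 2 * sqrt S0" by (simp add: real_sqrt_mult)
qed

lemma e_pointwise:
  assumes "x \<in> {0..1}" "t \<ge> 0"
  shows "\<bar>e x t\<bar> \<le> \<bar>cut (\<lambda>z. e z 0) (x + t)\<bar> + 4 * B * N (max 0 (t - 1)) t"
proof (cases "x + t \<le> 1")
  case True
  then have "max 0 (t - 1) = 0" using assms by auto
  then show ?thesis using e_bound_left[OF assms True] True by (simp add: cut_def)
next
  case False
  have "\<bar>e x t\<bar> \<le> 4 * B * N (x + t - 1) t" using e_bound_right[OF assms] False by auto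
  also have "\<dots> \<le> 4 * B * N (max 0 (t - 1)) t"
    using B False assms by (intro mult_left_mono N_mono) auto
  finally show ?thesis using False by (simp add: cut_def)
qed

lemma u_char_bound:
  assumes "0 \<le> \<xi>" "max 0 (\<xi> - 1) \<le> a" "a \<le> b" "b \<le> \<xi>"
  shows "\<bar>u (\<xi> - b) b - u (\<xi> - a) a\<bar> \<le> B * N a b"
proof -
  have "\<bar>integral {a..b} (\<lambda>s. \<beta> (\<xi> - s) * v s)\<bar> \<le> integral {a..b} (\<lambda>s. B * \<bar>v s\<bar>)"
  proof (rule integral_abs_bound_integral)
    show "(\<lambda>s. \<beta> (\<xi> - s) * v s) integrable_on {a..b}"
      by (rule absolutely_integrable_integrable[OF u_char(2)[OF assms]])
    show "(\<lambda>s. B * \<bar>v s\<bar>) integrable_on {a..b}"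
      using assms by (intro integrable_on_mult_right av_int) auto
    show "\<bar>\<beta> (\<xi> - s) * v s\<bar> \<le> B * \<bar>v s\<bar>" if "s \<in> {a..b}" for s
      unfolding abs_mult using that assms by (intro mult_right_mono beta_bound) auto
  qed
  then show ?thesis unfolding u_char(1)[OF assms] by (simp add: N_def)
qed

text \<open>Characteristics are followed forwards to x = 0. This expresses the state through future
  values of the trace and avoids any reference to initial data or control.\<close>

lemma u_to_trace:
  assumes "x \<in> {0..1}" "t \<ge> 0"
  shows "\<bar>u x t\<bar> \<le> \<bar>v (x + t)\<bar> + B * N t (t + x)"
    and "\<bar>v (x + t)\<bar> \<le> \<bar>u x t\<bar> + B * N t (t + x)"
proof -
  have "\<bar>v (x + t) - u x t\<bar> \<le> B * N t (t + x)"
    using u_char_bound[of "t + x" t "t + x"] assms by (simp add: v_def add.commute)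
  then show "\<bar>u x t\<bar> \<le> \<bar>v (x + t)\<bar> + B * N t (t + x)" "\<bar>v (x + t)\<bar> \<le> \<bar>u x t\<bar> + B * N t (t + x)"
    by linarith+
qed

lemma u_from_boundary:
  assumes "x \<in> {0..1}" "t \<ge> 0" "x + t \<ge> 1"
  shows "\<bar>u x t\<bar> \<le> \<bar>U (x + t - 1)\<bar> + B * N (x + t - 1) t"
  using u_char_bound[of "x + t" "x + t - 1" t] assms u_right[of "x + t - 1"] by auto

lemma u_from_initial:
  assumes "x \<in> {0..1}" "t \<ge> 0" "x + t \<le> 1"
  shows "\<bar>u x t\<bar> \<le> \<bar>u (x + t) 0\<bar> + B * N 0 t"
  using u_char_bound[of "x + t" 0 t] assms by auto

text \<open>The share of the initial error in the control: at times from 1 on, at most one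
  characteristic issuing from the initial data still meets the strip, a null set under the
  integral.\<close>

definition hcut where "hcut t = (if t < 1 then h1 else 0)"

lemma hcut_bounds: "0 \<le> hcut t" "hcut t \<le> h1"
  using h1_bound by (auto simp: hcut_def)

text \<open>Writing \<open>uh\<close> as u - e, the first term is bounded by the trace one unit
  ahead and the second by the trace one unit back plus the initial error. The coefficient 5 B is B
  from the former and 4 B from the latter.\<close>

lemma U_trace_bound:
  assumes t: "t \<ge> 0"
  shows "\<bar>U t\<bar> \<le> \<kappa>\<^sub>1 * ((1 + 5 * B) * N (max 0 (t - 1)) (t + 1) + hcut t)"
proof -
  let ?n = "N (max 0 (t - 1)) (t + 1)"
  have n: "N t (t + 1) \<le> ?n" "N (max 0 (t - 1)) t \<le> ?n" using t by (auto intro!: N_mono)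
  have cs: "(\<lambda>y. cut (\<lambda>z. e z 0) (t + y)) absolutely_integrable_on {0..1}"
    using square_integrable_imp_absolutely_integrable(1)[OF cut_square_integrable(1)[OF e_sq[of 0], of t "t+1"]] t
    by (subst absolutely_integrable_shift_left) (simp add: add.commute)
  have vs: "(\<lambda>y. v (t + y)) absolutely_integrable_on {0..1}"
    using t v_ai[of t "t+1"] by (subst absolutely_integrable_shift_left) (simp add: add.commute)
  have ab: "(\<lambda>y. \<bar>g y\<bar>) integrable_on {0..1}" if "g absolutely_integrable_on {0..1}" for g :: "real \<Rightarrow> real"
    using set_integrable_abs[OF that] by (rule absolutely_integrable_integrable)
  have "integral {0..1} (\<lambda>y. \<bar>uh y t\<bar>) \<le>
      integral {0..1} (\<lambda>y. \<bar>v (t + y)\<bar> + \<bar>cut (\<lambda>z. e z 0) (t + y)\<bar> + 5 * B * ?n)"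
  proof (rule integral_le)
    show "(\<lambda>y. \<bar>uh y t\<bar>) integrable_on {0..1}" using t by (intro ab uh_ai)
    show "(\<lambda>y. \<bar>v (t + y)\<bar> + \<bar>cut (\<lambda>z. e z 0) (t + y)\<bar> + 5 * B * ?n) integrable_on {0..1}"
      by (intro integrable_add ab cs vs) auto
    fix y :: real assume y: "y \<in> {0..1}"
    have "\<bar>uh y t\<bar> \<le> \<bar>u y t\<bar> + \<bar>e y t\<bar>" by (simp add: e_def)
    moreover have "B * N t (t + y) \<le> B * ?n" using B y t by (intro mult_left_mono N_mono) auto
    moreover have "B * N (max 0 (t - 1)) t \<le> B * ?n" using B n by (intro mult_left_mono) auto
    ultimately show "\<bar>uh y t\<bar> \<le> \<bar>v (t + y)\<bar> + \<bar>cut (\<lambda>z. e z 0) (t + y)\<bar> + 5 * B * ?n"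
      using u_to_trace(1)[OF y t] e_pointwise[OF y t] by (simp add: add.commute)
  qed
  also have "\<dots> = integral {0..1} (\<lambda>y. \<bar>v (t + y)\<bar>) + integral {0..1} (\<lambda>y. \<bar>cut (\<lambda>z. e z 0) (t + y)\<bar>) + 5 * B * ?n"
    using integral_plus_const[OF integrable_add[OF ab[OF vs] ab[OF cs]], of "5 * B * ?n"]
      integral_add[OF ab[OF vs] ab[OF cs]] by simp
  also have "integral {0..1} (\<lambda>y. \<bar>v (t + y)\<bar>) = N t (t + 1)"
    using integral_shift_left[of 0 1 "\<lambda>s. \<bar>v s\<bar>" t] by (simp add: N_def add.commute)
  also have "integral {0..1} (\<lambda>y. \<bar>cut (\<lambda>z. e z 0) (t + y)\<bar>) = integral {t..t+1} (\<lambda>z. \<bar>cut (\<lambda>z. e z 0) z\<bar>)"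
    using integral_shift_left[of 0 1 "\<lambda>s. \<bar>cut (\<lambda>z. e z 0) s\<bar>" t] by (simp add: add.commute)
  also have "\<dots> \<le> hcut t"
  proof (cases "t < 1")
    case True
    then show ?thesis using cut_square_integrable(3)[OF e_sq[of 0] t] by (simp add: hcut_def h1_def)
  next
    case False
    have "integral {t..t+1} (\<lambda>z. \<bar>cut (\<lambda>z. e z 0) z\<bar>) = integral {t..t+1} (\<lambda>_. 0)"
      by (rule integral_spike[of "{1}"]) (use False in \<open>auto simp: cut_def\<close>)
    then show ?thesis using False by (simp add: hcut_def)
  qed
  finally have "integral {0..1} (\<lambda>y. \<bar>uh y t\<bar>) \<le> (1 + 5 * B) * ?n + hcut t"
    using n by (simp add: algebra_simps)
  from mult_left_mono[OF this kappa_nonneg(2)] U_bound[OF t] show ?thesis by linarith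
qed

text \<open>Up to time 1 the trace comes from the initial data, afterwards from the control one unit
  earlier. The control looks one unit ahead, which is exactly up to \<open>r\<close>, so the bound
  involves the trace only until the present time and Gronwall applies.\<close>

lemma v_early_bound:
  assumes r: "r \<in> {0..2}"
  shows "\<bar>v r\<bar> \<le> \<bar>cut (\<lambda>z. u z 0) r\<bar> + \<kappa>\<^sub>1 * h1 + C1 * N 0 r"
proof (cases "r \<le> 1")
  case True
  have "\<bar>v r\<bar> \<le> \<bar>u r 0\<bar> + B * N 0 r" using u_to_trace(2)[of r 0] True r by auto
  moreover have "0 \<le> \<kappa>\<^sub>1 * h1" using kappa_nonneg h1_bound by auto
  moreover have "B * N 0 r \<le> C1 * N 0 r"
    using kappa_nonneg B N_nonneg[of 0 r] by (intro mult_right_mono) (auto simp: C1_def)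
  ultimately show ?thesis using True by (simp add: cut_def)
next
  case False
  define t where "t = r - 1"
  have t: "0 \<le> t" "r = 1 + t" "t \<le> 1" using False r by (auto simp: t_def)
  have "\<bar>v r\<bar> \<le> \<bar>U t\<bar> + B * N t (t + 1)" using u_to_trace(2)[of 1 t] t u_right[of t] by auto
  also have "\<bar>U t\<bar> \<le> \<kappa>\<^sub>1 * ((1 + 5 * B) * N 0 r + h1)"
  proof -
    have "max 0 (t - 1) = 0" using t by auto
    then have "\<bar>U t\<bar> \<le> \<kappa>\<^sub>1 * ((1 + 5 * B) * N 0 r + hcut t)"
      using U_trace_bound[OF t(1)] t by (simp add: add.commute)
    also have "\<dots> \<le> \<kappa>\<^sub>1 * ((1 + 5 * B) * N 0 r + h1)"
      using hcut_bounds kappa_nonneg by (intro mult_left_mono) auto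
    finally show ?thesis .
  qed
  also have "B * N t (t + 1) \<le> B * N 0 r" using B t by (intro mult_left_mono N_mono) auto
  finally show ?thesis using False by (simp add: cut_def C1_def algebra_simps)
qed

lemma N_early: "N 0 2 \<le> C2 * sqrt S0"
proof -
  let ?c = "integral {0..1} (\<lambda>x. \<bar>u x 0\<bar>) + 2 * (\<kappa>\<^sub>1 * h1)"
  note u0 = cut_square_integrable[OF u_sq[of 0], of 0, simplified]
  have u1: "integral {0..1} (\<lambda>x. \<bar>u x 0\<bar>) \<le> sqrt S0" "0 \<le> integral {0..1} (\<lambda>x. \<bar>u x 0\<bar>)"
  proof -
    have "(integral {0..1} (\<lambda>x. \<bar>u x 0\<bar>))\<^sup>2 \<le> S0"
      using square_integrable_imp_absolutely_integrable(3)[OF u_sq[of 0]] S0_bounds(2) by simp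
    then show "integral {0..1} (\<lambda>x. \<bar>u x 0\<bar>) \<le> sqrt S0" by (rule real_le_rsqrt)
    show "0 \<le> integral {0..1} (\<lambda>x. \<bar>u x 0\<bar>)"
      by (intro integral_nonneg absolutely_integrable_integrable set_integrable_abs u_ai) auto
  qed
  have kh: "0 \<le> \<kappa>\<^sub>1 * h1" using kappa_nonneg h1_bound by auto
  have Ni: "(\<lambda>s. C1 * N 0 s) integrable_on {0..t}" for t
    by (intro integrable_on_mult_right integrable_continuous_interval N_cont) auto
  have ci: "(\<lambda>z. \<bar>cut (\<lambda>z. u z 0) z\<bar>) integrable_on {0..t}" for t
    using square_integrable_imp_absolutely_integrable(1)[OF u0(1)]
    by (intro absolutely_integrable_integrable set_integrable_abs)
  have "N 0 2 \<le> ?c * exp (1 + 2 * integral {0..2} (\<lambda>_::real. C1))"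
  proof (rule gronwall_integral[where a = 0 and b = 2 and f = "N 0" and q = "\<lambda>_. C1" and c = ?c])
    show "(\<lambda>s. C1 * N 0 s) integrable_on {0..2}" by (rule Ni)
    show "0 \<le> ?c" using u1 kh by auto
    fix t :: real assume t: "t \<in> {0..2}"
    have "N 0 t \<le> integral {0..t} (\<lambda>r. \<bar>cut (\<lambda>z. u z 0) r\<bar> + \<kappa>\<^sub>1 * h1 + C1 * N 0 r)"
      unfolding N_def[of 0 t]
    proof (rule integral_le)
      show "(\<lambda>r. \<bar>cut (\<lambda>z. u z 0) r\<bar> + \<kappa>\<^sub>1 * h1 + C1 * N 0 r) integrable_on {0..t}"
        by (intro integrable_add ci Ni) auto
    qed (use t v_early_bound in \<open>auto intro: av_int\<close>)
    also have "\<dots> = integral {0..t} (\<lambda>r. \<bar>cut (\<lambda>z. u z 0) r\<bar>) + t * (\<kappa>\<^sub>1 * h1) + integral {0..t} (\<lambda>r. C1 * N 0 r)"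
    proof -
      have pc: "integral {0..t} (\<lambda>r. \<bar>cut (\<lambda>z. u z 0) r\<bar> + \<kappa>\<^sub>1 * h1) =
          integral {0..t} (\<lambda>r. \<bar>cut (\<lambda>z. u z 0) r\<bar>) + (t - 0) * (\<kappa>\<^sub>1 * h1)"
        by (rule integral_plus_const[OF ci]) (use t in auto)
      have "integral {0..t} (\<lambda>r. \<bar>cut (\<lambda>z. u z 0) r\<bar> + \<kappa>\<^sub>1 * h1 + C1 * N 0 r) =
          integral {0..t} (\<lambda>r. \<bar>cut (\<lambda>z. u z 0) r\<bar> + \<kappa>\<^sub>1 * h1) + integral {0..t} (\<lambda>r. C1 * N 0 r)"
        by (intro integral_add integrable_add ci Ni integrable_const_ivl)
      then show ?thesis unfolding pc by simp
    qed
    also have "\<dots> \<le> integral {0..1} (\<lambda>x. \<bar>u x 0\<bar>) + 2 * (\<kappa>\<^sub>1 * h1) + integral {0..t} (\<lambda>r. C1 * N 0 r)"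
      using u0(3)[of t] t kh by (intro add_mono mult_right_mono) auto
    finally show "N 0 t \<le> ?c + integral {0..t} (\<lambda>s. C1 * N 0 s)" .
  qed (use C_nonneg in \<open>auto intro: N_mono N_nonneg\<close>)
  also have "\<dots> = ?c * exp (1 + 4 * C1)" by simp
  also have "\<dots> \<le> ((1 + 4 * \<kappa>\<^sub>1) * sqrt S0) * exp (1 + 4 * C1)"
  proof (rule mult_right_mono)
    have "\<kappa>\<^sub>1 * h1 \<le> \<kappa>\<^sub>1 * (2 * sqrt S0)" using kappa_nonneg h1_bound by (intro mult_left_mono) auto
    then show "?c \<le> (1 + 4 * \<kappa>\<^sub>1) * sqrt S0" using u1 by (simp add: algebra_simps)
  qed auto
  finally show ?thesis by (simp add: C2_def mult_ac)
qed

lemma A_early: "A 0 2 \<le> C3 * S0"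
proof -
  let ?m = "(2 * \<kappa>\<^sub>1 + C1 * C2) * sqrt S0"
  note u0 = cut_square_integrable[OF u_sq[of 0], of 0 2, simplified]
  have ci: "(\<lambda>z. (cut (\<lambda>z. u z 0) z)\<^sup>2) integrable_on {0..2}"
    using u0(1) by (simp add: square_integrable_on_def)
  have "A 0 2 \<le> integral {0..2} (\<lambda>r. 2 * (cut (\<lambda>z. u z 0) r)\<^sup>2 + 2 * ?m\<^sup>2)"
    unfolding A_def
  proof (rule integral_le)
    show "(\<lambda>r. 2 * (cut (\<lambda>z. u z 0) r)\<^sup>2 + 2 * ?m\<^sup>2) integrable_on {0..2}"
      by (intro integrable_add integrable_on_mult_right ci) auto
    fix r :: real assume r: "r \<in> {0..2}"
    have "\<kappa>\<^sub>1 * h1 \<le> \<kappa>\<^sub>1 * (2 * sqrt S0)" using kappa_nonneg h1_bound by (intro mult_left_mono) auto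
    moreover have "C1 * N 0 r \<le> C1 * (C2 * sqrt S0)"
      using N_early N_mono[of 0 0 r 2] r C_nonneg by (intro mult_left_mono) auto
    ultimately have "\<bar>v r\<bar> \<le> \<bar>cut (\<lambda>z. u z 0) r\<bar> + ?m"
      using v_early_bound[OF r] by (simp add: algebra_simps)
    then have "(v r)\<^sup>2 \<le> (\<bar>cut (\<lambda>z. u z 0) r\<bar> + ?m)\<^sup>2" by (rule abs_le_square)
    also have "\<dots> \<le> 2 * (\<bar>cut (\<lambda>z. u z 0) r\<bar>\<^sup>2 + ?m\<^sup>2)" by (rule sum2_square_le)
    finally show "(v r)\<^sup>2 \<le> 2 * (cut (\<lambda>z. u z 0) r)\<^sup>2 + 2 * ?m\<^sup>2" by simp
  qed (auto intro: v2_int)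
  also have "\<dots> = 2 * integral {0..2} (\<lambda>r. (cut (\<lambda>z. u z 0) r)\<^sup>2) + 4 * ?m\<^sup>2"
    using integral_plus_const[OF integrable_on_mult_right[OF ci, of 2], of "2 * ?m\<^sup>2"] by simp
  also have "\<dots> \<le> 2 * S0 + 4 * ?m\<^sup>2" using u0(2) S0_bounds by auto
  also have "\<dots> = C3 * S0"
    unfolding C3_def power_mult_distrib real_sqrt_pow2[OF S0_bounds(1)] by (simp add: distrib_right)
  finally show ?thesis .
qed

text \<open>The drift of the estimate is an integral of e times v, both of the order of the root of
  \<open>S0\<close>, so its square is quadratic in \<open>S0\<close>; the projection bounds the same
  energy by a constant. The two bounds together give a linear one.\<close>

lemma bt_early:
  assumes t: "t \<in> {0..1}"
  shows "integral {0..1} (\<lambda>x. (bt x t)\<^sup>2) \<le> C5 * S0"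
proof -
  have sqS: "(sqrt S0)\<^sup>2 = S0" using S0_bounds(1) by simp
  have pw: "\<bar>bt x t\<bar> \<le> \<bar>bt x 0\<bar> + C4 * S0" if x: "x \<in> {0..1}" for x
  proof -
    \<comment> \<open>The initial error that passes the point \<open>x\<close> before time 1. It is
      only square integrable in \<open>r\<close>, so its product with \<open>v\<close> is handled by
      Cauchy-Schwarz.\<close>
    define c where "c r = \<bar>cut (\<lambda>z. e z 0) (x + r)\<bar>" for r
    have cs: "c square_integrable_on {0..t}"
      unfolding c_def using x cut_square_integrable(1)[OF e_sq[of 0], of "0+x" "t+x"]
      by (intro square_integrable_abs, subst square_integrable_shift_left) auto
    have vs: "v square_integrable_on {0..t}" by (rule v_sq) simp
    note cv = cauchy_schwarz_integral[OF _ cs vs]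
    have acv: "(\<lambda>r. \<bar>c r * v r\<bar>) integrable_on {0..t}"
      using set_integrable_abs[OF cv(1)] by (auto intro: absolutely_integrable_integrable)
    have c2: "integral {0..t} (\<lambda>r. (c r)\<^sup>2) \<le> 4 * S0"
    proof -
      have "integral {0..t} (\<lambda>r. (c r)\<^sup>2) = integral {0+x..t+x} (\<lambda>z. (cut (\<lambda>z. e z 0) z)\<^sup>2)"
        using integral_shift_left[of 0 t "\<lambda>z. (cut (\<lambda>z. e z 0) z)\<^sup>2" x] by (simp add: c_def)
      also have "\<dots> \<le> integral {0..1} (\<lambda>x. (e x 0)\<^sup>2)"
        by (rule cut_square_integrable(2)[OF e_sq]) (use x in auto)
      also note e_initial
      finally show ?thesis .
    qed
    have "(integral {0..t} (\<lambda>r. \<bar>c r * v r\<bar>))\<^sup>2 \<le> integral {0..t} (\<lambda>r. (c r)\<^sup>2) * A 0 t"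
      using cv(2) by (simp add: A_def)
    also have "\<dots> \<le> (4 * S0) * (C3 * S0)"
      using c2 A_early A_mono[of 0 0 t 2] t S0_bounds(1) A_nonneg[of 0 t] by (intro mult_mono) auto
    also have "\<dots> = (sqrt (4 * C3) * S0)\<^sup>2"
      using C_nonneg by (simp add: power_mult_distrib power2_eq_square)
    finally have cvb: "integral {0..t} (\<lambda>r. \<bar>c r * v r\<bar>) \<le> sqrt (4 * C3) * S0"
      by (rule power2_le_imp_le) (use S0_bounds(1) C_nonneg in auto)
    have Nt: "N 0 t \<le> C2 * sqrt S0" using N_early N_mono[of 0 0 t 2] t by auto
    have "\<bar>bh x t - bh x 0\<bar> \<le> integral {0..t} (\<lambda>r. \<gamma> * (\<bar>c r * v r\<bar> + (4 * B * N 0 t) * \<bar>v r\<bar>))"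
    proof (rule bh_rate[OF x])
      show "(\<lambda>r. \<gamma> * (\<bar>c r * v r\<bar> + (4 * B * N 0 t) * \<bar>v r\<bar>)) integrable_on {0..t}"
        by (intro integrable_on_mult_right integrable_add acv av_int) auto
      fix r assume r: "r \<in> {0..t}"
      have "B * N (max 0 (r - 1)) r \<le> B * N 0 t" using B r by (intro mult_left_mono N_mono) auto
      then have "\<bar>e x r\<bar> \<le> c r + 4 * B * N 0 t" using e_pointwise[OF x, of r] r by (simp add: c_def)
      then have "\<bar>e x r\<bar> * \<bar>v r\<bar> \<le> (c r + 4 * B * N 0 t) * \<bar>v r\<bar>" by (rule mult_right_mono) simp
      also have "\<dots> = \<bar>c r * v r\<bar> + (4 * B * N 0 t) * \<bar>v r\<bar>" by (simp add: c_def abs_mult algebra_simps)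
      finally show "\<gamma> * \<bar>e x r\<bar> * \<bar>v r\<bar> \<le> \<gamma> * (\<bar>c r * v r\<bar> + (4 * B * N 0 t) * \<bar>v r\<bar>)"
        using gam unfolding mult.assoc by (intro mult_left_mono) auto
    qed (use t in auto)
    also have "\<dots> = \<gamma> * (integral {0..t} (\<lambda>r. \<bar>c r * v r\<bar>) + (4 * B * N 0 t) * N 0 t)"
      unfolding integral_mult_right N_def[of 0 t]
      by (subst integral_add) (auto intro!: acv integrable_on_mult_right av_int)
    also have "\<dots> \<le> \<gamma> * (sqrt (4 * C3) * S0 + 4 * B * (C2 * sqrt S0)\<^sup>2)"
    proof (intro mult_left_mono add_mono cvb)
      have "N 0 t * N 0 t \<le> (C2 * sqrt S0) * (C2 * sqrt S0)"
        using Nt N_nonneg[of 0 t] by (intro mult_mono) auto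
      from mult_left_mono[OF this, of "4 * B"] B
      show "4 * B * N 0 t * N 0 t \<le> 4 * B * (C2 * sqrt S0)\<^sup>2" by (simp add: power2_eq_square mult.assoc)
    qed (use gam in auto)
    also have "\<dots> = C4 * S0" unfolding power_mult_distrib sqS by (simp add: C4_def algebra_simps)
    finally show ?thesis unfolding bt_def by linarith
  qed
  have bi: "(\<lambda>x. (bt x s)\<^sup>2) integrable_on {0..1}" if "s \<ge> 0" for s
    using that by (intro integrable_continuous_interval continuous_intros bt_cont_space)
  have "integral {0..1} (\<lambda>x. (bt x t)\<^sup>2) \<le> integral {0..1} (\<lambda>x. 2 * (bt x 0)\<^sup>2 + 2 * (C4 * S0)\<^sup>2)"
  proof (rule integral_le)
    show "(\<lambda>x. 2 * (bt x 0)\<^sup>2 + 2 * (C4 * S0)\<^sup>2) integrable_on {0..1}"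
      by (intro integrable_add integrable_on_mult_right bi) auto
    show "(bt x t)\<^sup>2 \<le> 2 * (bt x 0)\<^sup>2 + 2 * (C4 * S0)\<^sup>2" if "x \<in> {0..1}" for x
      using abs_le_square[OF pw[OF that]] sum2_square_le[of "\<bar>bt x 0\<bar>" "C4 * S0"] by simp
  qed (use bi t in auto)
  also have "\<dots> = 2 * integral {0..1} (\<lambda>x. (bt x 0)\<^sup>2) + 2 * (C4 * S0)\<^sup>2"
    using integral_plus_const[OF integrable_on_mult_right[OF bi[of 0], of 2], of "2 * (C4 * S0)\<^sup>2"] by simp
  finally have 1: "integral {0..1} (\<lambda>x. (bt x t)\<^sup>2) \<le> 2 * S0 + (2 * C4\<^sup>2) * S0\<^sup>2"
    using S0_bounds(4) by (simp add: power_mult_distrib)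
  have "integral {0..1} (\<lambda>x. (bt x t)\<^sup>2) \<le> integral {0..1} (\<lambda>x::real. (2 * B)\<^sup>2)"
    by (rule integral_le) (use bi t bt_bound[THEN abs_le_square] in auto)
  then have 2: "integral {0..1} (\<lambda>x. (bt x t)\<^sup>2) \<le> 4 * B\<^sup>2" by (simp add: power_mult_distrib)
  show ?thesis
    unfolding C5_def by (rule le_linear_from_quadratic[OF 1 2]) (use S0_bounds in auto)
qed

lemma V_initial: "V 1 \<le> C6 * S0"
proof -
  have sqS: "(sqrt S0)\<^sup>2 = S0" using S0_bounds(1) by simp
  have "(e x 1)\<^sup>2 \<le> 16 * B\<^sup>2 * C2\<^sup>2 * S0" if x: "x \<in> {0..1}" for x
  proof -
    have "\<bar>e x 1\<bar> \<le> 4 * B * N x 1" using e_bound_right[OF x, of 1] x by simp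
    also have "\<dots> \<le> 4 * B * (C2 * sqrt S0)"
      using B x N_early N_mono[of 0 x 1 2] by (intro mult_left_mono) auto
    finally have "(e x 1)\<^sup>2 \<le> (4 * B * (C2 * sqrt S0))\<^sup>2" by (rule abs_le_square)
    then show ?thesis unfolding power_mult_distrib sqS by simp
  qed
  then have "E2 1 \<le> integral {0..1} (\<lambda>x::real. 16 * B\<^sup>2 * C2\<^sup>2 * S0)"
    unfolding E2_def
    by (intro integral_le integrable_continuous_interval continuous_intros e_cont_space) auto
  moreover have "integral {0..1} (\<lambda>x. (bt x 1)\<^sup>2) / \<gamma> \<le> C5 * S0 / \<gamma>"
    using bt_early[of 1] gam by (intro divide_right_mono) auto
  ultimately show ?thesis by (simp add: V_def C6_def algebra_simps)
qed

end

section \<open>Global bounds\<close>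

lemma integrable_initial_step: "(\<lambda>t. if t \<le> c then d else 0 :: real) integrable_on {0..T::real}"
  and integral_initial_step: "0 \<le> c \<Longrightarrow> 0 \<le> d \<Longrightarrow> integral {0..T} (\<lambda>t. if t \<le> c then d else 0 :: real) \<le> c * d"
proof -
  have eq: "{..c} \<inter> {0..T} = {0..min c T}" by auto
  have "(\<lambda>t. if t \<in> {..c} then d else 0 :: real) integrable_on {0..T}"
    unfolding integrable_restrict_Int eq by (rule integrable_const_ivl)
  then show "(\<lambda>t. if t \<le> c then d else 0 :: real) integrable_on {0..T}" by simp
  assume cd: "0 \<le> c" "0 \<le> d"
  have "integral {0..T} (\<lambda>t. if t \<in> {..c} then d else 0 :: real) = integral {0..min c T} (\<lambda>_. d)"
    unfolding Henstock_Kurzweil_Integration.integral_restrict_Int eq ..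
  also have "\<dots> \<le> c * d"
  proof (cases "0 \<le> min c T")
    case True
    then show ?thesis using cd by (auto intro!: mult_right_mono)
  next
    case False
    then show ?thesis using cd by auto
  qed
  finally show "integral {0..T} (\<lambda>t. if t \<le> c then d else 0 :: real) \<le> c * d" by simp
qed

lemma mono_bounded_convergent_at_top:
  fixes F :: "real \<Rightarrow> real"
  assumes mono: "\<And>s t. 0 \<le> s \<Longrightarrow> s \<le> t \<Longrightarrow> F s \<le> F t" and bd: "\<And>t. 0 \<le> t \<Longrightarrow> F t \<le> C"
  shows "\<exists>L. (F \<longlongrightarrow> L) at_top"
proof -
  define L where "L = Sup (F ` {0..})"
  have bdd: "bdd_above (F ` {0..})" using bd by (intro bdd_aboveI2[of _ _ C]) auto
  have le: "F t \<le> L" if "0 \<le> t" for t unfolding L_def by (rule cSUP_upper[OF _ bdd]) (use that in auto)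
  have "(F \<longlongrightarrow> L) at_top"
  proof (rule tendstoI)
    fix d :: real assume d: "d > 0"
    obtain T where T: "0 \<le> T" "L - d < F T"
      using less_cSUP_iff[of "{0..}" F "L - d"] bdd d unfolding L_def[symmetric] by auto
    show "\<forall>\<^sub>F t in at_top. dist (F t) L < d"
      unfolding eventually_at_top_linorder
    proof (intro exI allI impI)
      fix t assume "T \<le> t"
      then have "F T \<le> F t" "F t \<le> L" using mono[of T t] le[of t] T by auto
      then show "dist (F t) L < d" using T by (simp add: dist_real_def)
    qed
  qed
  then show ?thesis by blast
qed

lemma sum3_square_le:
  fixes a b c :: real
  shows "(a + b + c)\<^sup>2 \<le> 3 * (a\<^sup>2 + b\<^sup>2 + c\<^sup>2)"
proof -
  have "3 * (a\<^sup>2 + b\<^sup>2 + c\<^sup>2) - (a + b + c)\<^sup>2 = (a-b)\<^sup>2 + (a-c)\<^sup>2 + (b-c)\<^sup>2"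
    by (simp add: power2_eq_square algebra_simps)
  also have "\<dots> \<ge> 0" by simp
  finally show ?thesis by simp
qed

section \<open>Energy of the trace over all times and the bounds that follow from it\<close>

context control_setting
begin

definition C7 where "C7 = C3 + (2 * C3 + 10 * (1 + \<kappa>\<^sub>1\<^sup>2) * C6) * exp 1"
definition C8 where "C8 = C1 + 4 * B"
definition C9 where "C9 = C8 * C2 + 2 * \<kappa>\<^sub>1"
text \<open>The first summand is the Gronwall exponent with the Lyapunov function at time 1 replaced
  by its bound; the summand 1 makes the rate strictly positive.\<close>

definition \<rho> where "\<rho> = 4 * \<theta> * (C6 / \<gamma>\<^sub>0) + 1"

end

context closed_loop
begin

definition J where "J = C7 * S0 * exp (\<rho> * S0)"

lemma const_nonneg: "0 \<le> C7" "0 \<le> C8" "0 \<le> C9" "0 < \<rho>" "0 \<le> J"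
proof -
  show 7: "0 \<le> C7" using C_nonneg by (auto simp: C7_def)
  show 8: "0 \<le> C8" using C_nonneg B by (auto simp: C8_def)
  show "0 \<le> C9" using 8 C_nonneg kappa_nonneg by (auto simp: C9_def)
  have "0 \<le> 4 * \<theta> * (C6 / \<gamma>\<^sub>0)" using theta_nonneg C_nonneg gam0 by auto
  then show "0 < \<rho>" by (simp add: \<rho>_def)
  show "0 \<le> J" using 7 S0_bounds by (auto simp: J_def)
qed

lemma A_bound:
  assumes T: "0 \<le> T"
  shows "A 0 T \<le> J"
proof -
  \<comment> \<open>The estimate from Gronwall speaks of end times of at least 2.\<close>
  have mono: "A 0 T \<le> A 0 (max T 2)" by (rule A_mono) auto
  have ex: "1 \<le> exp (\<rho> * S0)" using const_nonneg S0_bounds by simp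
  have "A 0 (max T 2) = A 0 1 + A 1 (max T 2)" using A_split[of 0 1 "max T 2"] by simp
  also have "A 0 1 \<le> C3 * S0" using A_early A_mono[of 0 0 1 2] by simp
  also have "A 1 (max T 2) \<le> (2 * A 1 2 + 10 * (1 + \<kappa>\<^sub>1\<^sup>2) * V 1) * exp (1 + 4 * \<theta> * (V 1 / \<gamma>\<^sub>0))"
    using trace_energy_bound[of "max T 2 - 1"] by simp
  also have "\<dots> \<le> (2 * (C3 * S0) + 10 * (1 + \<kappa>\<^sub>1\<^sup>2) * (C6 * S0)) * exp (1 + 4 * \<theta> * (C6 * S0 / \<gamma>\<^sub>0))"
  proof (intro mult_mono add_mono mult_left_mono)
    show "A 1 2 \<le> C3 * S0" using A_early A_mono[of 0 1 2 2] by simp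
    have "V 1 / \<gamma>\<^sub>0 \<le> C6 * S0 / \<gamma>\<^sub>0" using V_initial gam0 by (intro divide_right_mono) auto
    then show "exp (1 + 4 * \<theta> * (V 1 / \<gamma>\<^sub>0)) \<le> exp (1 + 4 * \<theta> * (C6 * S0 / \<gamma>\<^sub>0))"
      using theta_nonneg mult_left_mono[of "V 1 / \<gamma>\<^sub>0" "C6 * S0 / \<gamma>\<^sub>0" "4 * \<theta>"] by simp
  qed (use V_initial C_nonneg S0_bounds V_nonneg A_nonneg in auto)
  also have "\<dots> = (2 * C3 + 10 * (1 + \<kappa>\<^sub>1\<^sup>2) * C6) * exp 1 * S0 * exp (4 * \<theta> * (C6 / \<gamma>\<^sub>0) * S0)"
    by (simp add: exp_add algebra_simps)
  also have "\<dots> \<le> (2 * C3 + 10 * (1 + \<kappa>\<^sub>1\<^sup>2) * C6) * exp 1 * S0 * exp (\<rho> * S0)"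
  proof (intro mult_left_mono)
    have "\<rho> * S0 = 4 * \<theta> * (C6 / \<gamma>\<^sub>0) * S0 + S0" by (simp add: \<rho>_def distrib_right)
    then show "exp (4 * \<theta> * (C6 / \<gamma>\<^sub>0) * S0) \<le> exp (\<rho> * S0)" using S0_bounds(1) by simp
  qed (use C_nonneg S0_bounds(1) in auto)
  also have "C3 * S0 \<le> C3 * S0 * exp (\<rho> * S0)"
    using ex C_nonneg S0_bounds mult_left_mono[of 1 "exp (\<rho> * S0)" "C3 * S0"] by simp
  finally have "A 0 (max T 2) \<le> J" by (simp add: J_def C7_def algebra_simps)
  with mono show ?thesis by linarith
qed

text \<open>Squared bound for \<open>u\<close> and \<open>uh\<close> at times \<open>t \<ge> 1\<close>: a characteristic takes one time unit to cross the
  interval, the control law looks one unit ahead in \<open>v\<close> and one unit back through \<open>e\<close>.\<close>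

definition w where "w t = 6 * C8\<^sup>2 * A (max 0 (t - 2)) (t + 1) + (if t \<le> 2 then 2 * (\<kappa>\<^sub>1 * h1)\<^sup>2 else 0)"

lemma w_nonneg: "0 \<le> w t"
  using A_nonneg[of "max 0 (t - 2)" "t + 1"] by (simp add: w_def)

lemma w_bound:
  assumes "0 \<le> t" shows "w t \<le> 6 * C8\<^sup>2 * J + 8 * \<kappa>\<^sub>1\<^sup>2 * S0"
proof -
  have "A (max 0 (t - 2)) (t + 1) \<le> J"
    using A_bound[of "t+1"] A_mono[of 0 "max 0 (t-2)" "t+1" "t+1"] assms by auto
  then have "6 * C8\<^sup>2 * A (max 0 (t - 2)) (t + 1) \<le> 6 * C8\<^sup>2 * J" by (intro mult_left_mono) auto
  moreover have "2 * (\<kappa>\<^sub>1 * h1)\<^sup>2 \<le> 8 * \<kappa>\<^sub>1\<^sup>2 * S0"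
    using mult_left_mono[OF h1_bound(3), of "2 * \<kappa>\<^sub>1\<^sup>2"] by (simp add: power_mult_distrib)
  moreover have "0 \<le> 8 * \<kappa>\<^sub>1\<^sup>2 * S0" using S0_bounds by simp
  ultimately have "6 * C8\<^sup>2 * A (max 0 (t - 2)) (t + 1) + c \<le> 6 * C8\<^sup>2 * J + 8 * \<kappa>\<^sub>1\<^sup>2 * S0"
    if "c = 2 * (\<kappa>\<^sub>1 * h1)\<^sup>2 \<or> c = 0" for c using that by linarith
  then show ?thesis unfolding w_def by presburger
qed

text \<open>At time \<open>r\<close> the characteristic through (x,t) left x = 1. The control at
  that time sees the trace within one unit of \<open>r\<close>, hence between t - 2 and t + 1;
  Cauchy-Schwarz on this window gives the 3 hidden in the factor 6 of \<open>w\<close>.\<close>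

lemma late_bound:
  assumes x: "x \<in> {0..1}" and t: "t \<ge> 1"
  shows "\<bar>u x t\<bar> \<le> sqrt (w t)" and "\<bar>uh x t\<bar> \<le> sqrt (w t)"
proof -
  let ?n = "N (max 0 (t - 2)) (t + 1)"
  let ?h = "if t \<le> 2 then h1 else 0"
  define r where "r = x + t - 1"
  have r: "0 \<le> r" "t - 1 \<le> r" "r \<le> t" using x t by (auto simp: r_def)
  have n0: "0 \<le> ?n" by (rule N_nonneg) simp
  have "\<bar>U r\<bar> \<le> \<kappa>\<^sub>1 * ((1 + 5 * B) * N (max 0 (r - 1)) (r + 1) + hcut r)" by (rule U_trace_bound[OF r(1)])
  also have "\<dots> \<le> \<kappa>\<^sub>1 * ((1 + 5 * B) * ?n + ?h)"
  proof (intro mult_left_mono add_mono)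
    show "N (max 0 (r - 1)) (r + 1) \<le> ?n" using r t by (intro N_mono) auto
    show "hcut r \<le> ?h" using r h1_bound by (auto simp: hcut_def)
  qed (use kappa_nonneg B in auto)
  finally have U: "\<bar>U r\<bar> \<le> \<kappa>\<^sub>1 * ((1 + 5 * B) * ?n + ?h)" .
  have n1: "N r t \<le> ?n" using r t by (intro N_mono) auto
  have "\<bar>u x t\<bar> \<le> \<bar>U r\<bar> + B * N r t" using u_from_boundary[OF x] x t unfolding r_def by auto
  also have "\<dots> \<le> \<kappa>\<^sub>1 * ((1 + 5 * B) * ?n + ?h) + B * ?n" using U B n1 by (intro add_mono mult_left_mono) auto
  finally have u: "\<bar>u x t\<bar> \<le> C1 * ?n + \<kappa>\<^sub>1 * ?h" by (simp add: C1_def algebra_simps)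
  have "\<bar>e x t\<bar> \<le> 4 * B * N r t" using e_bound_right[OF x] x t unfolding r_def by auto
  also have "\<dots> \<le> 4 * B * ?n" using B n1 by (intro mult_left_mono) auto
  finally have e: "\<bar>e x t\<bar> \<le> 4 * B * ?n" .
  have uh: "\<bar>uh x t\<bar> \<le> C8 * ?n + \<kappa>\<^sub>1 * ?h" using u e unfolding C8_def e_def by (simp add: algebra_simps)
  have "0 \<le> 4 * B * ?n" using B n0 by simp
  then have u': "\<bar>u x t\<bar> \<le> C8 * ?n + \<kappa>\<^sub>1 * ?h" using u unfolding C8_def by (simp add: algebra_simps)
  have "(C8 * ?n + \<kappa>\<^sub>1 * ?h)\<^sup>2 \<le> 2 * ((C8 * ?n)\<^sup>2 + (\<kappa>\<^sub>1 * ?h)\<^sup>2)" by (rule sum2_square_le)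
  also have "(C8 * ?n)\<^sup>2 \<le> C8\<^sup>2 * (3 * A (max 0 (t - 2)) (t + 1))"
  proof -
    have "?n\<^sup>2 \<le> \<bar>t + 1 - max 0 (t - 2)\<bar> * A (max 0 (t - 2)) (t + 1)" by (rule N_A) simp
    also have "\<dots> \<le> 3 * A (max 0 (t - 2)) (t + 1)" using t A_nonneg by (intro mult_right_mono) auto
    finally show ?thesis unfolding power_mult_distrib by (intro mult_left_mono) auto
  qed
  finally have "(C8 * ?n + \<kappa>\<^sub>1 * ?h)\<^sup>2 \<le> w t" by (auto simp: w_def)
  then have b: "C8 * ?n + \<kappa>\<^sub>1 * ?h \<le> sqrt (w t)" by (rule real_le_rsqrt)
  show "\<bar>u x t\<bar> \<le> sqrt (w t)" "\<bar>uh x t\<bar> \<le> sqrt (w t)" using u' uh b by linarith+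
qed

text \<open>Up to time 1 the initial data are still present. They cannot be bounded pointwise and
  are kept as functions of x + t, to be squared and integrated or, for bounded data, estimated
  directly.\<close>

lemma early_bound:
  assumes x: "x \<in> {0..1}" and t: "t \<in> {0..1}"
  shows "\<bar>u x t\<bar> \<le> \<bar>cut (\<lambda>z. u z 0) (x + t)\<bar> + C9 * sqrt S0"
    and "\<bar>uh x t\<bar> \<le> \<bar>cut (\<lambda>z. u z 0) (x + t)\<bar> + \<bar>cut (\<lambda>z. e z 0) (x + t)\<bar> + C9 * sqrt S0"
proof -
  have N2: "N a b \<le> N 0 2" if "0 \<le> a" "b \<le> 2" for a b using that by (intro N_mono) auto
  have n0: "0 \<le> N 0 2" by (simp add: N_nonneg)
  have kh: "0 \<le> \<kappa>\<^sub>1 * h1" using kappa_nonneg h1_bound by simp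
  have u: "\<bar>u x t\<bar> \<le> \<bar>cut (\<lambda>z. u z 0) (x + t)\<bar> + (C1 * N 0 2 + \<kappa>\<^sub>1 * h1)"
  proof (cases "x + t \<le> 1")
    case True
    have "\<bar>u x t\<bar> \<le> \<bar>u (x + t) 0\<bar> + B * N 0 t" using u_from_initial[OF x _ True] t by auto
    also have "B * N 0 t \<le> C1 * N 0 2"
      using N2[of 0 t] t kappa_nonneg B n0 N_nonneg[of 0 t] by (intro mult_mono) (auto simp: C1_def)
    finally show ?thesis using True kh by (simp add: cut_def)
  next
    case False
    define r where "r = x + t - 1"
    have r: "0 \<le> r" "r \<le> 1" using x t False by (auto simp: r_def)
    have "\<bar>U r\<bar> \<le> \<kappa>\<^sub>1 * ((1 + 5 * B) * N (max 0 (r - 1)) (r + 1) + hcut r)" by (rule U_trace_bound[OF r(1)])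
    also have "\<dots> \<le> \<kappa>\<^sub>1 * ((1 + 5 * B) * N 0 2 + h1)"
      using kappa_nonneg B r hcut_bounds by (intro mult_left_mono add_mono N2) auto
    finally have U: "\<bar>U r\<bar> \<le> \<dots>" .
    have "\<bar>u x t\<bar> \<le> \<bar>U r\<bar> + B * N r t" using u_from_boundary[OF x] t False unfolding r_def by auto
    also have "\<dots> \<le> \<kappa>\<^sub>1 * ((1 + 5 * B) * N 0 2 + h1) + B * N 0 2"
      using U B r t by (intro add_mono mult_left_mono N2) auto
    finally show ?thesis using False by (simp add: cut_def C1_def algebra_simps)
  qed
  have "\<bar>e x t\<bar> \<le> \<bar>cut (\<lambda>z. e z 0) (x + t)\<bar> + 4 * B * N (max 0 (t - 1)) t"
    by (rule e_pointwise[OF x]) (use t in auto)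
  also have "4 * B * N (max 0 (t - 1)) t \<le> 4 * B * N 0 2" using B t by (intro mult_left_mono N2) auto
  finally have e: "\<bar>e x t\<bar> \<le> \<bar>cut (\<lambda>z. e z 0) (x + t)\<bar> + 4 * B * N 0 2" by simp
  have "C8 * N 0 2 + \<kappa>\<^sub>1 * h1 \<le> C8 * (C2 * sqrt S0) + \<kappa>\<^sub>1 * (2 * sqrt S0)"
    using N_early h1_bound kappa_nonneg const_nonneg by (intro add_mono mult_left_mono) auto
  then have c: "C8 * N 0 2 + \<kappa>\<^sub>1 * h1 \<le> C9 * sqrt S0" by (simp add: C9_def algebra_simps)
  have p: "0 \<le> 4 * B * N 0 2" using B n0 by simp
  show "\<bar>u x t\<bar> \<le> \<bar>cut (\<lambda>z. u z 0) (x + t)\<bar> + C9 * sqrt S0"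
    using u c p unfolding C8_def distrib_right by linarith
  show "\<bar>uh x t\<bar> \<le> \<bar>cut (\<lambda>z. u z 0) (x + t)\<bar> + \<bar>cut (\<lambda>z. e z 0) (x + t)\<bar> + C9 * sqrt S0"
    using u e c unfolding C8_def distrib_right e_def by linarith
qed

lemma square_int: "t \<ge> 0 \<Longrightarrow> (\<lambda>x. (u x t)\<^sup>2) integrable_on {0..1}" "t \<ge> 0 \<Longrightarrow> (\<lambda>x. (uh x t)\<^sup>2) integrable_on {0..1}"
  using u_sq uh_sq by (auto simp: square_integrable_on_def)

lemma late_l2:
  assumes "t \<ge> 1"
  shows "integral {0..1} (\<lambda>x. (u x t)\<^sup>2) \<le> w t" "integral {0..1} (\<lambda>x. (uh x t)\<^sup>2) \<le> w t"
proof -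
  have "integral {0..1} (\<lambda>x. (u x t)\<^sup>2) \<le> integral {0..1} (\<lambda>x::real. (sqrt (w t))\<^sup>2)"
    by (intro integral_le square_int abs_le_square late_bound) (use assms in auto)
  then show "integral {0..1} (\<lambda>x. (u x t)\<^sup>2) \<le> w t" using w_nonneg by simp
  have "integral {0..1} (\<lambda>x. (uh x t)\<^sup>2) \<le> integral {0..1} (\<lambda>x::real. (sqrt (w t))\<^sup>2)"
    by (intro integral_le square_int abs_le_square late_bound) (use assms in auto)
  then show "integral {0..1} (\<lambda>x. (uh x t)\<^sup>2) \<le> w t" using w_nonneg by simp
qed

lemma early_l2:
  assumes t: "t \<in> {0..1}"
  shows "integral {0..1} (\<lambda>x. (u x t)\<^sup>2) \<le> (15 + 3 * C9\<^sup>2) * S0"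
    and "integral {0..1} (\<lambda>x. (uh x t)\<^sup>2) \<le> (15 + 3 * C9\<^sup>2) * S0"
proof -
  define cu where "cu x = cut (\<lambda>z. u z 0) (t + x)" for x
  define ce where "ce x = cut (\<lambda>z. e z 0) (t + x)" for x
  have "cu square_integrable_on {0..1}" "ce square_integrable_on {0..1}"
    unfolding cu_def ce_def using cut_square_integrable(1)[OF u_sq[of 0], of "0+t" "1+t"]
      cut_square_integrable(1)[OF e_sq[of 0], of "0+t" "1+t"] t
    by (auto simp: square_integrable_shift_left)
  then have ci: "(\<lambda>x. (cu x)\<^sup>2) integrable_on {0..1}" "(\<lambda>x. (ce x)\<^sup>2) integrable_on {0..1}"
    by (auto simp: square_integrable_on_def)
  have cu2: "integral {0..1} (\<lambda>x. (cu x)\<^sup>2) \<le> S0"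
    using cut_square_integrable(2)[OF u_sq[of 0], of "0+t" "1+t"] S0_bounds(2) t
      integral_shift_left[of 0 1 "\<lambda>z. (cut (\<lambda>z. u z 0) z)\<^sup>2" t] by (simp add: cu_def)
  have ce2: "integral {0..1} (\<lambda>x. (ce x)\<^sup>2) \<le> 4 * S0"
    using cut_square_integrable(2)[OF e_sq[of 0], of "0+t" "1+t"] e_initial t
      integral_shift_left[of 0 1 "\<lambda>z. (cut (\<lambda>z. e z 0) z)\<^sup>2" t] by (simp add: ce_def)
  let ?g = "\<lambda>x. 3 * ((cu x)\<^sup>2 + (ce x)\<^sup>2) + 3 * (C9 * sqrt S0)\<^sup>2"
  have gi: "?g integrable_on {0..1}" by (intro integrable_add integrable_on_mult_right ci) auto
  have "integral {0..1} ?g = 3 * (integral {0..1} (\<lambda>x. (cu x)\<^sup>2) + integral {0..1} (\<lambda>x. (ce x)\<^sup>2)) + 3 * (C9 * sqrt S0)\<^sup>2"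
    unfolding integral_plus_const[OF integrable_on_mult_right[OF integrable_add[OF ci]] zero_le_one]
      integral_mult_right integral_add[OF ci] by simp
  also have "\<dots> \<le> 3 * (S0 + 4 * S0) + 3 * (C9 * sqrt S0)\<^sup>2" using cu2 ce2 by simp
  also have "\<dots> = (15 + 3 * C9\<^sup>2) * S0"
    unfolding power_mult_distrib real_sqrt_pow2[OF S0_bounds(1)] by (simp add: algebra_simps)
  finally have g: "integral {0..1} ?g \<le> (15 + 3 * C9\<^sup>2) * S0" .
  have pw: "f\<^sup>2 \<le> ?g x" if f: "\<bar>f\<bar> \<le> \<bar>cu x\<bar> + \<bar>ce x\<bar> + C9 * sqrt S0" for f x
    using abs_le_square[OF f] sum3_square_le[of "\<bar>cu x\<bar>" "\<bar>ce x\<bar>" "C9 * sqrt S0"] by simp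
  have "integral {0..1} (\<lambda>x. (u x t)\<^sup>2) \<le> integral {0..1} ?g"
  proof (rule integral_le[OF square_int(1) gi])
    show "(u x t)\<^sup>2 \<le> ?g x" if "x \<in> {0..1}" for x
      using early_bound(1)[OF that t] by (intro pw) (auto simp: cu_def ce_def add.commute)
  qed (use t in auto)
  with g show "integral {0..1} (\<lambda>x. (u x t)\<^sup>2) \<le> (15 + 3 * C9\<^sup>2) * S0" by linarith
  have "integral {0..1} (\<lambda>x. (uh x t)\<^sup>2) \<le> integral {0..1} ?g"
  proof (rule integral_le[OF square_int(2) gi])
    show "(uh x t)\<^sup>2 \<le> ?g x" if "x \<in> {0..1}" for x
      using early_bound(2)[OF that t] by (intro pw) (auto simp: cu_def ce_def add.commute)
  qed (use t in auto)
  with g show "integral {0..1} (\<lambda>x. (uh x t)\<^sup>2) \<le> (15 + 3 * C9\<^sup>2) * S0" by linarith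
qed

end

context control_setting
begin

text \<open>The first three summands, with 30 = 2 * 15 and 6 = 2 * 3 for the two states, serve the
  times up to 1; the others serve later times.\<close>

definition R where "R = 30 + 6 * C9\<^sup>2 + C5 + 12 * C8\<^sup>2 * C7 + 16 * \<kappa>\<^sub>1\<^sup>2 + \<gamma> * C6"

end

context closed_loop
begin

lemma R_pos: "0 < R"
  unfolding R_def using C_nonneg const_nonneg gam
  by (intro add_pos_nonneg mult_nonneg_nonneg) auto

lemma stability_estimate:
  assumes t: "t \<ge> 0"
  shows "S_fun \<beta> u uh bh t \<le> R * S0 * exp (\<rho> * S0)"
proof -
  let ?X = "exp (\<rho> * S0)"
  have ex: "1 \<le> ?X" using const_nonneg S0_bounds by simp
  have S0: "0 \<le> S0" by (rule S0_bounds)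
  have cX: "c * S0 \<le> c * S0 * ?X" if "0 \<le> c" for c
    using mult_left_mono[OF ex, of "c * S0"] that S0 by simp
  have nn: "0 \<le> 30 + 6 * C9\<^sup>2 + C5" "0 \<le> 12 * C8\<^sup>2 * C7" "0 \<le> 16 * \<kappa>\<^sub>1\<^sup>2 + \<gamma> * C6"
    using C_nonneg const_nonneg gam by auto
  show ?thesis
  proof (cases "t \<le> 1")
    case True
    then have t1: "t \<in> {0..1}" using t by auto
    have "S_fun \<beta> u uh bh t \<le> (30 + 6 * C9\<^sup>2 + C5) * S0"
      unfolding S_eq using early_l2[OF t1] bt_early[OF t1] by (simp add: algebra_simps)
    also have "\<dots> \<le> R * S0" using nn S0 by (intro mult_right_mono) (auto simp: R_def)
    also have "\<dots> \<le> R * S0 * ?X" using R_pos by (intro cX) auto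
    finally show ?thesis .
  next
    case False
    have "integral {0..1} (\<lambda>x. (bt x t)\<^sup>2) \<le> \<gamma> * V t"
      unfolding V_def using gam E2_nonneg[of t] by (simp add: distrib_left)
    also have "\<dots> \<le> \<gamma> * (C6 * S0)"
      using V_consequences(3)[of t] V_initial False gam by (intro mult_left_mono) auto
    finally have b: "integral {0..1} (\<lambda>x. (bt x t)\<^sup>2) \<le> \<gamma> * (C6 * S0)" .
    have t1: "1 \<le> t" using False by simp
    have "S_fun \<beta> u uh bh t \<le> 2 * (6 * C8\<^sup>2 * J + 8 * \<kappa>\<^sub>1\<^sup>2 * S0) + \<gamma> * (C6 * S0)"
    proof -
      define X where "X = 6 * C8\<^sup>2 * J + 8 * \<kappa>\<^sub>1\<^sup>2 * S0"
      have "w t \<le> X" unfolding X_def by (rule w_bound[OF t])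
      then have "S_fun \<beta> u uh bh t \<le> X + X + \<gamma> * (C6 * S0)"
        unfolding S_eq using late_l2[OF t1] b by (intro add_mono) auto
      then show ?thesis by (simp add: X_def algebra_simps)
    qed
    also have "\<dots> = (12 * C8\<^sup>2 * C7) * S0 * ?X + (16 * \<kappa>\<^sub>1\<^sup>2 + \<gamma> * C6) * S0"
      by (simp add: J_def algebra_simps)
    also have "\<dots> \<le> (12 * C8\<^sup>2 * C7) * S0 * ?X + (16 * \<kappa>\<^sub>1\<^sup>2 + \<gamma> * C6) * S0 * ?X"
      using cX[OF nn(3)] by simp
    also have "\<dots> = (12 * C8\<^sup>2 * C7 + (16 * \<kappa>\<^sub>1\<^sup>2 + \<gamma> * C6)) * S0 * ?X" by (simp add: algebra_simps)
    also have "\<dots> \<le> R * S0 * ?X" using nn S0 by (intro mult_right_mono) (auto simp: R_def)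
    finally show ?thesis .
  qed
qed

section \<open>Integrability and decay of the late bound\<close>

lemma A_window_eq: "0 \<le> t \<Longrightarrow> A (max 0 (t - 2)) (t + 1) = A 0 (t + 1) - A 0 (max 0 (t - 2))"
  using A_split[of 0 "max 0 (t - 2)" "t + 1"] by auto

lemma A_window_cont: "continuous_on {0..T} (\<lambda>t. A (max 0 (t - 2)) (t + 1))"
proof -
  have c: "continuous_on {0..T+1} (A 0)" by (rule A_cont) simp
  have "continuous_on {0..T} (\<lambda>t. A 0 (t + 1) - A 0 (max 0 (t - 2)))"
    by (intro continuous_on_diff continuous_on_compose2[OF c] continuous_intros) auto
  then show ?thesis by (rule continuous_on_eq) (use A_window_eq in auto)
qed

lemma w_integrable: "w integrable_on {0..T}"
  unfolding w_def
  by (intro integrable_add integrable_on_mult_right integrable_continuous_interval A_window_cont integrable_initial_step)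

text \<open>The integral of the moving window of \<open>A\<close> telescopes: after shifting the two
  end points, only a piece of length 3 survives, on which \<open>A\<close> is at most
  \<open>J\<close>.\<close>

lemma w_integral:
  assumes "0 \<le> T"
  shows "integral {0..T} w \<le> 18 * C8\<^sup>2 * J + 4 * (\<kappa>\<^sub>1 * h1)\<^sup>2"
proof -
  let ?T = "max T 2"
  have Fi: "A 0 integrable_on {a..b}" if "0 \<le> a" for a b
    by (rule integrable_continuous_interval[OF continuous_on_subset[OF A_cont[of 0 b]]]) (use that in auto)
  have F0: "0 \<le> A 0 t" for t by (rule A_nonneg) simp
  let ?W = "\<lambda>t. A (max 0 (t - 2)) (t + 1)"
  have m: "continuous_on {0..?T} (\<lambda>t. A 0 (max 0 (t - 2)))"
    by (rule continuous_on_compose2[OF A_cont[of 0 ?T]]) (auto intro!: continuous_intros)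
  have p: "(\<lambda>t. A 0 (1 + t)) integrable_on {0..?T}"
    using Fi[of "0+1" "?T+1"] by (subst integrable_shift_left) auto
  have "integral {0..?T} ?W = integral {0..?T} (\<lambda>t. A 0 (1 + t) - A 0 (max 0 (t - 2)))"
    by (rule integral_cong) (use A_window_eq in \<open>auto simp: add.commute\<close>)
  also have "\<dots> = integral {0..?T} (\<lambda>t. A 0 (1 + t)) - integral {0..?T} (\<lambda>t. A 0 (max 0 (t - 2)))"
    by (intro integral_diff p integrable_continuous_interval m)
  also have "integral {0..?T} (\<lambda>t. A 0 (1 + t)) = integral {0+1..?T+1} (A 0)" by (rule integral_shift_left)
  also have "\<dots> \<le> integral {0..?T+1} (A 0)" using F0 by (intro integral_subset_le Fi) auto
  also have "\<dots> = integral {0..?T-2} (A 0) + integral {?T-2..?T+1} (A 0)"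
    by (rule Henstock_Kurzweil_Integration.integral_combine[symmetric]) (auto intro: Fi)
  also have "integral {?T-2..?T+1} (A 0) \<le> integral {?T-2..?T+1} (\<lambda>_. J)"
    by (intro integral_le Fi) (auto intro: A_bound)
  also have "\<dots> = 3 * J" by simp
  also have "integral {0..?T} (\<lambda>t. A 0 (max 0 (t - 2))) \<ge> integral {0..?T-2} (A 0)"
  proof -
    have "integral {0..?T-2} (A 0) = integral {0..?T-2} (\<lambda>t. A 0 (max 0 ((2 + t) - 2)))"
      by (rule integral_cong) auto
    also have "\<dots> = integral {0+2..?T-2+2} (\<lambda>t. A 0 (max 0 (t - 2)))"
      by (rule integral_shift_left[where f = "\<lambda>t. A 0 (max 0 (t - 2))"])
    also have "\<dots> \<le> integral {0..?T} (\<lambda>t. A 0 (max 0 (t - 2)))"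
      using F0 by (intro integral_subset_le integrable_continuous_interval m continuous_on_subset[OF m]) auto
    finally show ?thesis .
  qed
  finally have W: "integral {0..?T} ?W \<le> 3 * J" by simp
  have Wi: "?W integrable_on {0..?T}" by (intro integrable_continuous_interval A_window_cont)
  have "integral {0..T} w \<le> integral {0..?T} w"
    using w_nonneg by (intro integral_subset_le w_integrable) auto
  also have "\<dots> = 6 * C8\<^sup>2 * integral {0..?T} ?W + integral {0..?T} (\<lambda>t. if t \<le> 2 then 2 * (\<kappa>\<^sub>1 * h1)\<^sup>2 else 0)"
    unfolding w_def
    using integral_add[OF integrable_on_mult_right[OF Wi, of "6 * C8\<^sup>2"] integrable_initial_step[of 2 "2 * (\<kappa>\<^sub>1 * h1)\<^sup>2" ?T]]
    by simp
  also have "\<dots> \<le> 6 * C8\<^sup>2 * (3 * J) + 2 * (2 * (\<kappa>\<^sub>1 * h1)\<^sup>2)"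
    by (intro add_mono mult_left_mono W integral_initial_step) auto
  finally show ?thesis by simp
qed

text \<open>The energy \<open>A 0\<close> is monotone and bounded, so it converges and its
  increments over windows of length 3 vanish. This takes the place of an argument of Barbalat
  type.\<close>

lemma w_tendsto: "(w \<longlongrightarrow> 0) at_top"
proof -
  obtain L where L: "(A 0 \<longlongrightarrow> L) at_top"
    using mono_bounded_convergent_at_top[of "A 0" J] A_mono[of 0 0] A_bound by auto
  have p: "filterlim (\<lambda>t::real. t + 1) at_top at_top" "filterlim (\<lambda>t::real. t - 2) at_top at_top"
    using filterlim_tendsto_add_at_top[OF tendsto_const[of "1::real"] filterlim_ident]
      filterlim_tendsto_add_at_top[OF tendsto_const[of "-2::real"] filterlim_ident]
    by (auto simp: add.commute)
  have "((\<lambda>t. 6 * C8\<^sup>2 * (A 0 (t + 1) - A 0 (t - 2))) \<longlongrightarrow> 6 * C8\<^sup>2 * (L - L)) at_top"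
    by (intro tendsto_intros filterlim_compose[OF L] p)
  moreover have "\<forall>\<^sub>F t in at_top. w t = 6 * C8\<^sup>2 * (A 0 (t + 1) - A 0 (t - 2))"
    using eventually_gt_at_top[of 2]
  proof eventually_elim
    case (elim t)
    then show ?case using A_window_eq[of t] by (simp add: w_def max_def)
  qed
  ultimately show ?thesis by (simp add: tendsto_cong)
qed

text \<open>A common test for all norms: domination by the root of \<open>w\<close>, which is
  bounded and integrable, plus a constant during the first time unit.\<close>

lemma time_spaces:
  assumes m: "\<phi> \<in> borel_measurable (lebesgue_on {0..})" and a: "0 \<le> a" and D: "0 \<le> D"
    and le: "\<And>t. a \<le> t \<Longrightarrow> \<phi> t \<le> ennreal (sqrt (w t + (if t \<le> 1 then D else 0)))"
  shows "\<phi> \<in> L2_time {a..} \<inter> Linf_time {a..}"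
proof -
  define g where "g t = w t + (if t \<le> 1 then D else 0)" for t
  have g0: "0 \<le> g t" for t using w_nonneg D by (simp add: g_def)
  have gi: "g integrable_on {0..T}" for T
    unfolding g_def by (intro integrable_add w_integrable integrable_initial_step)
  have gint: "integral {0..T} g \<le> 18 * C8\<^sup>2 * J + 4 * (\<kappa>\<^sub>1 * h1)\<^sup>2 + 1 * D" if "0 \<le> T" for T
    unfolding g_def using integral_add[OF w_integrable integrable_initial_step] w_integral[OF that] integral_initial_step[of 1 D T] D
    by simp
  have meas: "\<phi> \<in> borel_measurable (lebesgue_on {a..})"
    by (rule measurable_restrict_mono[OF m]) (use a in auto)
  have "(\<integral>\<^sup>+ t. (\<phi> t)\<^sup>2 \<partial>lebesgue_on {a..}) = (\<integral>\<^sup>+ t. (\<phi> t)\<^sup>2 * indicator {a..} t \<partial>lebesgue)"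
    by (rule nn_integral_restrict_space) auto
  also have "\<dots> \<le> (\<integral>\<^sup>+ t. ennreal (g t) * indicator {0..} t \<partial>lebesgue)"
  proof (rule nn_integral_mono)
    fix t :: real
    show "(\<phi> t)\<^sup>2 * indicator {a..} t \<le> ennreal (g t) * indicator {0..} t"
    proof (cases "a \<le> t")
      case True
      have "(\<phi> t)\<^sup>2 \<le> (ennreal (sqrt (g t)))\<^sup>2" using le[OF True] by (intro power_mono) (auto simp: g_def)
      also have "\<dots> = ennreal (g t)" using g0 by (simp add: ennreal_power)
      finally show ?thesis using True a by simp
    qed simp
  qed
  also have "\<dots> = (\<integral>\<^sup>+ t. ennreal (g t) \<partial>lebesgue_on {0..})"
    by (rule nn_integral_restrict_space[symmetric]) auto
  also have "\<dots> \<le> ennreal (18 * C8\<^sup>2 * J + 4 * (\<kappa>\<^sub>1 * h1)\<^sup>2 + 1 * D)"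
    by (rule nn_integral_halfline_le[OF g0 gi gint])
  also have "\<dots> < \<infinity>" by simp
  finally have L2: "\<phi> \<in> L2_time {a..}" using meas by (simp add: L2_time_def)
  have "\<phi> t \<le> ennreal (sqrt (6 * C8\<^sup>2 * J + 8 * \<kappa>\<^sub>1\<^sup>2 * S0 + D))" if "a \<le> t" for t
  proof -
    have "\<phi> t \<le> ennreal (sqrt (g t))" using le[OF that] by (simp add: g_def)
    also have "\<dots> \<le> ennreal (sqrt (6 * C8\<^sup>2 * J + 8 * \<kappa>\<^sub>1\<^sup>2 * S0 + D))"
      using w_bound[of t] that a D by (intro ennreal_leI real_sqrt_le_mono) (auto simp: g_def)
    finally show ?thesis .
  qed
  then have "AE t in lebesgue_on {a..}. \<phi> t \<le> ennreal (sqrt (6 * C8\<^sup>2 * J + 8 * \<kappa>\<^sub>1\<^sup>2 * S0 + D))"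
    by (intro AE_I2) auto
  then have "\<phi> \<in> Linf_time {a..}" using meas by (auto simp: Linf_time_def)
  with L2 show ?thesis by simp
qed

section \<open>Membership of the norms in the spaces of functions of time\<close>

lemma char_continuous:
  assumes "0 \<le> \<xi>"
  shows "continuous_on {max 0 (\<xi> - 1)..\<xi>} (\<lambda>t. u (\<xi> - t) t)"
    and "continuous_on {max 0 (\<xi> - 1)..\<xi>} (\<lambda>t. uh (\<xi> - t) t)"
proof -
  have m: "max 0 (\<xi> - 1) \<le> \<xi>" using assms by auto
  show "continuous_on {max 0 (\<xi> - 1)..\<xi>} (\<lambda>t. u (\<xi> - t) t)"
    by (rule ac_continuous_on[OF u_char(1) u_char(2)]) (use assms m in auto)
  show "continuous_on {max 0 (\<xi> - 1)..\<xi>} (\<lambda>t. uh (\<xi> - t) t)"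
    by (rule ac_continuous_on[OF uh_char(1) uh_char(2)]) (use assms m in auto)
qed

lemma sup_norms_measurable:
  "(\<lambda>t. sup_norm (\<lambda>x. u x t)) \<in> borel_measurable (lebesgue_on {0..})"
  "(\<lambda>t. sup_norm (\<lambda>x. uh x t)) \<in> borel_measurable (lebesgue_on {0..})"
  by (intro sup_norm_measurable char_continuous; assumption)+

lemma l2_norms_measurable:
  "(\<lambda>t. ennreal (l2_norm (\<lambda>x. u x t))) \<in> borel_measurable (lebesgue_on {0..})"
  "(\<lambda>t. ennreal (l2_norm (\<lambda>x. uh x t))) \<in> borel_measurable (lebesgue_on {0..})"
proof -
  \<comment> \<open>The majorant has to be a function of x + t; this is why the state is bounded by
    the trace at the end of its characteristic.\<close>
  define H where "H T \<xi> = \<bar>v \<xi>\<bar> + \<bar>cut (\<lambda>z. e z 0) \<xi>\<bar> + 5 * B * N 0 (T + 1)" for T \<xi>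
  have Hi: "(\<lambda>\<xi>. (H T \<xi>)\<^sup>2) integrable_on {0..T+1}" for T
  proof -
    have "H T square_integrable_on {0..T+1}"
      unfolding H_def
      by (intro square_integrable_add square_integrable_abs square_integrable_const v_sq cut_square_integrable(1) e_sq) auto
    then show ?thesis by (simp add: square_integrable_on_def)
  qed
  have b: "\<bar>u x t\<bar> \<le> H T (x + t) \<and> \<bar>uh x t\<bar> \<le> H T (x + t)" if x: "x \<in> {0..1}" and t: "t \<in> {0..T}" for x t T
  proof -
    have "B * N t (t + x) \<le> B * N 0 (T + 1)" using B x t by (intro mult_left_mono N_mono) auto
    moreover have "B * N (max 0 (t - 1)) t \<le> B * N 0 (T + 1)" using B t by (intro mult_left_mono N_mono) auto
    moreover have "0 \<le> B * N 0 (T + 1)" using B N_nonneg[of 0 "T+1"] by simp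
    moreover have "\<bar>uh x t\<bar> \<le> \<bar>u x t\<bar> + \<bar>e x t\<bar>" by (simp add: e_def)
    moreover have "\<bar>u x t\<bar> \<le> \<bar>v (x + t)\<bar> + B * N t (t + x)" using u_to_trace(1)[OF x] t by auto
    moreover have "\<bar>e x t\<bar> \<le> \<bar>cut (\<lambda>z. e z 0) (x + t)\<bar> + 4 * B * N (max 0 (t - 1)) t"
      using e_pointwise[OF x] t by auto
    moreover have "0 \<le> \<bar>cut (\<lambda>z. e z 0) (x + t)\<bar>" by simp
    ultimately show ?thesis unfolding H_def by linarith
  qed
  have meas: "(\<lambda>t. ennreal (f t)) \<in> borel_measurable (lebesgue_on {0..})"
    if "\<And>T. T \<ge> 0 \<Longrightarrow> continuous_on {0..T} f" for f :: "real \<Rightarrow> real"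
  proof -
    have "f \<in> borel_measurable (lebesgue_on {0..})"
      by (intro continuous_imp_measurable_on_sets_lebesgue continuous_on_halfline that) auto
    then show ?thesis by measurable
  qed
  show "(\<lambda>t. ennreal (l2_norm (\<lambda>x. u x t))) \<in> borel_measurable (lebesgue_on {0..})"
    by (rule meas, rule l2_norm_continuous_on[OF char_continuous(1) u_sq Hi]) (use b in auto)
  show "(\<lambda>t. ennreal (l2_norm (\<lambda>x. uh x t))) \<in> borel_measurable (lebesgue_on {0..})"
    by (rule meas, rule l2_norm_continuous_on[OF char_continuous(2) uh_sq Hi]) (use b in auto)
qed

lemma l2_norms_time_spaces:
  "(\<lambda>t. ennreal (l2_norm (\<lambda>x. u x t))) \<in> L2_time {0..} \<inter> Linf_time {0..}"
  "(\<lambda>t. ennreal (l2_norm (\<lambda>x. uh x t))) \<in> L2_time {0..} \<inter> Linf_time {0..}"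
proof -
  let ?D = "(15 + 3 * C9\<^sup>2) * S0"
  have D: "0 \<le> ?D" using S0_bounds by simp
  have le: "ennreal (l2_norm f) \<le> ennreal (sqrt (w t + (if t \<le> 1 then ?D else 0)))"
    if "t \<le> 1 \<Longrightarrow> integral {0..1} (\<lambda>x. (f x)\<^sup>2) \<le> ?D" "1 < t \<Longrightarrow> integral {0..1} (\<lambda>x. (f x)\<^sup>2) \<le> w t" for f t
    unfolding l2_norm_def using that w_nonneg[of t] by (intro ennreal_leI real_sqrt_le_mono) (auto split: if_splits)
  show "(\<lambda>t. ennreal (l2_norm (\<lambda>x. u x t))) \<in> L2_time {0..} \<inter> Linf_time {0..}"
    by (rule time_spaces[OF l2_norms_measurable(1) _ D], simp, rule le) (use early_l2(1) late_l2(1) in auto)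
  show "(\<lambda>t. ennreal (l2_norm (\<lambda>x. uh x t))) \<in> L2_time {0..} \<inter> Linf_time {0..}"
    by (rule time_spaces[OF l2_norms_measurable(2) _ D], simp, rule le) (use early_l2(2) late_l2(2) in auto)
qed

lemma sup_norms_late:
  assumes "1 \<le> t"
  shows "sup_norm (\<lambda>x. u x t) \<le> ennreal (sqrt (w t))" "sup_norm (\<lambda>x. uh x t) \<le> ennreal (sqrt (w t))"
  using late_bound[OF _ assms] w_nonneg[of t] by (simp_all add: sup_norm_le_iff)

text \<open>Starts at time 1 because square integrable initial data may be unbounded, and up to time
  1 they still travel through the strip.\<close>

lemma sup_norms_late_time_spaces:
  "(\<lambda>t. sup_norm (\<lambda>x. u x t)) \<in> L2_time {1..} \<inter> Linf_time {1..}"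
  "(\<lambda>t. sup_norm (\<lambda>x. uh x t)) \<in> L2_time {1..} \<inter> Linf_time {1..}"
  by (rule time_spaces[where D = 0]; use sup_norms_measurable sup_norms_late in simp)+

text \<open>Bounded initial data close the gap before time 1: the terms with \<open>cut\<close> in
  the early bounds are then bounded pointwise by a constant.\<close>

lemma sup_norms_time_spaces:
  assumes fin: "sup_norm (\<lambda>x. u x 0) < \<infinity>" "sup_norm (\<lambda>x. uh x 0) < \<infinity>"
  shows "(\<lambda>t. sup_norm (\<lambda>x. u x t)) \<in> L2_time {0..} \<inter> Linf_time {0..}"
    and "(\<lambda>t. sup_norm (\<lambda>x. uh x t)) \<in> L2_time {0..} \<inter> Linf_time {0..}"
proof -
  obtain a where a: "0 \<le> a" "sup_norm (\<lambda>x. u x 0) = ennreal a" using fin(1) by (cases "sup_norm (\<lambda>x. u x 0)") auto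
  obtain b where b: "0 \<le> b" "sup_norm (\<lambda>x. uh x 0) = ennreal b" using fin(2) by (cases "sup_norm (\<lambda>x. uh x 0)") auto
  have u0: "\<bar>u x 0\<bar> \<le> a" and uh0: "\<bar>uh x 0\<bar> \<le> b" if "x \<in> {0..1}" for x
    using that a b sup_norm_le_iff[of a "\<lambda>x. u x 0"] sup_norm_le_iff[of b "\<lambda>x. uh x 0"] by auto
  define c where "c = a + (a + b) + C9 * sqrt S0"
  have c0: "0 \<le> C9 * sqrt S0" using const_nonneg S0_bounds by simp
  then have c: "0 \<le> c" using a b by (simp add: c_def)
  have cu: "\<bar>cut (\<lambda>z. u z 0) z\<bar> \<le> a" "\<bar>cut (\<lambda>z. e z 0) z\<bar> \<le> a + b" if "0 \<le> z" for z
    using that u0[of z] uh0[of z] a b by (auto simp: cut_def e_def)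
  have le: "\<bar>u x t\<bar> \<le> sqrt (w t + (if t \<le> 1 then c\<^sup>2 else 0))" "\<bar>uh x t\<bar> \<le> sqrt (w t + (if t \<le> 1 then c\<^sup>2 else 0))"
    if x: "x \<in> {0..1}" and t: "0 \<le> t" for x t
  proof -
    have sc: "c \<le> sqrt (w t + c\<^sup>2)" using w_nonneg[of t] by (intro real_le_rsqrt) simp
    have "\<bar>u x t\<bar> \<le> c \<and> \<bar>uh x t\<bar> \<le> c" if "t \<le> 1"
      using early_bound[OF x, of t] cu[of "x + t"] x t that a b unfolding c_def by auto
    then show "\<bar>u x t\<bar> \<le> sqrt (w t + (if t \<le> 1 then c\<^sup>2 else 0))" "\<bar>uh x t\<bar> \<le> sqrt (w t + (if t \<le> 1 then c\<^sup>2 else 0))"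
      using sc late_bound[OF x, of t] by (cases "t \<le> 1"; auto)+
  qed
  have g0: "0 \<le> sqrt (w t + (if t \<le> 1 then c\<^sup>2 else 0))" for t using w_nonneg[of t] by auto
  show "(\<lambda>t. sup_norm (\<lambda>x. u x t)) \<in> L2_time {0..} \<inter> Linf_time {0..}"
    by (rule time_spaces[OF sup_norms_measurable(1), where D = "c\<^sup>2"])
      (use le(1) in \<open>auto simp: sup_norm_le_iff[OF g0]\<close>)
  show "(\<lambda>t. sup_norm (\<lambda>x. uh x t)) \<in> L2_time {0..} \<inter> Linf_time {0..}"
    by (rule time_spaces[OF sup_norms_measurable(2), where D = "c\<^sup>2"])
      (use le(2) in \<open>auto simp: sup_norm_le_iff[OF g0]\<close>)
qed

lemma sup_norms_tendsto:
  "((\<lambda>t. sup_norm (\<lambda>x. u x t)) \<longlongrightarrow> 0) at_top"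
  "((\<lambda>t. sup_norm (\<lambda>x. uh x t)) \<longlongrightarrow> 0) at_top"
proof -
  have "((\<lambda>t. ennreal (sqrt (w t))) \<longlongrightarrow> ennreal (sqrt 0)) at_top"
    by (intro tendsto_ennrealI tendsto_real_sqrt w_tendsto)
  then have z: "((\<lambda>t. ennreal (sqrt (w t))) \<longlongrightarrow> 0) at_top" by simp
  have "\<forall>\<^sub>F t in at_top. sup_norm (\<lambda>x. u x t) \<le> ennreal (sqrt (w t))"
    using eventually_ge_at_top[of 1] by eventually_elim (rule sup_norms_late(1))
  moreover have "\<forall>\<^sub>F t in at_top. sup_norm (\<lambda>x. uh x t) \<le> ennreal (sqrt (w t))"
    using eventually_ge_at_top[of 1] by eventually_elim (rule sup_norms_late(2))
  ultimately show "((\<lambda>t. sup_norm (\<lambda>x. u x t)) \<longlongrightarrow> 0) at_top" "((\<lambda>t. sup_norm (\<lambda>x. uh x t)) \<longlongrightarrow> 0) at_top"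
    by (auto intro: tendsto_sandwich[OF _ _ tendsto_const z])
qed

end

section \<open>Conclusions for every solution, with constants chosen beforehand\<close>

theorem theorem6:
  fixes B \<gamma> \<gamma>\<^sub>0 M K \<epsilon> :: real
    and \<beta> \<sigma> :: "real \<Rightarrow> real"
    and Khat :: "(real \<Rightarrow> real) \<Rightarrow> real \<Rightarrow> real"
  assumes "B > 0" and "\<gamma> > 0" and "\<gamma>\<^sub>0 > 0"
    and "M \<ge> B" and "K > 0"
    and "continuous_on {0..1} \<beta>" and "sup_norm \<beta> \<le> ennreal B"
    and "0 < \<epsilon>" and "\<epsilon> < exp (- 3 / 2) / (sqrt 2 * (1 + B))"
    and "neural_operator (admissible_set M K) \<sigma> \<epsilon> Khat"
  shows
    "(\<forall>u uh bh.
        closed_loop_solution B \<gamma> \<gamma>\<^sub>0 \<beta> Khat u uh bh \<and>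
        (\<forall>t\<ge>0. K-lipschitz_on {0..1} (\<lambda>x. bh x t)) \<longrightarrow>
          {\<lambda>t. ennreal (l2_norm (\<lambda>x. u x t)), \<lambda>t. ennreal (l2_norm (\<lambda>x. uh x t))}
            \<subseteq> L2_time {0..} \<inter> Linf_time {0..} \<and>
          {\<lambda>t. sup_norm (\<lambda>x. u x t), \<lambda>t. sup_norm (\<lambda>x. uh x t)}
            \<subseteq> L2_time {1..} \<inter> Linf_time {1..} \<and>
          (sup_norm (\<lambda>x. u x 0) < \<infinity> \<and> sup_norm (\<lambda>x. uh x 0) < \<infinity> \<longrightarrow>
             {\<lambda>t. sup_norm (\<lambda>x. u x t), \<lambda>t. sup_norm (\<lambda>x. uh x t)}
               \<subseteq> L2_time {0..} \<inter> Linf_time {0..}) \<and>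
          ((\<lambda>t. sup_norm (\<lambda>x. u x t)) \<longlongrightarrow> 0) at_top \<and>
          ((\<lambda>t. sup_norm (\<lambda>x. uh x t)) \<longlongrightarrow> 0) at_top) \<and>
     (\<exists>\<rho>>0. \<exists>R>0. \<forall>u uh bh.
        closed_loop_solution B \<gamma> \<gamma>\<^sub>0 \<beta> Khat u uh bh \<and>
        (\<forall>t\<ge>0. K-lipschitz_on {0..1} (\<lambda>x. bh x t)) \<longrightarrow>
          (\<forall>t\<ge>0. S_fun \<beta> u uh bh t
                   \<le> R * S_fun \<beta> u uh bh 0 * exp (\<rho> * S_fun \<beta> u uh bh 0)))"
proof -
  interpret control_setting B \<gamma> \<gamma>\<^sub>0 M K \<epsilon> \<beta> \<sigma> Khat
    using assms by unfold_locales
  have cl: "closed_loop B \<gamma> \<gamma>\<^sub>0 M K \<epsilon> \<beta> \<sigma> Khat u uh bh"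
    if "closed_loop_solution B \<gamma> \<gamma>\<^sub>0 \<beta> Khat u uh bh \<and> (\<forall>t\<ge>0. K-lipschitz_on {0..1} (\<lambda>x. bh x t))" for u uh bh
    using that by unfold_locales auto
  show ?thesis
  proof (intro conjI allI impI)
    fix u uh bh
    assume s: "closed_loop_solution B \<gamma> \<gamma>\<^sub>0 \<beta> Khat u uh bh \<and> (\<forall>t\<ge>0. K-lipschitz_on {0..1} (\<lambda>x. bh x t))"
    interpret closed_loop B \<gamma> \<gamma>\<^sub>0 M K \<epsilon> \<beta> \<sigma> Khat u uh bh by (rule cl[OF s])
    show "{\<lambda>t. ennreal (l2_norm (\<lambda>x. u x t)), \<lambda>t. ennreal (l2_norm (\<lambda>x. uh x t))} \<subseteq> L2_time {0..} \<inter> Linf_time {0..}"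
      using l2_norms_time_spaces by blast
    show "{\<lambda>t. sup_norm (\<lambda>x. u x t), \<lambda>t. sup_norm (\<lambda>x. uh x t)} \<subseteq> L2_time {1..} \<inter> Linf_time {1..}"
      using sup_norms_late_time_spaces by blast
    show "{\<lambda>t. sup_norm (\<lambda>x. u x t), \<lambda>t. sup_norm (\<lambda>x. uh x t)} \<subseteq> L2_time {0..} \<inter> Linf_time {0..}"
      if "sup_norm (\<lambda>x. u x 0) < \<infinity> \<and> sup_norm (\<lambda>x. uh x 0) < \<infinity>"
      using sup_norms_time_spaces that by blast
    show "((\<lambda>t. sup_norm (\<lambda>x. u x t)) \<longlongrightarrow> 0) at_top" "((\<lambda>t. sup_norm (\<lambda>x. uh x t)) \<longlongrightarrow> 0) at_top"
      by (rule sup_norms_tendsto)+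
  next
    \<comment> \<open>The witnesses must be positive before any solution is given, whereas the
      positivity lemmas for \<rho> and \<open>R\<close> live in the locale with a solution. So
      \<rho> is treated again from the data alone and \<open>R\<close> is replaced by its maximum
      with 1.\<close>
    have pos: "0 < \<rho>" "0 < max 1 R"
    proof -
      have "0 \<le> 4 * \<theta> * (C6 / \<gamma>\<^sub>0)" using theta_nonneg C_nonneg gam0 by auto
      then show "0 < \<rho>" by (simp add: \<rho>_def)
    qed simp
    show "\<exists>\<rho>>0. \<exists>R>0. \<forall>u uh bh.
        closed_loop_solution B \<gamma> \<gamma>\<^sub>0 \<beta> Khat u uh bh \<and>
        (\<forall>t\<ge>0. K-lipschitz_on {0..1} (\<lambda>x. bh x t)) \<longrightarrow>
          (\<forall>t\<ge>0. S_fun \<beta> u uh bh t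
                   \<le> R * S_fun \<beta> u uh bh 0 * exp (\<rho> * S_fun \<beta> u uh bh 0))"
    proof (rule exI[of _ \<rho>], intro conjI pos, rule exI[of _ "max 1 R"], intro conjI pos allI impI)
      fix u uh bh and t :: real
      assume s: "closed_loop_solution B \<gamma> \<gamma>\<^sub>0 \<beta> Khat u uh bh \<and> (\<forall>t\<ge>0. K-lipschitz_on {0..1} (\<lambda>x. bh x t))"
        and t: "0 \<le> t"
      interpret closed_loop B \<gamma> \<gamma>\<^sub>0 M K \<epsilon> \<beta> \<sigma> Khat u uh bh by (rule cl[OF s])
      have "S_fun \<beta> u uh bh t \<le> R * S0 * exp (\<rho> * S0)" by (rule stability_estimate[OF t])
      also have "\<dots> \<le> max 1 R * S0 * exp (\<rho> * S0)"
        using S0_bounds(1) by (intro mult_right_mono) auto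
      finally show "S_fun \<beta> u uh bh t \<le> max 1 R * S_fun \<beta> u uh bh 0 * exp (\<rho> * S_fun \<beta> u uh bh 0)"
        by (simp add: S0_def)
    qed
  qed
qed

end
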